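(* Let $G$ be a finite quasiprimitive permutation group on a set $\Omega$. Then either (i) $\rho(G,\Omega)=1$ and $G$ has the EKR property, or (ii) $G$ is an almost simple group or a quasiprimitive group of product action type. Moreover, for primitive groups in case (ii), $\rho(G,\Omega)$ can be arbitrarily large: for every $M>0$ there exist an almost simple primitive permutation group $A\leqslant\mathrm{Sym}(\Gamma)$ and a primitive permutation group $P\leqslant\mathrm{Sym}(\Delta)$ of product action type such that $\rho(A,\Gamma)>M$ and $\rho(P,\Delta)>M$.
   Context: A finite permutation group is quasiprimitive if each of its nontrivial normal subgroups is transitive. Elements $x,y\in G$ intersect if some $\alpha\in\Omega$ satisfies $\alpha^{xy^{-1}}=\alpha$; a subset $S\subseteq G$ is an intersecting set if every two elements of $S$ intersect; it is maximum if it has the largest possible size among intersecting sets. For transitive $G$, $\rho(G,\Omega)$ denotes $|S|/|G_\omega|$ for $S$ a maximum intersecting set and $G_\omega$ a point stabilizer. $G$ has the EKR property if its point stabilizers are maximum intersecting sets. An almost simple group is a group $G$ with $T\leqslant G\leqslant\mathrm{Aut}(T)$ for some nonabelian simple group $T$. "Product action type" refers to the quasiprimitive type PA in Praeger's O'Nan–Scott classification of quasiprimitive groups: $G$ has a unique minimal normal subgroup $N\cong T^k$ with $T$ nonabelian simple and $k\ge2$, and $G$ is permutation equivalent to a subgroup of a wreath product $H\wr \mathrm{S}_k$ in product action on $\Delta^k$ where $H\leqslant\mathrm{Sym}(\Delta)$ is almost simple with socle $T$ (with $N$ not regular).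
   Formalization: Product action type is taken in Praeger's sense: G acts faithfully in product action on some G-invariant partition of Ω, not necessarily on Ω itself; requiring Ω = Δ^k makes the claim false (A5 wr S2 of degree 1800). For primitive groups the two notions agree. *)

theory Defs
  imports Complex_Main "HOL-Algebra.Algebra" "HOL-Library.Disjoint_Sets"
begin

section \<open>Permutation groups\<close>

text \<open>
  A permutation group on \<open>\<Omega>\<close> is given by its set \<open>G\<close> of elements, a subgroup of the library's
  symmetric group \<^term>\<open>BijGroup \<Omega>\<close>, whose product \<open>g \<otimes> f\<close> is the composite \<open>g \<circ> f\<close> (left
  actions).  \<open>\<Omega>\<close> is nonempty, as point stabilizers are spoken of throughout.
\<close>

abbreviation perm_grp :: "'a set \<Rightarrow> ('a \<Rightarrow> 'a) set \<Rightarrow> ('a \<Rightarrow> 'a) monoid" where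
  "perm_grp \<Omega> G \<equiv> (BijGroup \<Omega>)\<lparr>carrier := G\<rparr>"

definition finite_permutation_group :: "'a set \<Rightarrow> ('a \<Rightarrow> 'a) set \<Rightarrow> bool" where
  "finite_permutation_group \<Omega> G \<longleftrightarrow> finite \<Omega> \<and> \<Omega> \<noteq> {} \<and> subgroup G (BijGroup \<Omega>)"

abbreviation perm_transitive :: "'a set \<Rightarrow> ('a \<Rightarrow> 'a) set \<Rightarrow> bool" where
  "perm_transitive \<Omega> G \<equiv> transitive_action (perm_grp \<Omega> G) \<Omega> (\<lambda>g. g)"

abbreviation point_stabilizer :: "'a set \<Rightarrow> ('a \<Rightarrow> 'a) set \<Rightarrow> 'a \<Rightarrow> ('a \<Rightarrow> 'a) set" where
  "point_stabilizer \<Omega> G \<omega> \<equiv> stabilizer (perm_grp \<Omega> G) (\<lambda>g. g) \<omega>"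

definition perm_regular :: "'a set \<Rightarrow> ('a \<Rightarrow> 'a) set \<Rightarrow> bool" where
  "perm_regular \<Omega> G \<longleftrightarrow>
     perm_transitive \<Omega> G \<and> (\<forall>\<omega>\<in>\<Omega>. point_stabilizer \<Omega> G \<omega> = {\<one>\<^bsub>BijGroup \<Omega>\<^esub>})"

definition quasiprimitive :: "'a set \<Rightarrow> ('a \<Rightarrow> 'a) set \<Rightarrow> bool" where
  "quasiprimitive \<Omega> G \<longleftrightarrow>
     (\<forall>N. N \<lhd> perm_grp \<Omega> G \<and> N \<noteq> {\<one>\<^bsub>BijGroup \<Omega>\<^esub>} \<longrightarrow> perm_transitive \<Omega> N)"

definition invariant_partition :: "'a set \<Rightarrow> ('a \<Rightarrow> 'a) set \<Rightarrow> 'a set set \<Rightarrow> bool" where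
  "invariant_partition \<Omega> G P \<longleftrightarrow> partition_on \<Omega> P \<and> (\<forall>g\<in>G. \<forall>B\<in>P. g ` B \<in> P)"

definition primitive :: "'a set \<Rightarrow> ('a \<Rightarrow> 'a) set \<Rightarrow> bool" where
  "primitive \<Omega> G \<longleftrightarrow> perm_transitive \<Omega> G \<and>
     (\<forall>P. invariant_partition \<Omega> G P \<longrightarrow> P = {\<Omega>} \<or> P = (\<lambda>\<omega>. {\<omega>}) ` \<Omega>)"

definition perm_equivalent ::
    "'a set \<Rightarrow> ('a \<Rightarrow> 'a) set \<Rightarrow> 'b set \<Rightarrow> ('b \<Rightarrow> 'b) set \<Rightarrow> bool" where
  "perm_equivalent \<Omega> G \<Lambda> K \<longleftrightarrow>
     (\<exists>f \<psi>. bij_betw f \<Omega> \<Lambda> \<and> \<psi> \<in> iso (perm_grp \<Omega> G) (perm_grp \<Lambda> K) \<and>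
        (\<forall>g\<in>G. \<forall>\<omega>\<in>\<Omega>. f (g \<omega>) = \<psi> g (f \<omega>)))"


section \<open>Intersecting sets\<close>

text \<open>
  \<open>x\<close> and \<open>y\<close> intersect iff \<open>x y\<^sup>-\<^sup>1\<close> has a fixed point.  With right actions this says that \<open>x\<close> and
  \<open>y\<close> agree at \<open>\<alpha>\<close>, with left actions that they agree at \<open>y\<^sup>-\<^sup>1 \<alpha>\<close>; the relation is the same.
\<close>

definition elements_intersect :: "'a set \<Rightarrow> ('a \<Rightarrow> 'a) \<Rightarrow> ('a \<Rightarrow> 'a) \<Rightarrow> bool" where
  "elements_intersect \<Omega> x y \<longleftrightarrow>
     (\<exists>\<alpha>\<in>\<Omega>. (x \<otimes>\<^bsub>BijGroup \<Omega>\<^esub> inv\<^bsub>BijGroup \<Omega>\<^esub> y) \<alpha> = \<alpha>)"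

definition intersecting_set :: "'a set \<Rightarrow> ('a \<Rightarrow> 'a) set \<Rightarrow> ('a \<Rightarrow> 'a) set \<Rightarrow> bool" where
  "intersecting_set \<Omega> G S \<longleftrightarrow> S \<subseteq> G \<and> (\<forall>x\<in>S. \<forall>y\<in>S. elements_intersect \<Omega> x y)"

definition maximum_intersecting_set :: "'a set \<Rightarrow> ('a \<Rightarrow> 'a) set \<Rightarrow> ('a \<Rightarrow> 'a) set \<Rightarrow> bool" where
  "maximum_intersecting_set \<Omega> G S \<longleftrightarrow> intersecting_set \<Omega> G S \<and>
     (\<forall>S'. intersecting_set \<Omega> G S' \<longrightarrow> card S' \<le> card S)"

text \<open>For transitive \<open>G\<close> the value depends neither on the choice of \<open>S\<close> nor on that of \<open>\<omega>\<close>.\<close>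

definition intersection_density :: "'a set \<Rightarrow> ('a \<Rightarrow> 'a) set \<Rightarrow> real" where
  "intersection_density \<Omega> G =
     real (card (SOME S. maximum_intersecting_set \<Omega> G S)) /
     real (card (point_stabilizer \<Omega> G (SOME \<omega>. \<omega> \<in> \<Omega>)))"

definition EKR_property :: "'a set \<Rightarrow> ('a \<Rightarrow> 'a) set \<Rightarrow> bool" where
  "EKR_property \<Omega> G \<longleftrightarrow>
     (\<forall>\<omega>\<in>\<Omega>. maximum_intersecting_set \<Omega> G (point_stabilizer \<Omega> G \<omega>))"


section \<open>Almost simple groups and socles\<close>

definition nonabelian_simple :: "('a, 'b) monoid_scheme \<Rightarrow> bool" where
  "nonabelian_simple T \<longleftrightarrow> simple_group T \<and> \<not> comm_group T"

definition inner_automorphisms :: "('a, 'b) monoid_scheme \<Rightarrow> ('a \<Rightarrow> 'a) set" where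
  "inner_automorphisms T =
     {\<lambda>x\<in>carrier T. t \<otimes>\<^bsub>T\<^esub> x \<otimes>\<^bsub>T\<^esub> inv\<^bsub>T\<^esub> t | t. t \<in> carrier T}"

text \<open>
  \<open>T \<le> G \<le> Aut(T)\<close>, where \<open>T\<close> is identified with \<open>Inn(T)\<close> and \<open>G\<close> with its image under \<open>\<phi>\<close>.
  Taking \<open>T\<close> on the element type of \<open>G\<close> is no restriction, since such a \<open>T\<close> embeds in \<open>G\<close>.
\<close>

definition almost_simple :: "('a, 'b) monoid_scheme \<Rightarrow> bool" where
  "almost_simple G \<longleftrightarrow> group G \<and>
     (\<exists>(T :: 'a monoid) \<phi>. nonabelian_simple T \<and> \<phi> \<in> hom G (AutoGroup T) \<and>
        inj_on \<phi> (carrier G) \<and> inner_automorphisms T \<subseteq> \<phi> ` carrier G)"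

definition minimal_normal :: "('a, 'b) monoid_scheme \<Rightarrow> 'a set \<Rightarrow> bool" where
  "minimal_normal G N \<longleftrightarrow> N \<lhd> G \<and> N \<noteq> {\<one>\<^bsub>G\<^esub>} \<and>
     (\<forall>M. M \<lhd> G \<and> M \<noteq> {\<one>\<^bsub>G\<^esub>} \<and> M \<subseteq> N \<longrightarrow> M = N)"

definition socle :: "('a, 'b) monoid_scheme \<Rightarrow> 'a set" where
  "socle G = generate G (\<Union> {N. minimal_normal G N})"


section \<open>Product action type\<close>

text \<open>
  \<open>H wr S\<^sub>k\<close> in product action on \<open>\<Delta>\<^sup>k\<close>, as a set of permutations of \<open>\<Delta>\<^sup>k\<close>: permute the \<open>k\<close>
  coordinates by \<open>\<sigma>\<close>, then apply \<open>h i \<in> H\<close> in the \<open>i\<close>-th one.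
\<close>

definition cartesian_power :: "'a set \<Rightarrow> nat \<Rightarrow> (nat \<Rightarrow> 'a) set" where
  "cartesian_power \<Delta> k = {..<k} \<rightarrow>\<^sub>E \<Delta>"

definition wreath_product_action ::
    "'a set \<Rightarrow> ('a \<Rightarrow> 'a) set \<Rightarrow> nat \<Rightarrow> ((nat \<Rightarrow> 'a) \<Rightarrow> (nat \<Rightarrow> 'a)) set" where
  "wreath_product_action \<Delta> H k =
     {\<lambda>\<delta>\<in>cartesian_power \<Delta> k. \<lambda>i\<in>{..<k}. h i (\<delta> (inv_into UNIV \<sigma> i)) | h \<sigma>.
        h \<in> {..<k} \<rightarrow> H \<and> \<sigma> permutes {..<k}}"

definition partition_action :: "'a set set \<Rightarrow> ('a \<Rightarrow> 'a) \<Rightarrow> ('a set \<Rightarrow> 'a set)" where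
  "partition_action P g = (\<lambda>B\<in>P. g ` B)"

text \<open>
  In Praeger's type PA for quasiprimitive groups, the product structure is carried by a
  \<open>G\<close>-invariant partition \<open>P\<close> of \<open>\<Omega>\<close> on which \<open>G\<close> acts faithfully, not necessarily by \<open>\<Omega>\<close> itself:
  there are such \<open>G\<close> whose degree is not a proper power, e.g. \<open>A\<^sub>5 wr S\<^sub>2\<close> on the \<open>1800\<close> cosets of
  \<open>{(r,r) | r \<in> R} \<times> S\<^sub>2\<close> with \<open>R\<close> of order 2.  If \<open>G\<close> is primitive, faithfulness forces \<open>P\<close> to
  consist of singletons (\<open>G\<close> is nontrivial), so that \<open>G\<close> itself is permutation equivalent to a
  subgroup of \<open>H wr S\<^sub>k\<close> in product action on \<open>\<Delta>\<^sup>k\<close>.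

  The types of \<open>T\<close> and \<open>\<Delta>\<close> are no restriction: \<open>T\<close> embeds in \<open>G\<close>, and \<open>\<Delta>\<close> is finite.
\<close>

definition product_action_type :: "'a set \<Rightarrow> ('a \<Rightarrow> 'a) set \<Rightarrow> bool" where
  "product_action_type \<Omega> G \<longleftrightarrow> quasiprimitive \<Omega> G \<and>
     (\<exists>N (T :: ('a \<Rightarrow> 'a) monoid) k.
        {M. minimal_normal (perm_grp \<Omega> G) M} = {N} \<and>
        nonabelian_simple T \<and> k \<ge> 2 \<and>
        perm_grp \<Omega> N \<cong> product_group {..<k} (\<lambda>_. T) \<and>
        \<not> perm_regular \<Omega> N \<and>
        (\<exists>P (\<Delta> :: nat set) H K.
           invariant_partition \<Omega> G P \<and> inj_on (partition_action P) G \<and>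
           finite_permutation_group \<Delta> H \<and> almost_simple (perm_grp \<Delta> H) \<and>
           perm_grp \<Delta> (socle (perm_grp \<Delta> H)) \<cong> T \<and>
           subgroup K (BijGroup (cartesian_power \<Delta> k)) \<and> K \<subseteq> wreath_product_action \<Delta> H k \<and>
           perm_equivalent P (partition_action P ` G) (cartesian_power \<Delta> k) K))"

end

theory Submission
  imports Defs "HOL-Library.Z2" "HOL-Library.Function_Algebras"
begin

text \<open>
  If a transitive group has a regular subgroup \<open>R\<close>, the translates of an intersecting set by the
  elements of \<open>R\<close> are disjoint, so the point stabilizers are maximum intersecting sets.  Let \<open>N\<close> be a
  minimal normal subgroup of a quasiprimitive group \<open>G\<close> and \<open>S\<close> a point stabilizer.  If \<open>N \<inter> S = 1\<close>,
  take \<open>R = N\<close>.  Otherwise \<open>C\<^sub>G(N) = 1\<close>, since \<open>N \<inter> S\<close> would be normalized by \<open>C\<^sub>G(N) S = G\<close>, and \<open>N\<close> is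
  the only minimal normal subgroup, a direct product of conjugate nonabelian simple groups \<open>T\<close>.  If
  \<open>N = T\<close>, then \<open>G\<close> is almost simple.  If \<open>C\<^sub>G(T)\<close> is transitive, every projection of \<open>N \<inter> S\<close> to a
  factor is onto, and any \<open>R\<close> maximal among the normal subgroups of \<open>N\<close> with \<open>R \<inter> S = 1\<close> is regular.
  If \<open>C\<^sub>G(T)\<close> is intransitive, the orbits of the groups \<open>C\<^sub>G(T)\<close>, one for each factor, are the
  coordinates of the product structure, and the component is \<open>N\<^sub>G(T)\<close> acting on the orbits of \<open>C\<^sub>G(T)\<close>.

  For the unbounded densities let \<open>G = GL(10c, 2)\<close> act on the cosets of the stabilizer \<open>H\<close> of a
  decomposition into five subspaces of dimension \<open>2c\<close>.  The elements with blocks \<open>1, *; 0, 1\<close> of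
  size \<open>5c\<close> form an elementary abelian group of order \<open>2\<close> to the \<open>25c\<^sup>2\<close>, and each of them is
  conjugate into \<open>H\<close> by the rank normal form, whereas \<open>|H|\<close> is only about \<open>2\<close> to the \<open>20c\<^sup>2\<close>.  The wreath
  product of this group with \<open>S\<^sub>2\<close> in product action has density at least half the square.
\<close>

section \<open>Minimal normal subgroups\<close>

text \<open>The structural half replaces points by a core-free subgroup \<open>S\<close>, with
  \<open>G = N S\<close> expressing transitivity. In the product case the coordinates need not
  separate points; what survives is faithfulness, because the elements fixing all coordinates form a
  normal subgroup, which would be transitive if nontrivial and would leave a single orbit for each
  centralizer.

  Over the field with two elements \<open>GL\<close> is itself simple in the dimensions used, and
  neither scalars nor determinants intervene. The matrices \<open>1, *; 0, 1\<close> are conjugate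
  when the blocks \<open>*\<close> have equal rank, and \<open>H\<close> realizes every such rank by
  pairing coordinates inside its blocks. With \<open>B\<close> blocks of dimension \<open>2c\<close>
  the abelian group has order 2 to the \<open>B^2 c^2\<close> and \<open>H\<close> about 2 to the
  \<open>4 B c^2\<close>; \<open>B = 5\<close> is the first value for which the quotient grows.

  The product action type of the wreath product is not verified from the definition: a density above
  1 excludes the first alternative, almost simplicity is excluded directly, and the first half of
  the theorem leaves only that type.\<close>

definition centralizer :: "('a, 'b) monoid_scheme \<Rightarrow> 'a set \<Rightarrow> 'a set" where
  "centralizer G A = {g \<in> carrier G. \<forall>a\<in>A. g \<otimes>\<^bsub>G\<^esub> a = a \<otimes>\<^bsub>G\<^esub> g}"

text \<open>\<open>H\<close> normalizes \<open>K\<close>, without asking for \<open>K\<close> to lie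
  in \<open>H\<close>. Normality in \<open>G\<close>, in \<open>N\<close> and in a factor can thus
  be compared using the operations of \<open>G\<close> alone.\<close>

definition conj_invariant :: "('a, 'b) monoid_scheme \<Rightarrow> 'a set \<Rightarrow> 'a set \<Rightarrow> bool" where
  "conj_invariant G H K \<longleftrightarrow> (\<forall>h\<in>H. \<forall>k\<in>K. h \<otimes>\<^bsub>G\<^esub> k \<otimes>\<^bsub>G\<^esub> inv\<^bsub>G\<^esub> h \<in> K)"

definition conj_image :: "('a, 'b) monoid_scheme \<Rightarrow> 'a \<Rightarrow> 'a set \<Rightarrow> 'a set" where
  "conj_image G g A = (\<lambda>a. g \<otimes>\<^bsub>G\<^esub> a \<otimes>\<^bsub>G\<^esub> inv\<^bsub>G\<^esub> g) ` A"

context group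
begin

lemma inv_mult_cancel: "\<lbrakk>x \<in> carrier G; y \<in> carrier G\<rbrakk> \<Longrightarrow> inv x \<otimes> (x \<otimes> y) = y"
  by (simp flip: m_assoc)

lemma mult_inv_cancel: "\<lbrakk>x \<in> carrier G; y \<in> carrier G\<rbrakk> \<Longrightarrow> x \<otimes> (inv x \<otimes> y) = y"
  by (simp flip: m_assoc)

text \<open>Group words become right-nested products with inverses pushed to the letters and
  adjacent inverse pairs cancelled. Most conjugation identities below are settled this way.\<close>

lemmas word_simps = m_assoc inv_mult_group inv_mult_cancel mult_inv_cancel

lemma conj_eq_self_iff:
  "\<lbrakk>x \<in> carrier G; y \<in> carrier G\<rbrakk> \<Longrightarrow> x \<otimes> y \<otimes> inv x = y \<longleftrightarrow> x \<otimes> y = y \<otimes> x"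
  by (metis inv_solve_right m_closed)

lemma normal_carrier: "\<lbrakk>N \<lhd> G; x \<in> N\<rbrakk> \<Longrightarrow> x \<in> carrier G"
  by (meson normal_imp_subgroup subgroup.mem_carrier)

lemma normal_iff_conj_invariant:
  "N \<lhd> G \<longleftrightarrow> subgroup N G \<and> conj_invariant G (carrier G) N"
  by (auto simp: normal_inv_iff conj_invariant_def)

lemma normal_subgroup_iff:
  assumes "subgroup H G"
  shows "K \<lhd> G\<lparr>carrier := H\<rparr> \<longleftrightarrow> subgroup K G \<and> K \<subseteq> H \<and> conj_invariant G H K"
proof -
  interpret H: group "G\<lparr>carrier := H\<rparr>" using assms by (rule subgroup_imp_group)
  have "subgroup K (G\<lparr>carrier := H\<rparr>) \<longleftrightarrow> subgroup K G \<and> K \<subseteq> H"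
    using incl_subgroup[OF assms, of K] subgroup.subset[of K "G\<lparr>carrier := H\<rparr>"]
      subgroup_incl[OF _ assms, of K] by auto
  thus ?thesis
    using m_inv_consistent[OF assms] by (simp add: H.normal_inv_iff conj_invariant_def cong: conj_cong)
qed

lemma centralizer_subgroup: "A \<subseteq> carrier G \<Longrightarrow> subgroup (centralizer G A) G"
proof (rule subgroupI)
  assume A: "A \<subseteq> carrier G"
  show "centralizer G A \<subseteq> carrier G" by (auto simp: centralizer_def)
  have "\<one> \<in> centralizer G A" using A by (auto simp: centralizer_def)
  thus "centralizer G A \<noteq> {}" by blast
  fix a assume a: "a \<in> centralizer G A"
  show "inv a \<in> centralizer G A"
  proof -
    have "inv a \<otimes> x = x \<otimes> inv a" if "x \<in> A" for x
    proof -
      have x: "x \<in> carrier G" "a \<in> carrier G" "a \<otimes> x = x \<otimes> a"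
        using that A a by (auto simp: centralizer_def)
      have "inv a \<otimes> (a \<otimes> x) \<otimes> inv a = inv a \<otimes> (x \<otimes> a) \<otimes> inv a" using x by simp
      thus ?thesis using x(1,2) by (simp add: word_simps)
    qed
    thus ?thesis using a by (auto simp: centralizer_def)
  qed
  fix b assume b: "b \<in> centralizer G A"
  have "a \<otimes> b \<otimes> x = x \<otimes> (a \<otimes> b)" if "x \<in> A" for x
  proof -
    have "x \<in> carrier G" "a \<in> carrier G" "b \<in> carrier G" "a \<otimes> x = x \<otimes> a" "b \<otimes> x = x \<otimes> b"
      using that A a b by (auto simp: centralizer_def)
    thus ?thesis by (metis m_assoc)
  qed
  thus "a \<otimes> b \<in> centralizer G A" using a b by (auto simp: centralizer_def)
qed

lemma centralizerD: "\<lbrakk>g \<in> centralizer G A; a \<in> A\<rbrakk> \<Longrightarrow> g \<otimes> a = a \<otimes> g"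
  by (simp add: centralizer_def)

lemma centralizer_carrier: "g \<in> centralizer G A \<Longrightarrow> g \<in> carrier G"
  by (simp add: centralizer_def)

lemma centralizer_conj:
  assumes "A \<subseteq> carrier G" "g \<in> carrier G" "c \<in> centralizer G A"
  shows "g \<otimes> c \<otimes> inv g \<in> centralizer G (conj_image G g A)"
proof -
  have "g \<otimes> c \<otimes> inv g \<otimes> (g \<otimes> a \<otimes> inv g) = g \<otimes> a \<otimes> inv g \<otimes> (g \<otimes> c \<otimes> inv g)"
    if "a \<in> A" for a
  proof -
    have c: "a \<in> carrier G" "c \<in> carrier G" and e: "c \<otimes> a = a \<otimes> c"
      using that assms by (auto simp: centralizer_def)
    have "g \<otimes> (c \<otimes> a) \<otimes> inv g = g \<otimes> (a \<otimes> c) \<otimes> inv g" by (simp only: e)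
    thus ?thesis using c assms(2) by (simp add: word_simps)
  qed
  thus ?thesis using assms by (auto simp: centralizer_def conj_image_def)
qed

lemma conj_image_self:
  assumes "finite K" "K \<subseteq> carrier G" "h \<in> carrier G" "\<And>k. k \<in> K \<Longrightarrow> h \<otimes> k \<otimes> inv h \<in> K"
  shows "conj_image G h K = K"
proof -
  have "inj_on (\<lambda>a. h \<otimes> a \<otimes> inv h) K"
    using assms(2,3) by (auto intro!: inj_onI simp: subset_iff)
  moreover have "conj_image G h K \<subseteq> K" using assms by (auto simp: conj_image_def)
  ultimately show ?thesis unfolding conj_image_def
    by (metis assms(1) endo_inj_surj)
qed

lemma conj_image_one: "A \<subseteq> carrier G \<Longrightarrow> conj_image G \<one> A = A"
  by (force simp: conj_image_def)

lemma conj_image_mult: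
  assumes "A \<subseteq> carrier G" "g \<in> carrier G" "h \<in> carrier G"
  shows "conj_image G (g \<otimes> h) A = conj_image G g (conj_image G h A)"
proof -
  have "g \<otimes> h \<otimes> a \<otimes> inv (g \<otimes> h) = g \<otimes> (h \<otimes> a \<otimes> inv h) \<otimes> inv g" if "a \<in> A" for a
    using that assms by (simp add: subset_iff word_simps)
  thus ?thesis by (force simp: conj_image_def)
qed

lemma conj_image_subset: "\<lbrakk>A \<subseteq> carrier G; g \<in> carrier G\<rbrakk> \<Longrightarrow> conj_image G g A \<subseteq> carrier G"
  by (auto simp: conj_image_def)

lemma conj_image_inv:
  assumes "A \<subseteq> carrier G" "g \<in> carrier G"
  shows "conj_image G (inv g) (conj_image G g A) = A"
  using assms by (simp add: conj_image_one flip: conj_image_mult)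

lemma conj_image_subgroup:
  assumes "subgroup H G" "g \<in> carrier G"
  shows "subgroup (conj_image G g H) G"
proof (rule subgroupI)
  have H: "H \<subseteq> carrier G" using assms by (simp add: subgroup.subset)
  show "conj_image G g H \<subseteq> carrier G" using H assms by (rule_tac conj_image_subset)
  show "conj_image G g H \<noteq> {}" using assms by (auto simp: conj_image_def dest: subgroup.one_closed)
  fix a assume "a \<in> conj_image G g H"
  then obtain x where x: "x \<in> H" "a = g \<otimes> x \<otimes> inv g" by (auto simp: conj_image_def)
  have "inv a = g \<otimes> inv x \<otimes> inv g" using x H assms by (simp add: subset_iff word_simps)
  thus "inv a \<in> conj_image G g H" using x assms by (auto simp: conj_image_def dest: subgroup.m_inv_closed)
  fix b assume "b \<in> conj_image G g H"
  then obtain y where y: "y \<in> H" "b = g \<otimes> y \<otimes> inv g" by (auto simp: conj_image_def)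
  have "a \<otimes> b = g \<otimes> (x \<otimes> y) \<otimes> inv g" using x y H assms by (simp add: subset_iff word_simps)
  thus "a \<otimes> b \<in> conj_image G g H" using x y assms by (auto simp: conj_image_def dest: subgroup.m_closed)
qed

lemma conj_invariant_conj_image:
  assumes "finite (carrier G)" "N \<lhd> G" "subgroup K G" "conj_invariant G N K" "g \<in> carrier G"
  shows "conj_invariant G N (conj_image G g K)"
  unfolding conj_invariant_def
proof (intro ballI)
  fix n y assume n: "n \<in> N" and "y \<in> conj_image G g K"
  then obtain k where k: "k \<in> K" "y = g \<otimes> k \<otimes> inv g" by (auto simp: conj_image_def)
  have c: "n \<in> carrier G" "k \<in> carrier G"
    using n k assms by (auto intro: subgroup.mem_carrier normal_carrier)
  have "inv g \<otimes> n \<otimes> g \<in> N"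
    using normal.inv_op_closed1[OF assms(2,5) n] .
  hence "inv g \<otimes> n \<otimes> g \<otimes> k \<otimes> inv (inv g \<otimes> n \<otimes> g) \<in> K"
    using assms(4) k by (auto simp: conj_invariant_def)
  hence "g \<otimes> (inv g \<otimes> n \<otimes> g \<otimes> k \<otimes> inv (inv g \<otimes> n \<otimes> g)) \<otimes> inv g \<in> conj_image G g K"
    by (auto simp: conj_image_def)
  thus "n \<otimes> y \<otimes> inv n \<in> conj_image G g K"
    using c assms(5) k by (simp add: word_simps)
qed

lemma centralizer_normal:
  assumes "finite (carrier G)" "N \<lhd> G" shows "centralizer G N \<lhd> G"
proof -
  have N: "N \<subseteq> carrier G" using assms by (simp add: normal_imp_subgroup subgroup.subset)
  have "conj_image G g N = N" if "g \<in> carrier G" for g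
    using assms N that by (intro conj_image_self) (auto simp: normal_inv_iff finite_subset)
  thus ?thesis using centralizer_subgroup[OF N] centralizer_conj[OF N]
    by (auto simp: normal_inv_iff)
qed

text \<open>The commutator of \<open>a\<close> and \<open>b\<close> lies in both \<open>A\<close>
  and \<open>B\<close>, since each of the two subgroups normalizes the other.\<close>

lemma commute_of_conj_invariant:
  assumes "subgroup A G" "subgroup B G" "conj_invariant G A B" "conj_invariant G B A"
    "A \<inter> B = {\<one>}" "a \<in> A" "b \<in> B"
  shows "a \<otimes> b = b \<otimes> a"
proof -
  have c: "a \<in> carrier G" "b \<in> carrier G" using assms by (auto simp: subgroup.mem_carrier)
  have "a \<otimes> b \<otimes> inv a \<in> B" "b \<otimes> inv a \<otimes> inv b \<in> A"
    using assms by (auto simp: conj_invariant_def subgroup.m_inv_closed)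
  hence "a \<otimes> b \<otimes> inv a \<otimes> inv b \<in> B" "a \<otimes> (b \<otimes> inv a \<otimes> inv b) \<in> A"
    using assms by (auto intro: subgroup.m_closed subgroup.m_inv_closed)
  hence "a \<otimes> b \<otimes> inv a \<otimes> inv b = \<one>" using assms(5) c by (auto simp: m_assoc)
  hence "a \<otimes> b \<otimes> inv a \<otimes> inv b \<otimes> (b \<otimes> a) = b \<otimes> a" using c by simp
  thus ?thesis using c by (simp add: word_simps)
qed

text \<open>\<open>A\<close> lies in the centralizer of \<open>x\<close>, and that centralizer is a
  subgroup, so it contains everything generated by \<open>A\<close>.\<close>

lemma centralizer_generate:
  assumes "A \<subseteq> carrier G" "x \<in> centralizer G A"
  shows "x \<in> centralizer G (generate G A)"
proof -
  have "A \<subseteq> centralizer G {x}" using assms by (auto simp: centralizer_def)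
  hence "generate G A \<subseteq> centralizer G {x}"
    using assms centralizer_subgroup[of "{x}"] by (intro generate_subgroup_incl) (auto simp: centralizer_def)
  thus ?thesis using assms by (auto simp: centralizer_def)
qed

lemma ex_minimal_normal:
  assumes "finite (carrier G)" "carrier G \<noteq> {\<one>}"
  shows "\<exists>N. minimal_normal G N"
proof -
  let ?P = "\<lambda>N. N \<lhd> G \<and> N \<noteq> {\<one>}"
  have "?P (carrier G)" using assms by (simp add: normal_inv_iff subgroup_self)
  then obtain N where N: "?P N" "\<And>M. ?P M \<Longrightarrow> card N \<le> card M"
    using ex_has_least_nat[of ?P _ card] by metis
  have "finite N" using N assms by (meson normal_imp_subgroup rev_finite_subset subgroup.subset)
  hence "minimal_normal G N" using N by (auto simp: minimal_normal_def card_subset_eq card_mono antisym)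
  thus ?thesis ..
qed

end

section \<open>The simple factors of a minimal normal subgroup with trivial centralizer\<close>

locale minimal_normal_centerless = group +
  fixes N
  assumes fin: "finite (carrier G)"
    and min: "minimal_normal G N"
    and centralizer_trivial: "centralizer G N = {\<one>}"
begin

lemma N_normal: "N \<lhd> G" using min by (simp add: minimal_normal_def)
lemma N_subgroup: "subgroup N G" using N_normal by (rule normal_imp_subgroup)
lemma N_carrier: "x \<in> N \<Longrightarrow> x \<in> carrier G" using N_normal by (rule normal_carrier)
lemma N_subset: "N \<subseteq> carrier G" using N_carrier by blast
lemma N_nontrivial: "N \<noteq> {\<one>}" using min by (simp add: minimal_normal_def)

text \<open>A second minimal normal subgroup would meet \<open>N\<close> trivially, hence commute
  with it and lie in the trivial centralizer.\<close>

lemma unique_minimal_normal: "{M. minimal_normal G M} = {N}"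
proof -
  have "M = N" if M: "minimal_normal G M" for M
  proof (rule ccontr)
    assume ne: "M \<noteq> N"
    have Mn: "M \<lhd> G" "M \<noteq> {\<one>}" using M by (auto simp: minimal_normal_def)
    have i: "M \<inter> N \<lhd> G"
      using Mn(1) N_normal by (auto simp: normal_inv_iff intro: subgroups_Inter_pair)
    have "M \<inter> N = {\<one>}"
    proof (rule ccontr)
      assume "M \<inter> N \<noteq> {\<one>}"
      hence "M \<inter> N = M" "M \<inter> N = N" using i M min by (auto simp: minimal_normal_def)
      thus False using ne by simp
    qed
    hence "M \<subseteq> centralizer G N"
      using Mn N_normal normal_carrier commute_of_conj_invariant[of M N]
      by (auto simp: centralizer_def normal_iff_conj_invariant conj_invariant_def subgroup.mem_carrier)
    thus False using Mn centralizer_trivial subgroup.one_closed[OF normal_imp_subgroup[OF Mn(1)]] by auto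
  qed
  thus ?thesis using min by blast
qed

text \<open>These are the minimal normal subgroups of \<open>N\<close>, described inside
  \<open>G\<close>. They turn out to be the simple direct factors of \<open>N\<close>.\<close>

definition factor :: "'a set \<Rightarrow> bool" where
  "factor T \<longleftrightarrow> subgroup T G \<and> T \<subseteq> N \<and> T \<noteq> {\<one>} \<and> conj_invariant G N T \<and>
    (\<forall>K. subgroup K G \<longrightarrow> K \<subseteq> T \<longrightarrow> K \<noteq> {\<one>} \<longrightarrow> conj_invariant G N K \<longrightarrow> K = T)"

lemma factorD:
  assumes "factor T"
  shows "subgroup T G" "T \<subseteq> N" "T \<noteq> {\<one>}" "conj_invariant G N T" "T \<subseteq> carrier G" "\<one> \<in> T" "finite T"
  using assms fin N_subset finite_subset[of T "carrier G"]
  by (auto simp: factor_def subgroup.mem_carrier subgroup.one_closed)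

lemma factor_minimal:
  "\<lbrakk>factor T; subgroup K G; K \<subseteq> T; K \<noteq> {\<one>}; conj_invariant G N K\<rbrakk> \<Longrightarrow> K = T"
  by (simp add: factor_def)

lemma factor_exists: "\<exists>T. factor T"
proof -
  interpret N: group "G\<lparr>carrier := N\<rparr>" using N_subgroup by (rule subgroup_imp_group)
  have "finite N" using N_subset fin by (rule finite_subset)
  then obtain T where "minimal_normal (G\<lparr>carrier := N\<rparr>) T"
    using N.ex_minimal_normal N_nontrivial by auto
  hence "factor T" by (auto simp: minimal_normal_def factor_def normal_subgroup_iff[OF N_subgroup])
  thus ?thesis ..
qed

lemma factor_conj:
  assumes T: "factor T" and g: "g \<in> carrier G" shows "factor (conj_image G g T)"
proof -
  note d = factorD[OF T]
  have "conj_image G g T \<subseteq> N"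
    using d(2) g N_normal by (auto simp: conj_image_def normal_inv_iff)
  moreover have "conj_image G g T \<noteq> {\<one>}"
  proof
    assume "conj_image G g T = {\<one>}"
    hence "conj_image G (inv g) (conj_image G g T) = {\<one>}" using g by (simp add: conj_image_def)
    thus False using conj_image_inv[OF d(5) g] d(3) by simp
  qed
  moreover have "K = conj_image G g T"
    if K: "subgroup K G" "K \<subseteq> conj_image G g T" "K \<noteq> {\<one>}" "conj_invariant G N K" for K
  proof -
    have Kc: "K \<subseteq> carrier G" using K by (simp add: subgroup.subset)
    have bk: "conj_image G g (conj_image G (inv g) K) = K"
      using conj_image_inv[OF Kc, of "inv g"] g by simp
    have "conj_image G (inv g) K \<subseteq> conj_image G (inv g) (conj_image G g T)"
      using K(2) by (auto simp: conj_image_def)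
    hence "conj_image G (inv g) K \<subseteq> T" using conj_image_inv[OF d(5) g] by simp
    moreover have "conj_image G (inv g) K \<noteq> {\<one>}"
    proof
      assume "conj_image G (inv g) K = {\<one>}"
      hence "K = conj_image G g {\<one>}" using bk by simp
      thus False using K(3) g by (simp add: conj_image_def)
    qed
    ultimately have "conj_image G (inv g) K = T"
      using K g fin N_normal T by (intro factor_minimal conj_image_subgroup conj_invariant_conj_image) auto
    thus ?thesis using bk by simp
  qed
  ultimately show ?thesis
    using d g fin N_normal unfolding factor_def
    by (auto intro: conj_image_subgroup conj_invariant_conj_image)
qed

lemma factors_inter: 
  assumes "factor T" "subgroup M G" "conj_invariant G N M" "\<not> T \<subseteq> M"
  shows "T \<inter> M = {\<one>}"
proof (rule ccontr)
  assume "T \<inter> M \<noteq> {\<one>}"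
  hence "T \<inter> M = T" using assms factorD[of T]
    by (intro factor_minimal subgroups_Inter_pair) (auto simp: conj_invariant_def)
  thus False using assms(4) by blast
qed

lemma factors_commute:
  assumes "factor T" "factor T'" "T \<noteq> T'" "x \<in> T" "y \<in> T'"
  shows "x \<otimes> y = y \<otimes> x"
proof -
  have "\<not> T \<subseteq> T'" using assms factor_minimal[of T' T] factorD[of T] by auto
  hence "T \<inter> T' = {\<one>}" using factors_inter[OF assms(1) factorD(1,4)[OF assms(2)]] by simp
  thus ?thesis using assms factorD[of T] factorD[of T']
    by (intro commute_of_conj_invariant[of T T']) (auto simp: conj_invariant_def subset_iff)
qed

text \<open>The conjugates of \<open>T\<close> generate a nontrivial normal subgroup of
  \<open>G\<close> inside \<open>N\<close>, so minimality of \<open>N\<close> applies.\<close>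

lemma factor_class_generate:
  assumes "factor T" shows "generate G (\<Union>g\<in>carrier G. conj_image G g T) = N"
proof -
  let ?A = "\<Union>g\<in>carrier G. conj_image G g T"
  note d = factorD[OF assms]
  have A: "?A \<subseteq> N" using factorD(2)[OF factor_conj[OF assms]] by blast
  have Ac: "?A \<subseteq> carrier G" using A N_subset by blast
  have "?A \<supseteq> T" using conj_image_one[OF d(5)] by force
  hence "generate G ?A \<supseteq> T" by (meson generate.incl subset_iff)
  moreover have "generate G ?A \<lhd> G"
  proof (rule normal_generateI[OF Ac])
    fix h g assume "h \<in> ?A" and g: "g \<in> carrier G"
    then obtain k where k: "k \<in> carrier G" "h \<in> conj_image G k T" by blast
    have "g \<otimes> h \<otimes> inv g \<in> conj_image G (g \<otimes> k) T"
      using k g d(5) by (simp add: conj_image_mult) (simp add: conj_image_def)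
    thus "g \<otimes> h \<otimes> inv g \<in> ?A" using k g by blast
  qed
  moreover have "generate G ?A \<subseteq> N" using A N_subgroup by (rule generate_subgroup_incl)
  ultimately show ?thesis using min d(3,6) unfolding minimal_normal_def by blast
qed

text \<open>A factor not conjugate to \<open>T\<close> commutes with every conjugate of
  \<open>T\<close>, hence with \<open>N\<close>, contrary to the trivial centralizer.\<close>

lemma factors_conjugate:
  assumes "factor T" "factor T'" shows "\<exists>g\<in>carrier G. T' = conj_image G g T"
proof (rule ccontr)
  assume n: "\<not> ?thesis"
  let ?A = "\<Union>g\<in>carrier G. conj_image G g T"
  have A: "?A \<subseteq> carrier G" using factorD(5)[OF factor_conj[OF assms(1)]] by blast
  have "T' \<subseteq> centralizer G ?A"
    using n factors_commute[OF assms(2) factor_conj[OF assms(1)]] factorD(5)[OF assms(2)]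
    by (auto simp: centralizer_def)
  hence "T' \<subseteq> centralizer G N"
    using centralizer_generate[OF A] factor_class_generate[OF assms(1)] by auto
  thus False using centralizer_trivial factorD(3,6)[OF assms(2)] by blast
qed

text \<open>The form in which the trivial centralizer is used: the factors generate
  \<open>N\<close>.\<close>

lemma commute_all_factors:
  assumes "x \<in> carrier G" "\<And>T t. \<lbrakk>factor T; t \<in> T\<rbrakk> \<Longrightarrow> x \<otimes> t = t \<otimes> x"
  shows "x = \<one>"
proof -
  obtain T where T: "factor T" using factor_exists ..
  let ?A = "\<Union>g\<in>carrier G. conj_image G g T"
  have A: "?A \<subseteq> carrier G" using factorD(5)[OF factor_conj[OF T]] by blast
  have "x \<in> centralizer G ?A" using assms factor_conj[OF T] by (auto simp: centralizer_def)
  hence "x \<in> centralizer G N"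
    using centralizer_generate[OF A] factor_class_generate[OF T] by auto
  thus ?thesis using centralizer_trivial by auto
qed

text \<open>Each generator of \<open>N\<close> lies in a factor, and that factor is \<open>T\<close>
  or commutes with \<open>T\<close>. Products \<open>t \<otimes> c\<close> are closed under
  multiplication because \<open>c\<close> commutes with \<open>T\<close>.\<close>

lemma factor_decomposition:
  assumes T: "factor T" and n: "n \<in> N"
  shows "\<exists>t\<in>T. \<exists>c\<in>centralizer G T \<inter> N. n = t \<otimes> c"
proof -
  note d = factorD[OF T]
  have C: "subgroup (centralizer G T \<inter> N) G"
    using centralizer_subgroup[OF d(5)] N_subgroup by (rule subgroups_Inter_pair)
  have base: "\<exists>t\<in>T. \<exists>c\<in>centralizer G T \<inter> N. h = t \<otimes> c" if T': "factor T'" "h \<in> T'" for h T'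
  proof (cases "T' = T")
    case True
    thus ?thesis using that d subgroup.one_closed[OF C] by (intro bexI[of _ h] bexI[of _ \<one>]) auto
  next
    case False
    hence "h \<in> centralizer G T \<inter> N"
      using that factors_commute[OF T'(1) T] factorD[OF T'(1)] by (auto simp: centralizer_def)
    thus ?thesis using d(6) centralizer_carrier by (intro bexI[of _ \<one>] bexI[of _ h]) auto
  qed
  have "n \<in> generate G (\<Union>g\<in>carrier G. conj_image G g T)" using n factor_class_generate[OF T] by simp
  thus ?thesis
  proof induction
    case one
    show ?case using d(6) subgroup.one_closed[OF C] by (intro bexI[of _ \<one>]) auto
  next
    case (incl h)
    thus ?case using base factor_conj[OF T] by blast
  next
    case (inv h)
    then obtain g where g: "g \<in> carrier G" "h \<in> conj_image G g T" by blast
    hence "inv h \<in> conj_image G g T"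
      using factorD(1)[OF factor_conj[OF T g(1)]] by (simp add: subgroup.m_inv_closed)
    thus ?case using base[OF factor_conj[OF T g(1)]] by blast
  next
    case (eng h1 h2)
    then obtain t1 c1 t2 c2 where h: "t1 \<in> T" "c1 \<in> centralizer G T \<inter> N" "h1 = t1 \<otimes> c1"
        "t2 \<in> T" "c2 \<in> centralizer G T \<inter> N" "h2 = t2 \<otimes> c2" by blast
    have c: "t1 \<in> carrier G" "t2 \<in> carrier G" "c1 \<in> carrier G" "c2 \<in> carrier G"
      using h d(5) centralizer_carrier by auto
    have "c1 \<otimes> t2 = t2 \<otimes> c1" using h centralizerD by blast
    hence "t1 \<otimes> (c1 \<otimes> t2) \<otimes> c2 = t1 \<otimes> (t2 \<otimes> c1) \<otimes> c2" by simp
    hence "h1 \<otimes> h2 = (t1 \<otimes> t2) \<otimes> (c1 \<otimes> c2)" using h c by (simp add: m_assoc)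
    thus ?case using h subgroup.m_closed[OF C] subgroup.m_closed[OF d(1)] by blast
  qed
qed

lemma factor_center: "\<lbrakk>factor T; x \<in> T; x \<in> centralizer G T\<rbrakk> \<Longrightarrow> x = \<one>"
  using factors_commute[of T _ x] by (intro commute_all_factors) (auto simp: centralizer_def)

text \<open>By \<open>factor_decomposition\<close> an element of \<open>N\<close> acts on
  \<open>T\<close> by conjugation as its \<open>T\<close>-part does. A subgroup normal in
  \<open>T\<close> is therefore normal in \<open>N\<close>, and minimality of \<open>T\<close>
  applies.\<close>

lemma factor_simple:
  assumes T: "factor T" and K: "subgroup K G" "K \<subseteq> T" "conj_invariant G T K" "K \<noteq> {\<one>}"
  shows "K = T"
proof -
  note d = factorD[OF T]
  have "conj_invariant G N K" unfolding conj_invariant_def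
  proof (intro ballI)
    fix n k assume n: "n \<in> N" and k: "k \<in> K"
    obtain t c where tc: "t \<in> T" "c \<in> centralizer G T" "n = t \<otimes> c"
      using factor_decomposition[OF T n] by blast
    have cc: "t \<in> carrier G" "c \<in> carrier G" "k \<in> carrier G"
      using tc k K d(5) centralizer_carrier by auto
    have e: "c \<otimes> k = k \<otimes> c" using tc k K centralizerD by blast
    have "n \<otimes> k \<otimes> inv n = t \<otimes> (c \<otimes> k \<otimes> inv c) \<otimes> inv t"
      using cc tc by (simp add: word_simps)
    also have "c \<otimes> k \<otimes> inv c = k" using cc e by (simp add: m_assoc)
    finally show "n \<otimes> k \<otimes> inv n \<in> K" using K(3) tc k by (simp add: conj_invariant_def)
  qed
  thus ?thesis using T K by (intro factor_minimal) auto
qed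

lemma factor_nonabelian_simple:
  assumes T: "factor T" shows "nonabelian_simple (G\<lparr>carrier := T\<rparr>)"
proof -
  note d = factorD[OF T]
  interpret T: group "G\<lparr>carrier := T\<rparr>" using d(1) by (rule subgroup_imp_group)
  obtain x where x: "x \<in> T" "x \<noteq> \<one>" using d(3,6) by blast
  have "card {\<one>, x} \<le> card T" using x d by (intro card_mono) auto
  hence o: "order (G\<lparr>carrier := T\<rparr>) > 1" using x(2) by (simp add: order_def)
  have "\<not> comm_group (G\<lparr>carrier := T\<rparr>)"
  proof
    assume "comm_group (G\<lparr>carrier := T\<rparr>)"
    then interpret c: comm_group "G\<lparr>carrier := T\<rparr>" .
    have "x \<in> centralizer G T" using x(1) d c.m_comm[of x] by (auto simp: centralizer_def)
    thus False using factor_center[OF T x(1)] x(2) by simp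
  qed
  moreover have "simple_group (G\<lparr>carrier := T\<rparr>)"
    using o factor_simple[OF T] by unfold_locales (auto simp: normal_subgroup_iff[OF d(1)])
  ultimately show ?thesis by (simp add: nonabelian_simple_def)
qed

lemma factors_finite: "finite {T. factor T}"
  by (rule finite_subset[of _ "Pow (carrier G)"]) (use fin factorD(5) in auto)

text \<open>The product of the \<open>t T\<close> has all prescribed components at once, because
  distinct factors commute. The branch for factors outside \<open>F\<close> is the induction
  invariant: their component is still trivial.\<close>

lemma factors_independent:
  assumes "finite F" "\<And>T. T \<in> F \<Longrightarrow> factor T \<and> t T \<in> T"
  shows "\<exists>n\<in>N. \<forall>T. factor T \<longrightarrow> (if T \<in> F then inv (t T) \<otimes> n else n) \<in> centralizer G T"
  using assms
proof (induction F)
  case empty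
  show ?case using subgroup.one_closed[OF N_subgroup]
    by (intro bexI[of _ \<one>]) (auto simp: centralizer_def dest: subsetD[OF factorD(5)])
next
  case (insert T F)
  then obtain n where n: "n \<in> N"
    "\<And>T. factor T \<Longrightarrow> (if T \<in> F then inv (t T) \<otimes> n else n) \<in> centralizer G T" by auto
  have T: "factor T" "t T \<in> T" using insert.prems by auto
  note d = factorD[OF T(1)]
  have tT: "t T \<in> carrier G" "n \<in> carrier G" using T d(5) N_carrier n by auto
  show ?case
  proof (intro bexI[of _ "n \<otimes> t T"] allI impI)
    show "n \<otimes> t T \<in> N" using n T d(2) subgroup.m_closed[OF N_subgroup] by blast
    fix T' assume T': "factor T'"
    show "(if T' \<in> insert T F then inv (t T') \<otimes> (n \<otimes> t T) else n \<otimes> t T) \<in> centralizer G T'"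
    proof (cases "T' = T")
      case True
      have nc: "n \<in> centralizer G T" using n(2)[OF T(1)] insert.hyps by simp
      hence "n \<otimes> t T = t T \<otimes> n" using T(2) centralizerD by blast
      thus ?thesis using True nc tT by (simp add: inv_mult_cancel)
    next
      case False
      have c: "t T \<in> centralizer G T'"
        using factors_commute[OF T(1) T'] False T tT by (auto simp: centralizer_def)
      note sc = subgroup.m_closed[OF centralizer_subgroup[OF factorD(5)[OF T']] _ c]
      show ?thesis
      proof (cases "T' \<in> F")
        case True
        have "t T' \<in> carrier G" using insert.prems True factorD(5)[OF T'] by blast
        thus ?thesis using n(2)[OF T'] True False sc[of "inv (t T') \<otimes> n"] tT by (simp add: m_assoc)
      next
        case nF: False
        thus ?thesis using n(2)[OF T'] False sc[of n] by simp
      qed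
    qed
  qed
qed

end

section \<open>Regular subgroups of quasiprimitive groups\<close>

text \<open>\<open>S\<close> stands for a point stabilizer: the factorization \<open>G = N S\<close>
  is transitivity of \<open>N\<close>, and core-freeness is faithfulness of the action.\<close>

locale quasiprimitive_pair = group +
  fixes S
  assumes finite_group: "finite (carrier G)"
    and S: "subgroup S G"
    and quasi: "\<lbrakk>N \<lhd> G; N \<noteq> {\<one>}; g \<in> carrier G\<rbrakk> \<Longrightarrow> \<exists>n\<in>N. \<exists>s\<in>S. g = n \<otimes> s"
    and core_free: "\<lbrakk>N \<lhd> G; N \<subseteq> S\<rbrakk> \<Longrightarrow> N = {\<one>}"
begin

lemma S_carrier: "x \<in> S \<Longrightarrow> x \<in> carrier G"
  using S by (rule subgroup.mem_carrier)

lemma centralizer_minimal_normal: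
  assumes N: "minimal_normal G N" and NS: "N \<inter> S \<noteq> {\<one>}"
  shows "centralizer G N = {\<one>}"
proof (rule ccontr)
  assume C: "centralizer G N \<noteq> {\<one>}"
  have Nn: "N \<lhd> G" using N by (simp add: minimal_normal_def)
  have "N \<inter> S \<lhd> G" unfolding normal_inv_iff
  proof (intro conjI ballI)
    show "subgroup (N \<inter> S) G" using Nn S normal_imp_subgroup by (blast intro: subgroups_Inter_pair)
    fix g k assume g: "g \<in> carrier G" and k: "k \<in> N \<inter> S"
    obtain c s where cs: "c \<in> centralizer G N" "s \<in> S" "g = c \<otimes> s"
      using quasi[OF centralizer_normal[OF finite_group Nn] C g] by blast
    have cc: "c \<in> carrier G" "s \<in> carrier G" "k \<in> carrier G"
      using cs k S_carrier centralizer_carrier by auto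
    have m: "s \<otimes> k \<otimes> inv s \<in> N \<inter> S"
      using cs k cc Nn S by (auto simp: normal_inv_iff intro: subgroup.m_closed subgroup.m_inv_closed)
    hence "c \<otimes> (s \<otimes> k \<otimes> inv s) = (s \<otimes> k \<otimes> inv s) \<otimes> c" using cs centralizerD by blast
    hence "c \<otimes> (s \<otimes> k \<otimes> inv s) \<otimes> inv c = s \<otimes> k \<otimes> inv s"
      using cc by (intro iffD2[OF conj_eq_self_iff]) simp_all
    moreover have "g \<otimes> k \<otimes> inv g = c \<otimes> (s \<otimes> k \<otimes> inv s) \<otimes> inv c"
      using cc cs by (simp add: word_simps)
    ultimately show "g \<otimes> k \<otimes> inv g \<in> N \<inter> S" using m by simp
  qed
  thus False using core_free[of "N \<inter> S"] NS by simp
qed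

end

locale quasiprimitive_pair_factors =
  quasiprimitive_pair G S + minimal_normal_centerless G N for G (structure) and S and N +
  assumes nonregular: "N \<inter> S \<noteq> {\<one>}"
begin

lemma transitive_N: "g \<in> carrier G \<Longrightarrow> \<exists>n\<in>N. \<exists>s\<in>S. g = n \<otimes> s"
  using quasi N_normal N_nontrivial by blast

text \<open>\<open>N\<close> normalizes every factor and \<open>G = N S\<close>, so conjugation by
  \<open>S\<close> alone is transitive on the factors.\<close>

lemma factors_conjugate_S:
  assumes "factor T" "factor T'" shows "\<exists>s\<in>S. T' = conj_image G s T"
proof -
  obtain g where g: "g \<in> carrier G" "T' = conj_image G g T" using factors_conjugate[OF assms] by blast
  have "inv g \<in> carrier G" using g by simp
  then obtain n s where ns: "n \<in> N" "s \<in> S" "inv g = n \<otimes> s" using transitive_N by blast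
  have c: "n \<in> carrier G" "s \<in> carrier G" using ns N_carrier S_carrier by auto
  have "g = inv s \<otimes> inv n" using ns c g by (metis inv_inv inv_mult_group)
  moreover have "conj_image G (inv n) T = T"
    using factorD(4,5,7)[OF assms(1)] ns c subgroup.m_inv_closed[OF N_subgroup, of n]
    by (intro conj_image_self) (simp_all only: conj_invariant_def inv_closed)
  ultimately have "T' = conj_image G (inv s) T"
    using g c factorD(5)[OF assms(1)] by (simp add: conj_image_mult)
  thus ?thesis using ns subgroup.m_inv_closed[OF S] by blast
qed

text \<open>\<open>N \<inter> S\<close> is normalized by \<open>S\<close>. If it centralized
  \<open>T\<close>, it would centralize all \<open>S\<close>-conjugates of \<open>T\<close>, which
  are all the factors, and hence be trivial.\<close>

lemma stabilizer_not_centralizing: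
  assumes T: "factor T" shows "\<not> N \<inter> S \<subseteq> centralizer G T"
proof
  assume cen: "N \<inter> S \<subseteq> centralizer G T"
  have "N \<inter> S \<subseteq> {\<one>}"
  proof
    fix x assume x: "x \<in> N \<inter> S"
    have "x = \<one>"
    proof (rule commute_all_factors)
      show xc: "x \<in> carrier G" using x N_carrier by blast
      fix T' t assume T': "factor T'" "t \<in> T'"
      obtain s where s: "s \<in> S" "T' = conj_image G s T" using factors_conjugate_S[OF T T'(1)] by blast
      have sc: "s \<in> carrier G" using s S_carrier by blast
      have "inv s \<otimes> x \<otimes> s \<in> N \<inter> S"
        using x s sc normal.inv_op_closed1[OF N_normal] S
        by (auto intro: subgroup.m_closed subgroup.m_inv_closed)
      hence "s \<otimes> (inv s \<otimes> x \<otimes> s) \<otimes> inv s \<in> centralizer G T'"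
        using cen s(2) sc centralizer_conj[OF factorD(5)[OF T]] by blast
      moreover have "s \<otimes> (inv s \<otimes> x \<otimes> s) \<otimes> inv s = x" using sc xc by (simp add: word_simps)
      ultimately show "x \<otimes> t = t \<otimes> x" using T'(2) centralizerD by auto
    qed
    thus "x \<in> {\<one>}" by simp
  qed
  thus False using nonregular subgroup.one_closed[OF S] subgroup.one_closed[OF N_subgroup] by blast
qed

text \<open>An element of \<open>S\<close> that conjugates \<open>T\<close> to \<open>T'\<close>
  carries the factorization for \<open>T\<close> to one for \<open>T'\<close>.\<close>

lemma transitive_centralizer_all:
  assumes T: "factor T" "factor T'"
    and tr: "\<And>g. g \<in> carrier G \<Longrightarrow> \<exists>c\<in>centralizer G T. \<exists>s\<in>S. g = c \<otimes> s"
    and g: "g \<in> carrier G"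
  shows "\<exists>c\<in>centralizer G T'. \<exists>s\<in>S. g = c \<otimes> s"
proof -
  obtain s where s: "s \<in> S" "T' = conj_image G s T" using factors_conjugate_S[OF T] by blast
  have sc: "s \<in> carrier G" using s S_carrier by blast
  obtain c u where cu: "c \<in> centralizer G T" "u \<in> S" "inv s \<otimes> g = c \<otimes> u" using tr[of "inv s \<otimes> g"] sc g by auto
  have c: "c \<in> carrier G" "u \<in> carrier G" using cu S_carrier centralizer_carrier by auto
  have "g = s \<otimes> (inv s \<otimes> g)" using sc g by (simp add: word_simps)
  also have "\<dots> = (s \<otimes> c \<otimes> inv s) \<otimes> (s \<otimes> u)" unfolding cu(3) using sc c by (simp add: word_simps)
  finally show ?thesis
    using centralizer_conj[OF factorD(5)[OF T(1)] sc cu(1)] s cu(2) subgroup.m_closed[OF S] by blast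
qed

text \<open>When \<open>C\<^sub>G(T) S = G\<close>, the projection of \<open>N \<inter> S\<close> to \<open>T\<close> is invariant under all of \<open>T\<close>, as an
  element of \<open>T\<close> acts on \<open>T\<close> like some element of \<open>S\<close>.  Being nontrivial, it is \<open>T\<close>.\<close>

lemma projection_onto_factor:
  assumes T: "factor T"
    and tr: "\<And>g. g \<in> carrier G \<Longrightarrow> \<exists>c\<in>centralizer G T. \<exists>s\<in>S. g = c \<otimes> s"
    and x: "x \<in> T"
  shows "\<exists>c\<in>centralizer G T \<inter> N. c \<otimes> x \<in> S"
proof -
  note d = factorD[OF T]
  let ?C = "centralizer G T \<inter> N"
  have C: "subgroup ?C G"
    using centralizer_subgroup[OF d(5)] N_subgroup by (rule subgroups_Inter_pair)
  have comm: "c \<otimes> t = t \<otimes> c" "c \<in> carrier G" "t \<in> carrier G" if "c \<in> centralizer G T" "t \<in> T" for c t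
    using that centralizerD centralizer_carrier d(5) by auto
  define R where "R = {t \<in> T. \<exists>c\<in>?C. c \<otimes> t \<in> S}"
  have "subgroup R G"
  proof (rule subgroupI)
    show "R \<subseteq> carrier G" using d(5) by (auto simp: R_def)
    have "\<one> \<in> R" using d(6) subgroup.one_closed[OF C] subgroup.one_closed[OF S] by (auto simp: R_def intro!: bexI[of _ \<one>])
    thus "R \<noteq> {}" by blast
    fix a assume "a \<in> R"
    then obtain c where a: "a \<in> T" "c \<in> ?C" "c \<otimes> a \<in> S" by (auto simp: R_def)
    have "inv (c \<otimes> a) = inv c \<otimes> inv a" using a comm[of c a] by (metis IntD1 inv_mult_group)
    hence "inv c \<otimes> inv a \<in> S" using subgroup.m_inv_closed[OF S a(3)] by simp
    thus "inv a \<in> R" using a subgroup.m_inv_closed[OF C] subgroup.m_inv_closed[OF d(1)] by (auto simp: R_def)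
    fix b assume "b \<in> R"
    then obtain e where b: "b \<in> T" "e \<in> ?C" "e \<otimes> b \<in> S" by (auto simp: R_def)
    have cc: "a \<in> carrier G" "b \<in> carrier G" "c \<in> carrier G" "e \<in> carrier G"
      using a b comm by blast+
    have "a \<otimes> e = e \<otimes> a" using comm[of e a] a b by simp
    hence "c \<otimes> (a \<otimes> e) \<otimes> b = c \<otimes> (e \<otimes> a) \<otimes> b" by simp
    hence "(c \<otimes> e) \<otimes> (a \<otimes> b) = (c \<otimes> a) \<otimes> (e \<otimes> b)" using cc by (simp add: m_assoc)
    hence "(c \<otimes> e) \<otimes> (a \<otimes> b) \<in> S" using subgroup.m_closed[OF S a(3) b(3)] by simp
    thus "a \<otimes> b \<in> R" using a b subgroup.m_closed[OF C] subgroup.m_closed[OF d(1)] by (auto simp: R_def)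
  qed
  moreover have "R \<subseteq> T" by (auto simp: R_def)
  moreover have "conj_invariant G T R" unfolding conj_invariant_def
  proof (intro ballI)
    fix y t assume y: "y \<in> T" and "t \<in> R"
    then obtain c where t: "t \<in> T" "c \<in> ?C" "c \<otimes> t \<in> S" by (auto simp: R_def)
    obtain e s where es: "e \<in> centralizer G T" "s \<in> S" "y = e \<otimes> s" using tr[of y] y d(5) by blast
    have cc: "y \<in> carrier G" "t \<in> carrier G" "c \<in> carrier G" "e \<in> carrier G" "s \<in> carrier G"
      using y t es d(5) comm S_carrier by blast+
    have yt: "y \<otimes> t \<otimes> inv y \<in> T" using y t d(1) by (auto intro: subgroup.m_closed subgroup.m_inv_closed)
    have se: "s = inv e \<otimes> y" using es cc by (simp add: word_simps)
    have ie: "inv e \<in> centralizer G T"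
      using es(1) subgroup.m_inv_closed[OF centralizer_subgroup[OF d(5)]] by blast
    have "inv e \<otimes> (y \<otimes> t \<otimes> inv y) \<otimes> inv (inv e) = y \<otimes> t \<otimes> inv y"
      using comm[OF ie yt] by (intro iffD2[OF conj_eq_self_iff]) simp_all
    hence st: "s \<otimes> t \<otimes> inv s = y \<otimes> t \<otimes> inv y" unfolding se using cc by (simp add: word_simps)
    \<comment> \<open>\<open>s\<close> acts on \<open>T\<close> as \<open>y\<close> does, so it
      normalizes \<open>T\<close> and with it the centralizer. This keeps the complementary part of
      the conjugated element in \<open>?C\<close>.\<close>
    have sT: "conj_image G s T = T"
    proof (rule conj_image_self[OF d(7,5) cc(5)])
      fix k assume k: "k \<in> T"
      have yk: "y \<otimes> k \<otimes> inv y \<in> T" using y k d(1) by (auto intro: subgroup.m_closed subgroup.m_inv_closed)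
      have "inv e \<otimes> (y \<otimes> k \<otimes> inv y) \<otimes> inv (inv e) = y \<otimes> k \<otimes> inv y"
        using comm[OF ie yk] by (intro iffD2[OF conj_eq_self_iff]) simp_all
      thus "s \<otimes> k \<otimes> inv s \<in> T" unfolding se using yk cc k d(5) by (simp add: word_simps subset_iff)
    qed
    have "s \<otimes> c \<otimes> inv s \<in> ?C"
      using centralizer_conj[OF d(5) cc(5), of c] t sT N_normal cc by (auto simp: normal_inv_iff)
    moreover have "(s \<otimes> c \<otimes> inv s) \<otimes> (s \<otimes> t \<otimes> inv s) \<in> S"
    proof -
      have "s \<otimes> (c \<otimes> t) \<otimes> inv s \<in> S" using es(2) t(3) S by (auto intro: subgroup.m_closed subgroup.m_inv_closed)
      thus ?thesis using cc by (simp add: word_simps)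
    qed
    ultimately show "y \<otimes> t \<otimes> inv y \<in> R" using yt st by (auto simp: R_def)
  qed
  moreover have "R \<noteq> {\<one>}"
  proof
    assume R1: "R = {\<one>}"
    have "N \<inter> S \<subseteq> centralizer G T"
    proof
      fix z assume z: "z \<in> N \<inter> S"
      then obtain t c where tc: "t \<in> T" "c \<in> ?C" "z = t \<otimes> c" using factor_decomposition[OF T] by blast
      have zc: "z = c \<otimes> t" using tc comm[of c t] by simp
      hence "t \<in> R" using tc z by (auto simp: R_def)
      thus "z \<in> centralizer G T" using R1 zc tc comm[of c t] by simp
    qed
    thus False using stabilizer_not_centralizing[OF T] by simp
  qed
  ultimately have "R = T" by (intro factor_simple[OF T])
  thus ?thesis using x by (auto simp: R_def)
qed

text \<open>\<open>M\<close> is maximal among the normal subgroups of \<open>N\<close> that meet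
  \<open>S\<close> trivially. For a factor \<open>T\<close> outside \<open>M\<close>, the product
  \<open>M T\<close> meets \<open>S\<close> nontrivially by maximality. The \<open>T\<close>-parts
  of this intersection form a nontrivial normal subgroup of \<open>T\<close>, hence all of
  \<open>T\<close>, so each \<open>t\<close> is an element of \<open>M\<close> times one of
  \<open>N \<inter> S\<close>. As this holds for all factors, \<open>N = M (N \<inter> S)\<close>
  and \<open>G = M S\<close>.\<close>

lemma exists_regular_subgroup:
  assumes T0: "factor T0"
    and tr: "\<And>g. g \<in> carrier G \<Longrightarrow> \<exists>c\<in>centralizer G T0. \<exists>s\<in>S. g = c \<otimes> s"
  shows "\<exists>R. subgroup R G \<and> R \<inter> S = {\<one>} \<and> (\<forall>g\<in>carrier G. \<exists>r\<in>R. \<exists>s\<in>S. g = r \<otimes> s)"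
proof -
  define P where "P M \<longleftrightarrow> subgroup M G \<and> M \<subseteq> N \<and> conj_invariant G N M \<and> M \<inter> S = {\<one>}" for M
  have P1: "P {\<one>}" using triv_subgroup N_carrier subgroup.one_closed[OF N_subgroup] subgroup.one_closed[OF S]
    by (auto simp: P_def conj_invariant_def)
  have Pb: "\<forall>M. P M \<longrightarrow> card M < Suc (card N)"
    using finite_subset[OF N_subset fin] by (auto simp: P_def less_Suc_eq_le card_mono)
  obtain M where PM: "P M" and max': "\<And>M'. P M' \<Longrightarrow> card M' \<le> card M"
    using ex_has_greatest_nat[OF P1 Pb] by blast
  note M = PM[unfolded P_def] and max = max'[unfolded P_def]
  have Mc: "x \<in> carrier G" if "x \<in> M" for x using M that N_carrier by blast
  have conjM: "n \<otimes> m \<otimes> inv n \<in> M" if "n \<in> N" "m \<in> M" for n m using M that by (simp add: conj_invariant_def)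
  note Mm = subgroup.m_closed[OF conjunct1[OF M]] and Mi = subgroup.m_inv_closed[OF conjunct1[OF M]]
  \<comment> \<open>The product of \<open>M\<close> and \<open>N \<inter> S\<close>; showing that it
    contains every factor shows that it contains \<open>N\<close>.\<close>
  define Q where "Q = {m \<otimes> s | m s. m \<in> M \<and> s \<in> N \<inter> S}"
  have NS: "subgroup (N \<inter> S) G" using N_subgroup S by (rule subgroups_Inter_pair)
  have Q: "subgroup Q G"
  proof (rule subgroupI)
    show "Q \<subseteq> carrier G" using Mc S_carrier by (auto simp: Q_def)
    show "Q \<noteq> {}" using M subgroup.one_closed[OF NS] by (auto simp: Q_def dest: subgroup.one_closed)
    fix a assume "a \<in> Q"
    then obtain m s where a: "m \<in> M" "s \<in> N \<inter> S" "a = m \<otimes> s" by (auto simp: Q_def)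
    have c: "m \<in> carrier G" "s \<in> carrier G" using a Mc N_carrier by auto
    have si: "inv s \<in> N \<inter> S" using a subgroup.m_inv_closed[OF NS] by blast
    have "inv a = (inv s \<otimes> inv m \<otimes> inv (inv s)) \<otimes> inv s" using c a by (simp add: word_simps)
    thus "inv a \<in> Q" using conjM[OF _ Mi[OF a(1)], of "inv s"] si by (auto simp: Q_def)
    fix b assume "b \<in> Q"
    then obtain m' s' where b: "m' \<in> M" "s' \<in> N \<inter> S" "b = m' \<otimes> s'" by (auto simp: Q_def)
    have c': "m' \<in> carrier G" "s' \<in> carrier G" using b Mc N_carrier by auto
    have "a \<otimes> b = (m \<otimes> (s \<otimes> m' \<otimes> inv s)) \<otimes> (s \<otimes> s')" using c c' a b by (simp add: word_simps)
    moreover have "m \<otimes> (s \<otimes> m' \<otimes> inv s) \<in> M" using a b conjM Mm by auto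
    moreover have "s \<otimes> s' \<in> N \<inter> S" using a b subgroup.m_closed[OF NS] by blast
    ultimately show "a \<otimes> b \<in> Q" unfolding Q_def by blast
  qed
  have fQ: "T \<subseteq> Q" if T: "factor T" for T
  proof (cases "T \<subseteq> M")
    case True
    show ?thesis
    proof
      fix x assume "x \<in> T"
      hence "x = x \<otimes> \<one>" "x \<in> M" using True Mc by auto
      thus "x \<in> Q" using subgroup.one_closed[OF NS] unfolding Q_def by blast
    qed
  next
    case False
    note d = factorD[OF T]
    have tr': "\<And>g. g \<in> carrier G \<Longrightarrow> \<exists>c\<in>centralizer G T. \<exists>s\<in>S. g = c \<otimes> s"
      using transitive_centralizer_all[OF T0 T tr] by blast
    have TM: "T \<inter> M = {\<one>}" using factors_inter[OF T] M False by blast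
    have TMc: "t \<otimes> m = m \<otimes> t" if "t \<in> T" "m \<in> M" for t m
      using that M d TM by (intro commute_of_conj_invariant[of T M]) (auto simp: conj_invariant_def subset_iff)
    have Tm: "\<And>a b. \<lbrakk>a \<in> T; b \<in> T\<rbrakk> \<Longrightarrow> a \<otimes> b \<in> T" "\<And>a. a \<in> T \<Longrightarrow> inv a \<in> T" and Tc: "\<And>a. a \<in> T \<Longrightarrow> a \<in> carrier G"
      using d(1,5) by (auto intro: subgroup.m_closed subgroup.m_inv_closed)
    have split: "(m \<otimes> t) \<otimes> (m' \<otimes> t') = (m \<otimes> m') \<otimes> (t \<otimes> t')"
      if "m \<in> M" "m' \<in> M" "t \<in> T" "t' \<in> T" for m m' t t'
    proof -
      have "m \<otimes> (t \<otimes> m') \<otimes> t' = m \<otimes> (m' \<otimes> t) \<otimes> t'" using TMc that by simp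
      thus ?thesis using that Mc Tc by (simp add: m_assoc)
    qed
    define L where "L = {m \<otimes> t | m t. m \<in> M \<and> t \<in> T}"
    have LI: "\<And>m t. \<lbrakk>m \<in> M; t \<in> T\<rbrakk> \<Longrightarrow> m \<otimes> t \<in> L" by (auto simp: L_def)
    have L: "subgroup L G"
    proof (rule subgroupI)
      show "L \<subseteq> carrier G" using Mc Tc by (auto simp: L_def)
      show "L \<noteq> {}" using M d(6) by (auto simp: L_def dest: subgroup.one_closed)
      fix a assume "a \<in> L"
      then obtain m t where a: "m \<in> M" "t \<in> T" "a = m \<otimes> t" by (auto simp: L_def)
      have "inv a = inv m \<otimes> inv t" using a Mc Tc TMc[of t m] by (metis inv_mult_group)
      thus "inv a \<in> L" using a Mi Tm LI by simp
      fix b assume "b \<in> L"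
      then obtain m' t' where b: "m' \<in> M" "t' \<in> T" "b = m' \<otimes> t'" by (auto simp: L_def)
      thus "a \<otimes> b \<in> L" using a b split[of m m' t t'] Mm Tm LI by simp
    qed
    have LN: "L \<subseteq> N" using M d(2) subgroup.m_closed[OF N_subgroup] by (auto simp: L_def)
    have Linv: "conj_invariant G N L" unfolding conj_invariant_def
    proof (intro ballI)
      fix n y assume n: "n \<in> N" and "y \<in> L"
      then obtain m t where a: "m \<in> M" "t \<in> T" "y = m \<otimes> t" by (auto simp: L_def)
      have "n \<otimes> y \<otimes> inv n = (n \<otimes> m \<otimes> inv n) \<otimes> (n \<otimes> t \<otimes> inv n)"
        using a n N_carrier Mc Tc by (simp add: word_simps)
      thus "n \<otimes> y \<otimes> inv n \<in> L" using a n conjM d(4) LI by (simp add: conj_invariant_def)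
    qed
    have "M \<subset> L"
    proof -
      have "m \<in> L" if "m \<in> M" for m using LI[OF that d(6)] that Mc by simp
      moreover have "t \<in> L" if "t \<in> T" for t
        using LI[OF subgroup.one_closed[OF conjunct1[OF M]] that] that Tc by simp
      ultimately show ?thesis using False by blast
    qed
    moreover have "finite L" using LN fin N_subset by (meson finite_subset)
    ultimately have "card M < card L" by (simp add: psubset_card_mono)
    hence "L \<inter> S \<noteq> {\<one>}" using max[of L] L LN Linv by auto
    then obtain y where "y \<in> L" "y \<in> S" "y \<noteq> \<one>"
      using subgroup.one_closed[OF L] subgroup.one_closed[OF S] by blast
    then obtain m0 t0 where y: "m0 \<in> M" "t0 \<in> T" "m0 \<otimes> t0 \<in> S" "m0 \<otimes> t0 \<noteq> \<one>" by (auto simp: L_def)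
    have t0: "t0 \<noteq> \<one>" using y M Mc by auto
    \<comment> \<open>The projection of \<open>L \<inter> S\<close> to \<open>T\<close>, nontrivial
      because \<open>M\<close> itself meets \<open>S\<close> trivially.\<close>
    define W where "W = {t \<in> T. \<exists>m\<in>M. m \<otimes> t \<in> S}"
    have "subgroup W G"
    proof (rule subgroupI)
      show "W \<subseteq> carrier G" using Tc by (auto simp: W_def)
      show "W \<noteq> {}" using y by (auto simp: W_def)
      fix a assume "a \<in> W"
      then obtain m where a: "a \<in> T" "m \<in> M" "m \<otimes> a \<in> S" by (auto simp: W_def)
      have "inv (m \<otimes> a) = inv m \<otimes> inv a" using a Mc Tc TMc[of a m] by (metis inv_mult_group)
      hence "inv m \<otimes> inv a \<in> S" using subgroup.m_inv_closed[OF S a(3)] by simp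
      thus "inv a \<in> W" using a Mi Tm by (auto simp: W_def)
      fix b assume "b \<in> W"
      then obtain m' where b: "b \<in> T" "m' \<in> M" "m' \<otimes> b \<in> S" by (auto simp: W_def)
      have "(m \<otimes> m') \<otimes> (a \<otimes> b) \<in> S" using split[of m m' a b] a b subgroup.m_closed[OF S a(3) b(3)] by simp
      thus "a \<otimes> b \<in> W" using a b Mm Tm by (auto simp: W_def)
    qed
    moreover have "conj_invariant G T W" unfolding conj_invariant_def
    proof (intro ballI)
      fix x t assume x: "x \<in> T" and "t \<in> W"
      then obtain m where t: "t \<in> T" "m \<in> M" "m \<otimes> t \<in> S" by (auto simp: W_def)
      \<comment> \<open>\<open>x\<close> is the \<open>T\<close>-part of an element \<open>n\<close>
        of \<open>N \<inter> S\<close>. Conjugation by \<open>n\<close> preserves both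
        \<open>M\<close> and \<open>S\<close>, and on \<open>T\<close> it agrees with conjugation by
        \<open>x\<close>.\<close>
      obtain c where c: "c \<in> centralizer G T \<inter> N" "c \<otimes> x \<in> S" using projection_onto_factor[OF T tr' x] by blast
      define n where "n = c \<otimes> x"
      have nN: "n \<in> N" using c x d(2) subgroup.m_closed[OF N_subgroup] by (auto simp: n_def)
      have cc: "c \<in> carrier G" "x \<in> carrier G" "t \<in> carrier G" "m \<in> carrier G" "n \<in> carrier G"
        using c x t Tc Mc nN N_carrier by auto
      have xt: "x \<otimes> t \<otimes> inv x \<in> T" using x t Tm by simp
      have "n \<otimes> t \<otimes> inv n = c \<otimes> (x \<otimes> t \<otimes> inv x) \<otimes> inv c" using cc by (simp add: n_def word_simps)
      also have "\<dots> = x \<otimes> t \<otimes> inv x" using c xt cc centralizerD[of c T] by (intro iffD2[OF conj_eq_self_iff]) auto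
      finally have nt: "n \<otimes> t \<otimes> inv n = x \<otimes> t \<otimes> inv x" .
      have "n \<otimes> (m \<otimes> t) \<otimes> inv n \<in> S"
        using t(3) c(2) S by (auto simp: n_def intro: subgroup.m_closed subgroup.m_inv_closed)
      moreover have "n \<otimes> (m \<otimes> t) \<otimes> inv n = (n \<otimes> m \<otimes> inv n) \<otimes> (n \<otimes> t \<otimes> inv n)" using cc by (simp add: word_simps)
      ultimately have "(n \<otimes> m \<otimes> inv n) \<otimes> (x \<otimes> t \<otimes> inv x) \<in> S" using nt by simp
      thus "x \<otimes> t \<otimes> inv x \<in> W" using xt conjM[OF nN t(2)] by (auto simp: W_def)
    qed
    moreover have "W \<noteq> {\<one>}" using y t0 by (auto simp: W_def)
    ultimately have WT: "W = T" using factor_simple[OF T, of W] by (auto simp: W_def)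
    show ?thesis
    proof
      fix t assume tT: "t \<in> T"
      then obtain m where m: "m \<in> M" "m \<otimes> t \<in> S" using WT by (auto simp: W_def)
      have "t = inv m \<otimes> (m \<otimes> t)" using m tT Mc Tc by (simp add: word_simps)
      moreover have "m \<otimes> t \<in> N" using m tT M d(2) subgroup.m_closed[OF N_subgroup] by blast
      ultimately show "t \<in> Q" using m Mi unfolding Q_def by blast
    qed
  qed
  have sub: "(\<Union>g\<in>carrier G. conj_image G g T0) \<subseteq> Q"
    by (intro UN_least fQ factor_conj[OF T0])
  have NQ: "N \<subseteq> Q"
    using generate_subgroup_incl[OF sub Q] factor_class_generate[OF T0] by simp
  have "\<exists>r\<in>M. \<exists>s\<in>S. g = r \<otimes> s" if g: "g \<in> carrier G" for g
  proof -
    obtain n s where ns: "n \<in> N" "s \<in> S" "g = n \<otimes> s" using transitive_N[OF g] by blast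
    then obtain m u where mu: "m \<in> M" "u \<in> S" "n = m \<otimes> u" using NQ unfolding Q_def by blast
    have "g = m \<otimes> (u \<otimes> s)" using ns mu Mc S_carrier by (simp add: m_assoc)
    thus ?thesis using mu ns subgroup.m_closed[OF S] by blast
  qed
  thus ?thesis using M by blast
qed

end

section \<open>Actions and intersecting sets\<close>

locale finite_faithful_action = group_action G E \<phi> for G (structure) and E and \<phi> +
  assumes finite_points: "finite E" and points_nonempty: "E \<noteq> {}"
    and faithful: "inj_on \<phi> (carrier G)"

sublocale finite_faithful_action \<subseteq> group G
  using group_hom group_hom.axioms(1) by auto

lemma (in group_action) act_closed: "\<lbrakk>g \<in> carrier G; x \<in> E\<rbrakk> \<Longrightarrow> \<phi> g x \<in> E"
  using element_image by blast

lemma (in group_action) act_one: "x \<in> E \<Longrightarrow> \<phi> \<one> x = x"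
  using id_eq_one by (metis restrict_apply')

lemma (in group_action) act_inv_left: "\<lbrakk>g \<in> carrier G; x \<in> E\<rbrakk> \<Longrightarrow> \<phi> (inv g) (\<phi> g x) = x"
  using orbit_sym_aux by blast

lemma (in group_action) act_inv_right:
  assumes "g \<in> carrier G" "x \<in> E" shows "\<phi> g (\<phi> (inv g) x) = x"
proof -
  interpret group G using group_hom group_hom.axioms(1) by auto
  show ?thesis using act_inv_left[of "inv g" x] assms by simp
qed

lemma (in group_action) act_eqI:
  assumes "g \<in> carrier G" "h \<in> carrier G" "\<And>x. x \<in> E \<Longrightarrow> \<phi> g x = \<phi> h x"
  shows "\<phi> g = \<phi> h"
  using assms bij_prop0[THEN Bij_imp_extensional] by (metis extensionalityI)

text \<open>As \<open>f\<close> is onto, the action laws for \<open>\<psi>\<close> need checking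
  only at points \<open>f x\<close>, where they are those of \<open>\<phi>\<close>. Extensionality
  is asked for because \<open>Bij\<close> consists of extensional functions. The component, product,
  partition and coset actions all arise from this lemma.\<close>

lemma group_action_equivariant_image:
  fixes G (structure)
  assumes "group_action G E \<phi>" "f ` E = E'"
    and ext: "\<And>g. g \<in> carrier G \<Longrightarrow> \<psi> g \<in> extensional E'"
    and eq: "\<And>g x. \<lbrakk>g \<in> carrier G; x \<in> E\<rbrakk> \<Longrightarrow> \<psi> g (f x) = f (\<phi> g x)"
  shows "group_action G E' \<psi>"
proof -
  interpret group_action G E \<phi> by fact
  interpret group G using group_hom group_hom.axioms(1) by auto
  have E': "y \<in> E' \<longleftrightarrow> (\<exists>x\<in>E. y = f x)" for y using assms(2) by blast
  have cl: "\<psi> g y \<in> E'" if "g \<in> carrier G" "y \<in> E'" for g y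
    using that eq act_closed unfolding E' by metis
  have inv1: "\<psi> (inv g) (\<psi> g y) = y" "\<psi> g (\<psi> (inv g) y) = y" if "g \<in> carrier G" "y \<in> E'" for g y
  proof -
    obtain x where x: "x \<in> E" "y = f x" using \<open>y \<in> E'\<close> E' by blast
    show "\<psi> (inv g) (\<psi> g y) = y" "\<psi> g (\<psi> (inv g) y) = y"
      using x that(1) by (simp_all add: eq act_closed act_inv_left act_inv_right)
  qed
  have bij: "\<psi> g \<in> Bij E'" if "g \<in> carrier G" for g
  proof -
    have "bij_betw (\<psi> g) E' E'"
      using that inv1 cl by (intro bij_betw_byWitness[of _ "\<psi> (inv g)"]) auto
    thus ?thesis using ext that by (simp add: Bij_def)
  qed
  have "\<psi> (g \<otimes> h) = compose E' (\<psi> g) (\<psi> h)" if gh: "g \<in> carrier G" "h \<in> carrier G" for g h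
  proof (rule extensionalityI[of _ E'])
    show "\<psi> (g \<otimes> h) \<in> extensional E'" using ext gh by simp
    fix y assume "y \<in> E'"
    then obtain x where x: "x \<in> E" "y = f x" using E' by blast
    show "\<psi> (g \<otimes> h) y = compose E' (\<psi> g) (\<psi> h) y"
      using x gh \<open>y \<in> E'\<close> by (simp add: compose_def eq act_closed composition_rule)
  qed (simp add: compose_def)
  thus ?thesis using bij
    by (auto simp: group_action_def group_hom_def group_hom_axioms_def hom_def BijGroup_def
        group_BijGroup[unfolded BijGroup_def] is_group)
qed

context finite_faithful_action
begin

lemma finite_carrier: "finite (carrier G)"
proof -
  have "\<phi> ` carrier G \<subseteq> (E \<rightarrow>\<^sub>E E)"
    using bij_prop0 by (auto simp: Bij_def PiE_def dest: bij_betw_imp_funcset)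
  moreover have "finite (E \<rightarrow>\<^sub>E E)" using finite_points by (simp add: finite_PiE)
  ultimately show ?thesis using faithful by (meson finite_imageD finite_subset)
qed

lemma faithfulI:
  "\<lbrakk>g \<in> carrier G; h \<in> carrier G; \<And>x. x \<in> E \<Longrightarrow> \<phi> g x = \<phi> h x\<rbrakk> \<Longrightarrow> g = h"
  using faithful act_eqI by (meson inj_onD)

text \<open>The clique--coclique bound: \<open>(x, r) \<mapsto> x\<^sup>-\<^sup>1 r\<close> is injective on \<open>F \<times> R\<close>.\<close>

lemma intersecting_bound:
  assumes R: "subgroup R G" and w: "w \<in> E"
    and RS: "R \<inter> stabilizer G \<phi> w = {\<one>}"
    and fac: "\<And>g. g \<in> carrier G \<Longrightarrow> \<exists>r\<in>R. \<exists>s\<in>stabilizer G \<phi> w. g = r \<otimes> s"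
    and tr: "\<And>x. x \<in> E \<Longrightarrow> \<exists>g\<in>carrier G. x = \<phi> g w"
    and F: "F \<subseteq> carrier G" "\<And>x y. \<lbrakk>x \<in> F; y \<in> F\<rbrakk> \<Longrightarrow> \<exists>a\<in>E. \<phi> (x \<otimes> inv y) a = a"
  shows "card F \<le> card (stabilizer G \<phi> w)"
proof -
  let ?S = "stabilizer G \<phi> w"
  have S: "subgroup ?S G" using w by (rule stabilizer_subgroup)
  have Rc: "r \<in> carrier G" if "r \<in> R" for r using R that by (rule subgroup.mem_carrier)
  \<comment> \<open>\<open>R\<close> is semiregular: \<open>G = R S\<close> makes every point a
    translate of \<open>w\<close> under \<open>R\<close>, so a point stabilizer in \<open>R\<close>
    is conjugate in \<open>R\<close> to the trivial group \<open>R \<inter> S\<close>.\<close>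
  have free: "r = \<one>" if r: "r \<in> R" and a: "a \<in> E" "\<phi> r a = a" for r a
  proof -
    obtain g where g: "g \<in> carrier G" "a = \<phi> g w" using tr[OF a(1)] by blast
    obtain q s where q: "q \<in> R" "s \<in> ?S" "g = q \<otimes> s" using fac[OF g(1)] by blast
    have qc: "q \<in> carrier G" "r \<in> carrier G" "s \<in> carrier G" "\<phi> s w = w"
      using q r Rc by (auto simp: stabilizer_def)
    have aq: "a = \<phi> q w" using g q qc w by (simp add: composition_rule)
    have "\<phi> (inv q \<otimes> r \<otimes> q) w = \<phi> (inv q) (\<phi> r (\<phi> q w))"
      using qc w by (simp add: composition_rule act_closed)
    also have "\<dots> = w" using a aq qc w by (simp add: act_inv_left)
    finally have "inv q \<otimes> r \<otimes> q \<in> ?S" using qc by (simp add: stabilizer_def)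
    moreover have "inv q \<otimes> r \<otimes> q \<in> R" using q r R by (simp add: subgroup.m_closed subgroup.m_inv_closed)
    ultimately have "inv q \<otimes> r \<otimes> q = \<one>" using RS by blast
    hence "q \<otimes> (inv q \<otimes> r \<otimes> q) \<otimes> inv q = \<one>" using qc by simp
    thus ?thesis using qc by (simp add: word_simps)
  qed
  have "inj_on (\<lambda>(x, r). inv x \<otimes> r) (F \<times> R)"
  proof (rule inj_onI, clarify)
    fix x r y q assume a: "x \<in> F" "r \<in> R" "y \<in> F" "q \<in> R" "inv x \<otimes> r = inv y \<otimes> q"
    have c: "x \<in> carrier G" "y \<in> carrier G" "r \<in> carrier G" "q \<in> carrier G" using a F Rc by auto
    have "y \<otimes> (inv x \<otimes> r) \<otimes> inv r = y \<otimes> (inv y \<otimes> q) \<otimes> inv r" using a by simp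
    hence e: "y \<otimes> inv x = q \<otimes> inv r" using c by (simp add: word_simps)
    \<comment> \<open>\<open>y \<otimes> inv x\<close> has a fixed point because \<open>F\<close> is
      intersecting, and it equals an element of the semiregular group \<open>R\<close>, so it is
      trivial.\<close>
    obtain b where "b \<in> E" "\<phi> (q \<otimes> inv r) b = b" using F(2)[OF a(3,1)] e by auto
    hence one: "q \<otimes> inv r = \<one>"
      using free[of "q \<otimes> inv r"] a R by (simp add: subgroup.m_closed subgroup.m_inv_closed)
    hence "q = r" using c by (metis inv_equality inv_inv inv_closed)
    moreover have "y = x" using one e c by (metis inv_equality inv_inv inv_closed)
    ultimately show "x = y \<and> r = q" by simp
  qed
  moreover have "(\<lambda>(x, r). inv x \<otimes> r) ` (F \<times> R) \<subseteq> carrier G" using F Rc by auto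
  ultimately have "card F * card R \<le> card (carrier G)"
    using finite_carrier by (metis card_cartesian_product card_image card_mono)
  also have "\<dots> \<le> card R * card ?S"
  proof -
    have "carrier G \<subseteq> (\<lambda>(r, s). r \<otimes> s) ` (R \<times> ?S)" using fac by fastforce
    moreover have "finite (R \<times> ?S)"
      using finite_carrier R S by (meson finite_SigmaI finite_subset subgroup.subset)
    ultimately have "card (carrier G) \<le> card (R \<times> ?S)" by (rule surj_card_le[rotated])
    thus ?thesis by (simp add: card_cartesian_product)
  qed
  finally have "card F * card R \<le> card ?S * card R" by (simp add: mult.commute)
  moreover have "card R > 0" using R finite_carrier by (rule subgroup.finite_imp_card_positive)
  ultimately show ?thesis by simp
qed

lemma card_stabilizer_eq:
  assumes g: "g \<in> carrier G" and w: "w \<in> E"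
  shows "card (stabilizer G \<phi> (\<phi> g w)) = card (stabilizer G \<phi> w)"
proof -
  have "stabilizer G \<phi> (\<phi> g w) = (\<lambda>s. g \<otimes> s \<otimes> inv g) ` stabilizer G \<phi> w"
  proof (intro Set.set_eqI iffI)
    fix x assume "x \<in> stabilizer G \<phi> (\<phi> g w)"
    hence x: "x \<in> carrier G" "\<phi> x (\<phi> g w) = \<phi> g w" by (auto simp: stabilizer_def)
    have "inv g \<otimes> x \<otimes> g \<in> stabilizer G \<phi> w"
      using x g w by (simp add: stabilizer_def composition_rule act_closed act_inv_left)
    moreover have "x = g \<otimes> (inv g \<otimes> x \<otimes> g) \<otimes> inv g" using x g by (simp add: word_simps)
    ultimately show "x \<in> (\<lambda>s. g \<otimes> s \<otimes> inv g) ` stabilizer G \<phi> w" by blast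
  next
    fix x assume "x \<in> (\<lambda>s. g \<otimes> s \<otimes> inv g) ` stabilizer G \<phi> w"
    then obtain s where "s \<in> carrier G" "\<phi> s w = w" "x = g \<otimes> s \<otimes> inv g" by (auto simp: stabilizer_def)
    thus "x \<in> stabilizer G \<phi> (\<phi> g w)"
      using g w by (simp add: stabilizer_def composition_rule act_closed act_inv_left)
  qed
  moreover have "inj_on (\<lambda>s. g \<otimes> s \<otimes> inv g) (stabilizer G \<phi> w)"
    using g by (auto intro!: inj_onI simp: stabilizer_def)
  ultimately show ?thesis by (simp add: card_image)
qed

end

section \<open>Finite permutation groups and the intersection density\<close>

locale perm_group =
  fixes \<Omega> :: "'a set" and G
  assumes perm: "finite_permutation_group \<Omega> G"

sublocale perm_group \<subseteq> finite_faithful_action "perm_grp \<Omega> G" \<Omega> "\<lambda>g. g"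
proof -
  interpret B: group "BijGroup \<Omega>" by (rule group_BijGroup)
  have G: "subgroup G (BijGroup \<Omega>)" using perm by (simp add: finite_permutation_group_def)
  have "group_hom (perm_grp \<Omega> G) (BijGroup \<Omega>) (\<lambda>g. g)"
    using G subgroup.subset[OF G] B.subgroup_imp_group[OF G]
    by (auto simp: group_hom_def group_hom_axioms_def hom_def B.is_group)
  thus "finite_faithful_action (perm_grp \<Omega> G) \<Omega> (\<lambda>g. g)"
    using perm by (intro finite_faithful_action.intro finite_faithful_action_axioms.intro group_action.intro)
      (auto simp: finite_permutation_group_def)
qed

context perm_group
begin

lemma G_subgroup: "subgroup G (BijGroup \<Omega>)"
  using perm by (simp add: finite_permutation_group_def)

lemma perm_transitive_iff:
  assumes "subgroup N (perm_grp \<Omega> G)"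
  shows "perm_transitive \<Omega> N \<longleftrightarrow> (\<forall>x\<in>\<Omega>. \<forall>y\<in>\<Omega>. \<exists>g\<in>N. g x = y)"
proof -
  interpret B: group "BijGroup \<Omega>" by (rule group_BijGroup)
  have N: "subgroup N (BijGroup \<Omega>)" using B.incl_subgroup[OF G_subgroup assms] .
  have "group_action (perm_grp \<Omega> N) \<Omega> (\<lambda>g. g)"
    using N subgroup.subset[OF N] B.subgroup_imp_group[OF N]
    by (auto simp: group_action_def group_hom_def group_hom_axioms_def hom_def B.is_group)
  thus ?thesis by (auto simp: transitive_action_def transitive_action_axioms_def)
qed

lemma G_transitive_iff: "perm_transitive \<Omega> G \<longleftrightarrow> (\<forall>x\<in>\<Omega>. \<forall>y\<in>\<Omega>. \<exists>g\<in>G. g x = y)"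
  using perm_transitive_iff[of G] subgroup_self by simp

lemma elements_intersect_iff:
  "y \<in> G \<Longrightarrow> elements_intersect \<Omega> x y \<longleftrightarrow>
    (\<exists>a\<in>\<Omega>. (x \<otimes>\<^bsub>perm_grp \<Omega> G\<^esub> inv\<^bsub>perm_grp \<Omega> G\<^esub> y) a = a)"
  using group.m_inv_consistent[OF group_BijGroup G_subgroup] by (simp add: elements_intersect_def)

lemma stabilizer_intersecting:
  assumes "w \<in> \<Omega>" shows "intersecting_set \<Omega> G (point_stabilizer \<Omega> G w)"
proof -
  have "x \<otimes>\<^bsub>perm_grp \<Omega> G\<^esub> inv\<^bsub>perm_grp \<Omega> G\<^esub> y \<in> point_stabilizer \<Omega> G w"
    if "x \<in> point_stabilizer \<Omega> G w" "y \<in> point_stabilizer \<Omega> G w" for x y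
    using that stabilizer_subgroup[OF assms] by (intro subgroup.m_closed subgroup.m_inv_closed)
  moreover have "point_stabilizer \<Omega> G w \<subseteq> G" by (auto simp: stabilizer_def)
  ultimately show ?thesis using assms elements_intersect_iff
    by (fastforce simp: intersecting_set_def stabilizer_def)
qed

lemma finite_G: "finite G" using finite_carrier by simp

lemma maximum_intersecting_set_exists: "\<exists>S. maximum_intersecting_set \<Omega> G S"
proof -
  obtain w where w: "w \<in> \<Omega>" using points_nonempty by blast
  have "\<forall>S. intersecting_set \<Omega> G S \<longrightarrow> card S < Suc (card G)"
    using finite_G by (auto simp: intersecting_set_def less_Suc_eq_le intro: card_mono)
  from ex_has_greatest_nat[OF stabilizer_intersecting[OF w] this]
  show ?thesis by (auto simp: maximum_intersecting_set_def)
qed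

text \<open>Stabilizers are themselves intersecting, so the bound makes each of them maximum, and
  the density becomes a quotient of equal positive numbers.\<close>

lemma EKR_of_bound:
  assumes "\<And>F w. \<lbrakk>w \<in> \<Omega>; intersecting_set \<Omega> G F\<rbrakk> \<Longrightarrow> card F \<le> card (point_stabilizer \<Omega> G w)"
  shows "intersection_density \<Omega> G = 1 \<and> EKR_property \<Omega> G"
proof -
  have m: "maximum_intersecting_set \<Omega> G (point_stabilizer \<Omega> G w)" if "w \<in> \<Omega>" for w
    using assms that stabilizer_intersecting[OF that] by (auto simp: maximum_intersecting_set_def)
  define w where "w = (SOME \<omega>. \<omega> \<in> \<Omega>)"
  have w: "w \<in> \<Omega>" unfolding w_def using points_nonempty by (simp add: some_in_eq)
  define M where "M = (SOME S. maximum_intersecting_set \<Omega> G S)"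
  have M: "maximum_intersecting_set \<Omega> G M"
    unfolding M_def using maximum_intersecting_set_exists by (rule someI_ex)
  have "card M = card (point_stabilizer \<Omega> G w)"
    using M m[OF w] by (auto simp: maximum_intersecting_set_def intro: antisym)
  moreover have "card (point_stabilizer \<Omega> G w) > 0"
    using stabilizer_subgroup[OF w] finite_carrier by (rule subgroup.finite_imp_card_positive)
  ultimately have "intersection_density \<Omega> G = 1"
    by (simp add: intersection_density_def flip: w_def M_def)
  thus ?thesis using m by (simp add: EKR_property_def)
qed

text \<open>In a transitive group all stabilizers have the same order, so the point chosen in the
  definition of the density may be replaced by any other.\<close>

lemma intersection_density_ge:
  assumes tr: "perm_transitive \<Omega> G" and w: "w \<in> \<Omega>" and F: "intersecting_set \<Omega> G F"
  shows "intersection_density \<Omega> G \<ge> card F / card (point_stabilizer \<Omega> G w)"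
proof -
  define v where "v = (SOME \<omega>. \<omega> \<in> \<Omega>)"
  have v: "v \<in> \<Omega>" unfolding v_def using points_nonempty by (simp add: some_in_eq)
  define M where "M = (SOME S. maximum_intersecting_set \<Omega> G S)"
  have M: "maximum_intersecting_set \<Omega> G M"
    unfolding M_def using maximum_intersecting_set_exists by (rule someI_ex)
  have "card F \<le> card M" using M F by (simp add: maximum_intersecting_set_def)
  moreover obtain g where "g \<in> G" "g w = v" using tr w v G_transitive_iff by blast
  hence "card (point_stabilizer \<Omega> G v) = card (point_stabilizer \<Omega> G w)"
    using card_stabilizer_eq[of g w] w by simp
  ultimately show ?thesis
    by (simp add: intersection_density_def divide_right_mono flip: v_def M_def)
qed

end

section \<open>Simple normal subgroups, socles and almost simple groups\<close>

lemma nonabelian_simple_iso: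
  assumes G: "nonabelian_simple G" and iso: "\<phi> \<in> iso G H" and H: "group H"
  shows "nonabelian_simple H"
proof -
  have g: "group G" "simple_group G" using G by (auto simp: nonabelian_simple_def simple_group_def)
  have "\<not> comm_group H"
  proof
    assume "comm_group H"
    then interpret H: comm_group H .
    have "H \<cong> G" using group.iso_set_sym[OF g(1) iso] by (auto simp: is_iso_def)
    hence "comm_group G" using g(1) H.iso_imp_comm_group group.is_monoid by blast
    thus False using G by (simp add: nonabelian_simple_def)
  qed
  thus ?thesis using simple_group.iso_simple[OF g(2) H iso] by (simp add: nonabelian_simple_def)
qed

lemma (in group) minimal_normal_of_simple:
  assumes T: "T \<lhd> G" and simple: "nonabelian_simple (G\<lparr>carrier := T\<rparr>)"
  shows "minimal_normal G T"
proof -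
  interpret s: simple_group "G\<lparr>carrier := T\<rparr>" using simple by (simp add: nonabelian_simple_def)
  have Ts: "subgroup T G" using T by (rule normal_imp_subgroup)
  have "M = T" if "M \<lhd> G" "M \<noteq> {\<one>}" "M \<subseteq> T" for M
  proof -
    have "M \<lhd> G\<lparr>carrier := T\<rparr>"
      using that subgroup.subset[OF Ts]
      by (auto simp: normal_subgroup_iff[OF Ts] normal_iff_conj_invariant conj_invariant_def)
    thus ?thesis using s.no_real_normal_subgroup that by fastforce
  qed
  moreover have "T \<noteq> {\<one>}" using s.simple_not_triv by simp
  ultimately show ?thesis using T by (auto simp: minimal_normal_def)
qed

lemma (in group) socle_of_simple:
  assumes "finite (carrier G)" "T \<lhd> G" "nonabelian_simple (G\<lparr>carrier := T\<rparr>)" "centralizer G T = {\<one>}"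
  shows "socle G = T"
proof -
  interpret minimal_normal_centerless G T
    using assms minimal_normal_of_simple by unfold_locales auto
  have Ts: "subgroup T G" using assms by (simp add: normal_imp_subgroup)
  have "generate G T = T"
    using generate_subgroup_incl[OF _ Ts, of T] generate.incl[of _ T G] by blast
  thus ?thesis by (simp add: socle_def unique_minimal_normal)
qed

text \<open>Conjugation maps \<open>G\<close> to the automorphisms of \<open>T\<close> with the
  centralizer of \<open>T\<close> as kernel, and the elements of \<open>T\<close> induce the inner
  automorphisms.\<close>

lemma almost_simpleI:
  fixes G :: "'a monoid" (structure)
  assumes "group G" and T: "T \<lhd> G" and simple: "nonabelian_simple (G\<lparr>carrier := T\<rparr>)"
    and cen: "centralizer G T = {\<one>}"
  shows "almost_simple G"
proof -
  interpret group G by fact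
  have Ts: "subgroup T G" using T by (rule normal_imp_subgroup)
  have Tc: "x \<in> carrier G" if "x \<in> T" for x using T that by (rule normal_carrier)
  let ?T = "G\<lparr>carrier := T\<rparr>"
  have T_conj: "g \<otimes> x \<otimes> inv g \<in> T" if "g \<in> carrier G" "x \<in> T" for g x
    using T that by (simp add: normal_inv_iff)
  define c where "c g = (\<lambda>x\<in>T. g \<otimes> x \<otimes> inv g)" for g
  have "c g \<in> Bij T" if g: "g \<in> carrier G" for g
  proof -
    have "bij_betw (c g) T T"
    proof (rule bij_betw_byWitness[of _ "c (inv g)"])
      show "\<forall>x\<in>T. c (inv g) (c g x) = x" "\<forall>x\<in>T. c g (c (inv g) x) = x"
        using g Tc T_conj[OF g] T_conj[of "inv g"] by (auto simp: c_def word_simps)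
      show "c g ` T \<subseteq> T" "c (inv g) ` T \<subseteq> T"
        using g T_conj[OF g] T_conj[of "inv g"] by (auto simp: c_def)
    qed
    thus ?thesis by (simp add: Bij_def c_def)
  qed
  moreover have "c g \<in> hom ?T ?T" if g: "g \<in> carrier G" for g
    using g T_conj Tc subgroup.m_closed[OF Ts]
    by (auto simp: hom_def c_def word_simps)
  ultimately have auto: "c g \<in> auto ?T" if "g \<in> carrier G" for g
    using that by (simp add: auto_def)
  have cmul: "c (g \<otimes> h) = compose T (c g) (c h)" if "g \<in> carrier G" "h \<in> carrier G" for g h
  proof (rule extensionalityI[of _ T])
    fix x assume "x \<in> T"
    thus "c (g \<otimes> h) x = compose T (c g) (c h) x"
      using that T_conj Tc by (auto simp: c_def compose_def word_simps)
  qed (auto simp: c_def compose_def)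
  have "c \<in> hom G (AutoGroup ?T)"
    using auto cmul by (auto simp: hom_def AutoGroup_def BijGroup_def auto_def)
  moreover have "inj_on c (carrier G)"
  proof (rule inj_onI)
    fix g h assume gh: "g \<in> carrier G" "h \<in> carrier G" "c g = c h"
    have "(inv h \<otimes> g) \<otimes> x = x \<otimes> (inv h \<otimes> g)" if x: "x \<in> T" for x
    proof -
      have "g \<otimes> x \<otimes> inv g = h \<otimes> x \<otimes> inv h" using x gh(3) by (auto simp: c_def dest: fun_cong[of _ _ x])
      hence "inv h \<otimes> (g \<otimes> x \<otimes> inv g) \<otimes> g = inv h \<otimes> (h \<otimes> x \<otimes> inv h) \<otimes> g" by simp
      thus ?thesis using gh(1,2) Tc[OF x] by (simp add: word_simps)
    qed
    hence "inv h \<otimes> g \<in> centralizer G T" using gh by (auto simp: centralizer_def)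
    hence "h \<otimes> (inv h \<otimes> g) = h" using cen gh by simp
    thus "g = h" using gh by (simp add: word_simps)
  qed
  moreover have "inner_automorphisms ?T \<subseteq> c ` carrier G"
    using Tc m_inv_consistent[OF Ts] by (auto simp: inner_automorphisms_def c_def)
  ultimately show ?thesis using simple is_group unfolding almost_simple_def by blast
qed

section \<open>The case division for quasiprimitive actions\<close>

lemma (in group_action) group_action_subgroup:
  assumes H: "subgroup H G" shows "group_action (G\<lparr>carrier := H\<rparr>) E \<phi>"
proof -
  interpret group_hom G "BijGroup E" \<phi> by (rule group_hom)
  show ?thesis
    using H subgroup.subset[OF H] subgroup.subgroup_is_group[OF H G.is_group] homh
    by (auto simp: group_action_def group_hom_def group_hom_axioms_def hom_def subset_iff group_BijGroup)
qed

text \<open>The trivial group is quasiprimitive for want of nontrivial normal subgroups, on any set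
  whatever. \<open>nontrivial\<close> excludes it, and transitivity of \<open>G\<close> itself
  follows.\<close>

locale quasiprimitive_action = finite_faithful_action +
  assumes quasi_transitive: "\<lbrakk>N \<lhd> G; N \<noteq> {\<one>}; x \<in> E; y \<in> E\<rbrakk> \<Longrightarrow> \<exists>n\<in>N. \<phi> n x = y"
    and nontrivial: "carrier G \<noteq> {\<one>}"
begin

lemma transitive: "\<lbrakk>x \<in> E; y \<in> E\<rbrakk> \<Longrightarrow> \<exists>g\<in>carrier G. \<phi> g x = y"
  using quasi_transitive[of "carrier G"] nontrivial
  by (simp add: normal_inv_iff subgroup_self)

lemma quasiprimitive_pair_stabilizer:
  assumes w: "w \<in> E" shows "quasiprimitive_pair G (stabilizer G \<phi> w)"
proof (intro quasiprimitive_pair.intro quasiprimitive_pair_axioms.intro)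
  show "group G" by (rule is_group)
  show "finite (carrier G)" by (rule finite_carrier)
  show "subgroup (stabilizer G \<phi> w) G" using w by (rule stabilizer_subgroup)
  show "\<exists>n\<in>N. \<exists>s\<in>stabilizer G \<phi> w. g = n \<otimes> s" if N: "N \<lhd> G" "N \<noteq> {\<one>}" "g \<in> carrier G" for N g
  proof -
    obtain n where n: "n \<in> N" "\<phi> n w = \<phi> g w"
      using quasi_transitive[OF N(1,2) w act_closed[OF N(3) w]] by blast
    have nc: "n \<in> carrier G" using N n normal_carrier by blast
    have "\<phi> (inv n \<otimes> g) w = \<phi> (inv n) (\<phi> n w)" using n(2) nc N(3) w by (simp add: composition_rule)
    hence "inv n \<otimes> g \<in> stabilizer G \<phi> w" using nc N(3) w by (simp add: stabilizer_def act_inv_left)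
    moreover have "g = n \<otimes> (inv n \<otimes> g)" using nc N by (simp add: word_simps)
    ultimately show ?thesis using n by blast
  qed
  show "N = {\<one>}" if N: "N \<lhd> G" "N \<subseteq> stabilizer G \<phi> w" for N
  proof (rule ccontr)
    assume ne: "N \<noteq> {\<one>}"
    \<comment> \<open>A nontrivial \<open>N\<close> inside the stabilizer of \<open>w\<close> is
      transitive and fixes \<open>w\<close>, so there is only one point, and faithfulness makes
      \<open>G\<close> trivial.\<close>
    have "E = {w}" using quasi_transitive[OF N(1) ne w] N(2) w by (auto simp: stabilizer_def)
    hence "g = \<one>" if "g \<in> carrier G" for g
      using that act_closed[OF that] by (intro faithfulI) (auto simp: act_one)
    thus False using nontrivial by auto
  qed
qed

end

text \<open>\<open>intransitive\<close> says that the centralizer of \<open>T0\<close> times the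
  stabilizer is not all of \<open>G\<close>, that is, that this centralizer has more than one
  orbit.\<close>

locale product_type_action =
  quasiprimitive_action G E \<phi> +
  quasiprimitive_pair_factors G "stabilizer G \<phi> w" N
  for G :: "('a, 'c) monoid_scheme" (structure) and E :: "'b set" and \<phi> w N +
  fixes T0
  assumes base: "w \<in> E" and T0: "factor T0"
    and intransitive: "\<exists>g\<in>carrier G. \<forall>c\<in>centralizer G T0. \<forall>s\<in>stabilizer G \<phi> w. g \<noteq> c \<otimes> s"

text \<open>The number of factors is decided before transitivity of the centralizer is, so the
  product case comes with a second factor; this is the source of \<open>k \<ge> 2\<close>.\<close>

lemma (in quasiprimitive_action) onan_scott_cases:
  obtains (regular) R w where "w \<in> E" "subgroup R G" "R \<inter> stabilizer G \<phi> w = {\<one>}"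
      "\<And>g. g \<in> carrier G \<Longrightarrow> \<exists>r\<in>R. \<exists>s\<in>stabilizer G \<phi> w. g = r \<otimes> s"
  | (simple) T where "T \<lhd> G" "nonabelian_simple (G\<lparr>carrier := T\<rparr>)" "centralizer G T = {\<one>}"
  | (product) w N T0 where "product_type_action G E \<phi> w N T0"
      "\<exists>T. minimal_normal_centerless.factor G N T \<and> T \<noteq> T0"
proof -
  obtain w where w: "w \<in> E" using points_nonempty by blast
  interpret quasiprimitive_pair G "stabilizer G \<phi> w" using w by (rule quasiprimitive_pair_stabilizer)
  obtain N where N: "minimal_normal G N" using ex_minimal_normal[OF finite_carrier nontrivial] by blast
  have Nn: "N \<lhd> G" "N \<noteq> {\<one>}" using N by (auto simp: minimal_normal_def)
  show ?thesis
  proof (cases "N \<inter> stabilizer G \<phi> w = {\<one>}")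
    case True
    thus ?thesis using regular[OF w normal_imp_subgroup[OF Nn(1)]] quasi[OF Nn] by blast
  next
    case False
    interpret F: quasiprimitive_pair_factors G "stabilizer G \<phi> w" N
      using N False centralizer_minimal_normal finite_carrier by unfold_locales auto
    obtain T0 where T0: "F.factor T0" using F.factor_exists by blast
    show ?thesis
    proof (cases "\<exists>T. F.factor T \<and> T \<noteq> T0")
      case False
      hence "conj_image G g T0 = T0" if "g \<in> carrier G" for g
        using F.factor_conj[OF T0 that] by blast
      hence "(\<Union>g\<in>carrier G. conj_image G g T0) = T0" by auto
      hence "generate G T0 = N" using F.factor_class_generate[OF T0] by simp
      moreover have "generate G T0 = T0"
        using generate_subgroup_incl[OF _ F.factorD(1)[OF T0], of T0] generate.incl[of _ T0 G] by blast
      ultimately have "T0 = N" by simp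
      thus ?thesis
        using simple[OF Nn(1)] F.factor_nonabelian_simple[OF T0] F.centralizer_trivial by simp
    next
      case True
      show ?thesis
      proof (cases "\<forall>g\<in>carrier G. \<exists>c\<in>centralizer G T0. \<exists>s\<in>stabilizer G \<phi> w. g = c \<otimes> s")
        case True
        thus ?thesis using F.exists_regular_subgroup[OF T0] regular[OF w] by blast
      next
        case False
        have "product_type_action G E \<phi> w N T0"
          using False w T0 by unfold_locales auto
        thus ?thesis using product True by blast
      qed
    qed
  qed
qed

section \<open>Product action\<close>

lemma (in group) centralizer_conj_image:
  assumes A: "A \<subseteq> carrier G" and g: "g \<in> carrier G"
  shows "centralizer G (conj_image G g A) = conj_image G g (centralizer G A)"
proof (intro subset_antisym subsetI)
  fix x assume x: "x \<in> centralizer G (conj_image G g A)"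
  have xc: "x \<in> carrier G" using x centralizer_carrier by blast
  have "inv g \<otimes> x \<otimes> inv (inv g) \<in> centralizer G A"
    using centralizer_conj[OF conj_image_subset[OF A g] _ x, of "inv g"] conj_image_inv[OF A g] g by simp
  hence "g \<otimes> (inv g \<otimes> x \<otimes> inv (inv g)) \<otimes> inv g \<in> conj_image G g (centralizer G A)"
    by (auto simp: conj_image_def)
  thus "x \<in> conj_image G g (centralizer G A)" using xc g by (simp add: word_simps)
next
  fix x assume "x \<in> conj_image G g (centralizer G A)"
  thus "x \<in> centralizer G (conj_image G g A)"
    using centralizer_conj[OF A g] by (auto simp: conj_image_def)
qed

lemma iso_image_of_inj_hom:
  assumes "h \<in> hom G H" "inj_on h (carrier G)"
  shows "h \<in> iso G (H\<lparr>carrier := h ` carrier G\<rparr>)"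
  using assms by (auto simp: iso_def hom_def bij_betw_def)

section \<open>Orbits of the centralizers of the factors\<close>

context product_type_action
begin

definition orb :: "'a set \<Rightarrow> 'b \<Rightarrow> 'b set" where
  "orb T x = (\<lambda>c. \<phi> c x) ` centralizer G T"

lemma orb_shift:
  assumes T: "T \<subseteq> carrier G" and x: "x \<in> E" and c: "c \<in> centralizer G T"
  shows "orb T (\<phi> c x) = orb T x"
proof -
  note sub = centralizer_subgroup[OF T]
  have cc: "c \<in> carrier G" using c centralizer_carrier by blast
  show ?thesis
  proof (intro subset_antisym subsetI)
    fix y assume "y \<in> orb T (\<phi> c x)"
    then obtain e where e: "e \<in> centralizer G T" "y = \<phi> e (\<phi> c x)" by (auto simp: orb_def)
    hence "y = \<phi> (e \<otimes> c) x" using cc x centralizer_carrier by (simp add: composition_rule)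
    thus "y \<in> orb T x" using subgroup.m_closed[OF sub e(1) c] by (auto simp: orb_def)
  next
    fix y assume "y \<in> orb T x"
    then obtain e where e: "e \<in> centralizer G T" "y = \<phi> e x" by (auto simp: orb_def)
    hence "y = \<phi> (e \<otimes> inv c) (\<phi> c x)"
      using cc x centralizer_carrier by (simp add: composition_rule act_closed act_inv_left)
    thus "y \<in> orb T (\<phi> c x)"
      using subgroup.m_closed[OF sub e(1) subgroup.m_inv_closed[OF sub c]] by (auto simp: orb_def)
  qed
qed

lemma orb_eq_iff:
  assumes T: "T \<subseteq> carrier G" and x: "x \<in> E" and y: "y \<in> E"
  shows "orb T x = orb T y \<longleftrightarrow> (\<exists>c\<in>centralizer G T. y = \<phi> c x)"
proof
  assume "orb T x = orb T y"
  moreover have "\<one> \<in> centralizer G T" using centralizer_subgroup[OF T] by (rule subgroup.one_closed)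
  hence "y \<in> orb T y" using act_one[OF y] unfolding orb_def by force
  ultimately show "\<exists>c\<in>centralizer G T. y = \<phi> c x" by (auto simp: orb_def)
next
  assume "\<exists>c\<in>centralizer G T. y = \<phi> c x"
  thus "orb T x = orb T y" using orb_shift[OF T x] by auto
qed

lemma orb_image:
  assumes T: "T \<subseteq> carrier G" and x: "x \<in> E" and g: "g \<in> carrier G"
  shows "\<phi> g ` orb T x = orb (conj_image G g T) (\<phi> g x)"
proof -
  have "\<phi> g (\<phi> c x) = \<phi> (g \<otimes> c \<otimes> inv g) (\<phi> g x)" if "c \<in> centralizer G T" for c
    using that g x centralizer_carrier by (simp add: composition_rule act_closed act_inv_left)
  hence "\<phi> g ` orb T x = (\<lambda>c. \<phi> (g \<otimes> c \<otimes> inv g) (\<phi> g x)) ` centralizer G T"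
    by (simp add: orb_def image_image cong: image_cong)
  thus ?thesis
    unfolding orb_def centralizer_conj_image[OF T g] by (simp add: conj_image_def image_image)
qed

lemma orb_cong:
  assumes T: "T \<subseteq> carrier G" and "x \<in> E" "y \<in> E" and g: "g \<in> carrier G"
  shows "orb (conj_image G g T) (\<phi> g x) = orb (conj_image G g T) (\<phi> g y) \<longleftrightarrow> orb T x = orb T y"
proof -
  have "orb T x \<subseteq> E" "orb T y \<subseteq> E"
    using assms act_closed centralizer_carrier by (auto simp: orb_def)
  hence "\<phi> g ` orb T x = \<phi> g ` orb T y \<longleftrightarrow> orb T x = orb T y"
    by (rule inj_on_image_eq_iff[OF inj_prop[OF g]])
  thus ?thesis using assms by (simp add: orb_image)
qed

text \<open>\<open>N\<close> is transitive, and each of its elements is one of \<open>T\<close>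
  times one that centralizes \<open>T\<close>. The second part does not move the orbits, so
  \<open>T\<close> alone is transitive on them.\<close>

lemma factor_transitive_on_orbits:
  assumes T: "factor T" and x: "x \<in> E" "y \<in> E"
  shows "\<exists>t\<in>T. orb T y = orb T (\<phi> t x)"
proof -
  note d = factorD[OF T]
  obtain n where n: "n \<in> N" "\<phi> n x = y" using quasi_transitive[OF N_normal N_nontrivial x] by blast
  obtain t c where tc: "t \<in> T" "c \<in> centralizer G T" "n = t \<otimes> c" using factor_decomposition[OF T n(1)] by blast
  have cc: "t \<in> carrier G" "c \<in> carrier G" using tc d(5) centralizer_carrier by auto
  have "n = c \<otimes> t" using tc centralizerD by metis
  hence "y = \<phi> c (\<phi> t x)" using n cc x by (simp add: composition_rule)
  thus ?thesis using orb_shift[OF d(5) act_closed[OF cc(1) x(1)] tc(2)] tc(1) by blast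
qed

text \<open>\<open>w\<close> is moved by an element of \<open>N\<close> whose component in each
  factor is prescribed; the component in \<open>T\<close> is all that the \<open>T\<close>-th orbit
  depends on. This is surjectivity of the coordinates.\<close>

lemma orbits_independent:
  assumes y: "\<And>T. factor T \<Longrightarrow> y T \<in> E"
  shows "\<exists>x\<in>E. \<forall>T. factor T \<longrightarrow> orb T x = orb T (y T)"
proof -
  have "\<exists>t. t \<in> T \<and> orb T (y T) = orb T (\<phi> t w)" if "factor T" for T
    using factor_transitive_on_orbits[OF that base y[OF that]] by blast
  then obtain t where t: "\<And>T. factor T \<Longrightarrow> t T \<in> T" "\<And>T. factor T \<Longrightarrow> orb T (y T) = orb T (\<phi> (t T) w)"
    by metis
  obtain n where n: "n \<in> N"
    "\<And>T. factor T \<Longrightarrow> (if T \<in> {T. factor T} then inv (t T) \<otimes> n else n) \<in> centralizer G T"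
    using factors_independent[OF factors_finite, of t] t(1) by auto
  have nc: "n \<in> carrier G" using n N_carrier by blast
  have "orb T (\<phi> n w) = orb T (y T)" if T: "factor T" for T
  proof -
    note d = factorD[OF T]
    define c where "c = inv (t T) \<otimes> n"
    have c: "c \<in> centralizer G T" using n(2)[OF T] T by (simp add: c_def)
    have cc: "t T \<in> carrier G" "c \<in> carrier G" using t(1)[OF T] d(5) c centralizer_carrier by auto
    have "n = t T \<otimes> c" using nc cc by (simp add: c_def word_simps)
    hence "n = c \<otimes> t T" using centralizerD[OF c t(1)[OF T]] by simp
    hence "\<phi> n w = \<phi> c (\<phi> (t T) w)" using cc base by (simp add: composition_rule)
    thus ?thesis using orb_shift[OF d(5) act_closed[OF cc(1) base] c] t(2)[OF T] by simp
  qed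
  thus ?thesis using act_closed[OF nc base] by blast
qed

end

section \<open>Coordinates on the points and the component group\<close>

locale product_type_indexed = product_type_action G E \<phi> w N T0
  for G :: "('a, 'c) monoid_scheme" (structure) and E :: "'b set" and \<phi> w N T0 +
  fixes k :: nat and Tf :: "nat \<Rightarrow> 'a set" and gc :: "nat \<Rightarrow> 'a" and d :: "'b set \<Rightarrow> nat"
  assumes Tf: "bij_betw Tf {..<k} {T. factor T}"
    and gc: "\<And>i. i < k \<Longrightarrow> gc i \<in> carrier G" "\<And>i. i < k \<Longrightarrow> Tf i = conj_image G (gc i) T0"
    and d: "bij_betw d (orb T0 ` E) {..<card (orb T0 ` E)}"
begin

lemma Tf_factor: "i < k \<Longrightarrow> factor (Tf i)" using Tf by (auto simp: bij_betw_def)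
lemma factor_Tf: "factor T \<Longrightarrow> \<exists>i<k. T = Tf i"
  using bij_betw_imp_surj_on[OF Tf] by blast
lemma T0_subset: "T0 \<subseteq> carrier G" using factorD(5)[OF T0] .

definition Delta :: "nat set" where "Delta = {..<card (orb T0 ` E)}"
definition crd :: "'b \<Rightarrow> nat" where "crd x = d (orb T0 x)"
text \<open>\<open>inv (gc i)\<close> carries orbits of the centralizer of \<open>Tf i\<close> to
  orbits of the centralizer of \<open>T0\<close>. In this way all coordinates take values in the
  same set of numbers.\<close>

definition coord :: "'b \<Rightarrow> nat \<Rightarrow> nat" where "coord x = (\<lambda>i\<in>{..<k}. crd (\<phi> (inv (gc i)) x))"

lemma crd_image: "crd ` E = Delta"
  using d by (auto simp: crd_def Delta_def bij_betw_def image_image)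

lemma crd_eq_iff: "\<lbrakk>x \<in> E; y \<in> E\<rbrakk> \<Longrightarrow> crd x = crd y \<longleftrightarrow> orb T0 x = orb T0 y"
  using d by (auto simp: crd_def bij_betw_def dest!: inj_onD)

lemma crd_in: "x \<in> E \<Longrightarrow> crd x \<in> Delta" using crd_image by blast

lemma crd_gc_eq_iff:
  assumes i: "i < k" and x: "x \<in> E" "y \<in> E"
  shows "crd (\<phi> (inv (gc i)) x) = crd (\<phi> (inv (gc i)) y) \<longleftrightarrow> orb (Tf i) x = orb (Tf i) y"
proof -
  have g: "gc i \<in> carrier G" "inv (gc i) \<in> carrier G" using gc i by auto
  show ?thesis
    using orb_cong[OF T0_subset act_closed[OF g(2) x(1)] act_closed[OF g(2) x(2)] g(1)] g x gc(2)[OF i]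
    by (simp add: crd_eq_iff act_closed act_inv_right)
qed

lemma coord_eq_iff:
  assumes "x \<in> E" "y \<in> E"
  shows "coord x = coord y \<longleftrightarrow> (\<forall>T. factor T \<longrightarrow> orb T x = orb T y)"
proof -
  have "coord x = coord y \<longleftrightarrow> (\<forall>i<k. orb (Tf i) x = orb (Tf i) y)"
    using assms crd_gc_eq_iff by (auto simp: coord_def restrict_def fun_eq_iff)
  thus ?thesis using Tf_factor factor_Tf by metis
qed

lemma coord_image: "coord ` E = cartesian_power Delta k"
proof (intro subset_antisym subsetI)
  fix z assume "z \<in> coord ` E"
  then obtain x where x: "x \<in> E" "z = coord x" by blast
  show "z \<in> cartesian_power Delta k"
    unfolding cartesian_power_def x(2)
    by (rule PiE_I) (use x gc in \<open>auto simp: coord_def intro!: crd_in act_closed\<close>)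
next
  fix z assume z: "z \<in> cartesian_power Delta k"
  have "\<exists>u. u \<in> E \<and> crd (\<phi> (inv (gc i)) u) = z i" if i: "i < k" for i
  proof -
    have "z i \<in> crd ` E" using z i by (auto simp: cartesian_power_def crd_image)
    then obtain v where "v \<in> E" "crd v = z i" by auto
    thus ?thesis using gc(1)[OF i] act_closed act_inv_left by (intro exI[of _ "\<phi> (gc i) v"]) auto
  qed
  then obtain u where u: "\<And>i. i < k \<Longrightarrow> u i \<in> E" "\<And>i. i < k \<Longrightarrow> crd (\<phi> (inv (gc i)) (u i)) = z i"
    by metis
  define y where "y T = u (inv_into {..<k} Tf T)" for T
  have yT: "y (Tf i) = u i" if "i < k" for i
    using Tf that by (simp add: y_def bij_betw_def)
  have "y T \<in> E" if "factor T" for T using factor_Tf[OF that] yT u by auto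
  then obtain x where x: "x \<in> E" "\<And>T. factor T \<Longrightarrow> orb T x = orb T (y T)" using orbits_independent by metis
  have "crd (\<phi> (inv (gc i)) x) = z i" if i: "i < k" for i
    using crd_gc_eq_iff[OF i x(1) u(1)[OF i]] x(2)[OF Tf_factor[OF i]] yT[OF i] u(2)[OF i] by simp
  hence "coord x = z" using z by (auto simp: coord_def cartesian_power_def restrict_def PiE_def extensional_def)
  thus "z \<in> coord ` E" using x by blast
qed

text \<open>The place where \<open>intransitive\<close> enters: with a single orbit every element of
  \<open>G\<close> would be a product of one centralizing \<open>T0\<close> and one fixing
  \<open>w\<close>.\<close>

lemma Delta_card: "Delta \<noteq> {a}"
proof
  assume a: "Delta = {a}"
  obtain g where g: "g \<in> carrier G" "\<And>c s. \<lbrakk>c \<in> centralizer G T0; s \<in> stabilizer G \<phi> w\<rbrakk> \<Longrightarrow> g \<noteq> c \<otimes> s"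
    using intransitive by blast
  have gw: "\<phi> g w \<in> E" using g base act_closed by blast
  have "crd w = crd (\<phi> g w)" using a crd_in[OF base] crd_in[OF gw] by simp
  then obtain c where c: "c \<in> centralizer G T0" "\<phi> g w = \<phi> c w"
    using crd_eq_iff[OF base gw] orb_eq_iff[OF T0_subset base gw] by auto
  have cc: "c \<in> carrier G" using c centralizer_carrier by blast
  have "\<phi> (inv c \<otimes> g) w = \<phi> (inv c) (\<phi> c w)" using c(2) g cc base by (simp add: composition_rule)
  hence "inv c \<otimes> g \<in> stabilizer G \<phi> w" using g cc base by (simp add: stabilizer_def act_inv_left)
  moreover have "g = c \<otimes> (inv c \<otimes> g)" using cc g by (simp add: word_simps)
  ultimately show False using g(2) c(1) by blast
qed

definition Nm :: "'a set" where "Nm = {n \<in> carrier G. conj_image G n T0 = T0}"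

lemma Nm_subgroup: "subgroup Nm G"
proof (rule subgroupI)
  show "Nm \<subseteq> carrier G" by (auto simp: Nm_def)
  show "Nm \<noteq> {}" using conj_image_one[OF T0_subset] by (auto simp: Nm_def)
  fix a assume a: "a \<in> Nm"
  thus "inv a \<in> Nm" using conj_image_inv[OF T0_subset, of a] by (auto simp: Nm_def)
  fix b assume "b \<in> Nm"
  thus "a \<otimes> b \<in> Nm" using a conj_image_mult[OF T0_subset] by (auto simp: Nm_def)
qed

lemma NmD: "n \<in> Nm \<Longrightarrow> n \<in> carrier G" "n \<in> Nm \<Longrightarrow> conj_image G n T0 = T0"
  by (auto simp: Nm_def)

lemma T0_Nm: "T0 \<subseteq> Nm"
proof
  fix t assume t: "t \<in> T0"
  note f = factorD[OF T0]
  have "conj_image G t T0 = T0"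
    using t f by (intro conj_image_self) (auto intro: subgroup.m_closed subgroup.m_inv_closed)
  thus "t \<in> Nm" using t f by (auto simp: Nm_def)
qed

definition hperm :: "'a \<Rightarrow> nat \<Rightarrow> nat" where
  "hperm n = (\<lambda>a\<in>Delta. crd (\<phi> n (inv_into E crd a)))"

text \<open>An element normalizing \<open>T0\<close> also normalizes its centralizer and so permutes
  the orbits. Hence the representative chosen in \<open>hperm\<close> does not matter.\<close>

lemma hperm_crd:
  assumes n: "n \<in> Nm" and x: "x \<in> E" shows "hperm n (crd x) = crd (\<phi> n x)"
proof -
  define y where "y = inv_into E crd (crd x)"
  have y: "y \<in> E" "crd y = crd x" using x by (auto simp: y_def inv_into_into f_inv_into_f)
  have "crd (\<phi> n y) = crd (\<phi> n x)"
    using orb_cong[OF T0_subset y(1) x NmD(1)[OF n]] y x n NmD act_closed by (simp add: crd_eq_iff)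
  thus ?thesis using crd_in[OF x] by (simp add: hperm_def y_def)
qed

lemma hperm_action: "group_action (G\<lparr>carrier := Nm\<rparr>) Delta hperm"
  by (rule group_action_equivariant_image[OF group_action_subgroup[OF Nm_subgroup] crd_image])
    (auto simp: hperm_crd, auto simp: hperm_def)

definition H :: "(nat \<Rightarrow> nat) set" where "H = hperm ` Nm"

lemma hperm_eq_one_iff:
  assumes n: "n \<in> Nm" shows "hperm n = (\<lambda>a\<in>Delta. a) \<longleftrightarrow> (\<forall>x\<in>E. crd (\<phi> n x) = crd x)"
proof
  assume e: "hperm n = (\<lambda>a\<in>Delta. a)"
  show "\<forall>x\<in>E. crd (\<phi> n x) = crd x"
    using hperm_crd[OF n] crd_in by (auto simp: e)
next
  assume a: "\<forall>x\<in>E. crd (\<phi> n x) = crd x"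
  show "hperm n = (\<lambda>a\<in>Delta. a)"
  proof (rule extensionalityI[of _ Delta])
    fix a assume "a \<in> Delta"
    then obtain x where "x \<in> E" "a = crd x" using crd_image by blast
    thus "hperm n a = (\<lambda>a\<in>Delta. a) a" using hperm_crd[OF n] a crd_in by simp
  qed (auto simp: hperm_def)
qed

text \<open>The kernel on \<open>T0\<close> is normal in the simple group \<open>T0\<close>. If it
  were \<open>T0\<close>, then \<open>T0\<close> would fix every orbit; as it is transitive on the
  orbits, there would be only one, contrary to \<open>Delta_card\<close>.\<close>

lemma hperm_T0_inj: "inj_on hperm T0"
proof -
  note f = factorD[OF T0]
  define K where "K = {t \<in> T0. \<forall>x\<in>E. crd (\<phi> t x) = crd x}"
  have "subgroup K G"
  proof (rule subgroupI)
    show "K \<subseteq> carrier G" using f by (auto simp: K_def)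
    have "\<one> \<in> K" using f act_one by (auto simp: K_def)
    thus "K \<noteq> {}" by blast
    fix a assume a: "a \<in> K"
    hence ac: "a \<in> carrier G" "a \<in> T0" using f by (auto simp: K_def)
    have "crd (\<phi> (inv a) x) = crd x" if x: "x \<in> E" for x
    proof -
      have "crd (\<phi> a (\<phi> (inv a) x)) = crd (\<phi> (inv a) x)" using a x ac act_closed by (auto simp: K_def)
      thus ?thesis using x ac by (simp add: act_inv_right)
    qed
    thus "inv a \<in> K" using ac f(1) by (auto simp: K_def subgroup.m_inv_closed)
    fix b assume b: "b \<in> K"
    hence bc: "b \<in> carrier G" "b \<in> T0" using f by (auto simp: K_def)
    have "crd (\<phi> (a \<otimes> b) x) = crd x" if x: "x \<in> E" for x
      using a b x ac bc act_closed by (auto simp: K_def composition_rule)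
    thus "a \<otimes> b \<in> K" using ac bc f(1) by (auto simp: K_def subgroup.m_closed)
  qed
  moreover have "K \<subseteq> T0" by (auto simp: K_def)
  moreover have "conj_invariant G T0 K" unfolding conj_invariant_def
  proof (intro ballI)
    fix t a assume t: "t \<in> T0" and a: "a \<in> K"
    have c: "t \<in> carrier G" "a \<in> carrier G" "t \<in> Nm" "a \<in> T0" "inv t \<in> Nm"
      using t a f T0_Nm subgroup.m_inv_closed[OF Nm_subgroup] by (auto simp: K_def)
    have "crd (\<phi> (t \<otimes> a \<otimes> inv t) x) = crd x" if x: "x \<in> E" for x
    proof -
      have x': "\<phi> (inv t) x \<in> E" using x c act_closed by simp
      have "crd (\<phi> (t \<otimes> a \<otimes> inv t) x) = crd (\<phi> t (\<phi> a (\<phi> (inv t) x)))"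
        using c x x' by (simp add: composition_rule act_closed)
      also have "\<dots> = hperm t (crd (\<phi> a (\<phi> (inv t) x)))" using c x' act_closed by (simp add: hperm_crd)
      also have "\<dots> = hperm t (crd (\<phi> (inv t) x))" using a x' by (simp add: K_def)
      also have "\<dots> = crd x" using c x x' by (simp add: hperm_crd act_inv_right)
      finally show ?thesis .
    qed
    thus "t \<otimes> a \<otimes> inv t \<in> K" using t c f(1) by (auto simp: K_def intro: subgroup.m_closed subgroup.m_inv_closed)
  qed
  moreover have "K \<noteq> T0"
  proof
    assume K: "K = T0"
    have c: "crd x = crd w" if x: "x \<in> E" for x
    proof -
      obtain t where t: "t \<in> T0" "orb T0 x = orb T0 (\<phi> t w)" using factor_transitive_on_orbits[OF T0 base x] by blast
      have "crd x = crd (\<phi> t w)" using t by (simp add: crd_def)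
      also have "\<dots> = crd w" using t K base by (auto simp: K_def)
      finally show ?thesis .
    qed
    have "Delta = {crd w}"
    proof (rule subset_antisym)
      show "Delta \<subseteq> {crd w}"
      proof
        fix a assume "a \<in> Delta"
        then obtain x where x: "x \<in> E" "a = crd x" unfolding crd_image[symmetric] by (elim imageE)
        show "a \<in> {crd w}" unfolding x(2) c[OF x(1)] by simp
      qed
      show "{crd w} \<subseteq> Delta" using crd_in[OF base] by simp
    qed
    thus False using Delta_card by blast
  qed
  ultimately have K1: "K = {\<one>}" using factor_simple[OF T0] by blast
  show ?thesis
  proof (rule inj_onI)
    fix s t assume st: "s \<in> T0" "t \<in> T0" "hperm s = hperm t"
    have c: "s \<in> carrier G" "t \<in> carrier G" "s \<in> Nm" "t \<in> Nm" "inv s \<in> Nm"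
      using st f T0_Nm subgroup.m_inv_closed[OF Nm_subgroup] by auto
    have "crd (\<phi> (inv s \<otimes> t) x) = crd x" if x: "x \<in> E" for x
    proof -
      have "crd (\<phi> (inv s \<otimes> t) x) = hperm (inv s) (crd (\<phi> t x))"
        using c x act_closed by (simp add: composition_rule hperm_crd)
      also have "\<dots> = hperm (inv s) (crd (\<phi> s x))" using c x st(3) hperm_crd[of s x] hperm_crd[of t x] by simp
      also have "\<dots> = crd x" using c x act_closed by (simp add: hperm_crd act_inv_left)
      finally show ?thesis .
    qed
    hence "inv s \<otimes> t \<in> K" using st f(1) by (auto simp: K_def subgroup.m_closed subgroup.m_inv_closed)
    hence "s \<otimes> (inv s \<otimes> t) = s" using K1 c by simp
    thus "s = t" using c by (simp add: word_simps)
  qed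
qed

end

lemma (in group) iso_image_subgroup:
  assumes "group_hom G K h" "subgroup T G" "inj_on h T"
  shows "h \<in> iso (G\<lparr>carrier := T\<rparr>) (K\<lparr>carrier := h ` T\<rparr>)"
  using assms subgroup.subset[OF assms(2)]
  by (auto simp: iso_def hom_def bij_betw_def group_hom_def group_hom_axioms_def subset_iff)

context product_type_indexed
begin

lemma Delta_finite: "finite Delta" "Delta \<noteq> {}"
  using crd_in[OF base] by (auto simp: Delta_def)

lemma hperm_hom: "group_hom (G\<lparr>carrier := Nm\<rparr>) (BijGroup Delta) hperm"
  using hperm_action by (simp add: group_action_def)

lemma H_subgroup: "subgroup H (BijGroup Delta)"
  using group_hom.img_is_subgroup[OF hperm_hom] by (simp add: H_def)

lemma H_perm: "finite_permutation_group Delta H"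
  using H_subgroup Delta_finite by (simp add: finite_permutation_group_def)

lemma hperm_mult: "\<lbrakk>m \<in> Nm; n \<in> Nm\<rbrakk> \<Longrightarrow> hperm (m \<otimes> n) = hperm m \<otimes>\<^bsub>BijGroup Delta\<^esub> hperm n"
  using group_hom.hom_mult[OF hperm_hom] by simp

lemma hperm_inv:
  assumes n: "n \<in> Nm" shows "inv\<^bsub>perm_grp Delta H\<^esub> hperm n = hperm (inv n)"
proof -
  have "hperm n \<in> H" using n by (simp add: H_def)
  hence "inv\<^bsub>perm_grp Delta H\<^esub> hperm n = inv\<^bsub>BijGroup Delta\<^esub> hperm n"
    by (rule group.m_inv_consistent[OF group_BijGroup H_subgroup])
  also have "\<dots> = hperm (inv\<^bsub>G\<lparr>carrier := Nm\<rparr>\<^esub> n)" using group_hom.hom_inv[OF hperm_hom] n by simp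
  also have "inv\<^bsub>G\<lparr>carrier := Nm\<rparr>\<^esub> n = inv n" using n by (rule m_inv_consistent[OF Nm_subgroup])
  finally show ?thesis .
qed

lemma T0_conj: "\<lbrakk>n \<in> Nm; t \<in> T0\<rbrakk> \<Longrightarrow> n \<otimes> t \<otimes> inv n \<in> T0"
  using NmD(2)[of n] by (auto simp: conj_image_def)

text \<open>For the centralizer: if \<open>hperm n\<close> commutes with the image of
  \<open>T0\<close>, then \<open>n t n^-1\<close> and \<open>t\<close> have the same image, so they
  agree by injectivity on \<open>T0\<close>. Thus \<open>n\<close> centralizes \<open>T0\<close>,
  fixes every orbit, and \<open>hperm n\<close> is the identity.\<close>

lemma H_simple_normal:
  "hperm ` T0 \<lhd> perm_grp Delta H"
  "nonabelian_simple (perm_grp Delta (hperm ` T0))"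
  "perm_grp Delta (hperm ` T0) \<cong> G\<lparr>carrier := T0\<rparr>"
  "centralizer (perm_grp Delta H) (hperm ` T0) = {\<one>\<^bsub>perm_grp Delta H\<^esub>}"
proof -
  interpret P: perm_group Delta H using H_perm by unfold_locales
  note f = factorD[OF T0]
  interpret hom: group_hom "G\<lparr>carrier := Nm\<rparr>" "BijGroup Delta" hperm by (rule hperm_hom)
  have TN: "subgroup T0 (G\<lparr>carrier := Nm\<rparr>)"
    using f(1) Nm_subgroup T0_Nm by (rule subgroup_incl)
  have sB: "subgroup (hperm ` T0) (BijGroup Delta)" using TN by (rule hom.subgroup_img_is_subgroup)
  have TH: "hperm ` T0 \<subseteq> H" using T0_Nm by (auto simp: H_def)
  have s: "subgroup (hperm ` T0) (perm_grp Delta H)"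
    using sB H_subgroup TH by (rule group.subgroup_incl[OF group_BijGroup])
  show n: "hperm ` T0 \<lhd> perm_grp Delta H"
  proof (rule P.normal_invI[OF s])
    fix x y assume "x \<in> carrier (perm_grp Delta H)" "y \<in> hperm ` T0"
    then obtain m t where m: "m \<in> Nm" "x = hperm m" and t: "t \<in> T0" "y = hperm t" by (auto simp: H_def)
    have tm: "t \<in> Nm" "inv m \<in> Nm" "m \<otimes> t \<in> Nm"
      using t m T0_Nm subgroup.m_closed[OF Nm_subgroup] subgroup.m_inv_closed[OF Nm_subgroup] by auto
    have "x \<otimes>\<^bsub>perm_grp Delta H\<^esub> y \<otimes>\<^bsub>perm_grp Delta H\<^esub> inv\<^bsub>perm_grp Delta H\<^esub> x = hperm (m \<otimes> t \<otimes> inv m)"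
      using m t tm by (simp add: hperm_inv hperm_mult)
    thus "x \<otimes>\<^bsub>perm_grp Delta H\<^esub> y \<otimes>\<^bsub>perm_grp Delta H\<^esub> inv\<^bsub>perm_grp Delta H\<^esub> x \<in> hperm ` T0"
      using T0_conj[OF m(1) t(1)] by simp
  qed
  have iso: "hperm \<in> iso (G\<lparr>carrier := T0\<rparr>) (perm_grp Delta (hperm ` T0))"
    using group.iso_image_subgroup[OF hom.G.is_group hperm_hom TN hperm_T0_inj] by simp
  have gT: "group (perm_grp Delta (hperm ` T0))"
    using sB by (rule group.subgroup_imp_group[OF group_BijGroup])
  show "nonabelian_simple (perm_grp Delta (hperm ` T0))"
    using factor_nonabelian_simple[OF T0] iso gT by (rule nonabelian_simple_iso)
  show "perm_grp Delta (hperm ` T0) \<cong> G\<lparr>carrier := T0\<rparr>"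
    using group.iso_set_sym[OF subgroup_imp_group[OF f(1)] iso] by (auto simp: is_iso_def)
  show "centralizer (perm_grp Delta H) (hperm ` T0) = {\<one>\<^bsub>perm_grp Delta H\<^esub>}"
  proof (intro subset_antisym subsetI)
    fix x assume "x \<in> centralizer (perm_grp Delta H) (hperm ` T0)"
    then obtain n where n: "n \<in> Nm" "x = hperm n"
      and c: "\<And>t. t \<in> T0 \<Longrightarrow> hperm n \<otimes>\<^bsub>BijGroup Delta\<^esub> hperm t = hperm t \<otimes>\<^bsub>BijGroup Delta\<^esub> hperm n"
      by (auto simp: centralizer_def H_def)
    have nc: "n \<in> carrier G" using n NmD by blast
    have "n \<otimes> t = t \<otimes> n" if t: "t \<in> T0" for t
    proof -
      have tc: "t \<in> carrier G" "t \<in> Nm" "inv n \<in> Nm"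
        using t f(5) T0_Nm n subgroup.m_inv_closed[OF Nm_subgroup] by auto
      have "hperm (n \<otimes> t) = hperm (t \<otimes> n)" using c[OF t] n tc by (simp add: hperm_mult)
      hence "hperm ((n \<otimes> t) \<otimes> inv n) = hperm ((t \<otimes> n) \<otimes> inv n)"
        using n(1) tc subgroup.m_closed[OF Nm_subgroup] by (simp only: hperm_mult)
      hence "hperm (n \<otimes> t \<otimes> inv n) = hperm t" using nc tc by (simp add: m_assoc)
      hence "n \<otimes> t \<otimes> inv n = t" using hperm_T0_inj T0_conj[OF n(1) t] t by (auto dest: inj_onD)
      thus ?thesis using conj_eq_self_iff[OF nc tc(1)] by simp
    qed
    hence "n \<in> centralizer G T0" using nc by (simp add: centralizer_def)
    hence "hperm n = (\<lambda>a\<in>Delta. a)"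
      using hperm_eq_one_iff[OF n(1)] orb_shift[OF T0_subset] by (simp add: crd_def)
    thus "x \<in> {\<one>\<^bsub>perm_grp Delta H\<^esub>}" using n by (simp add: BijGroup_def)
  next
    fix x assume "x \<in> {\<one>\<^bsub>perm_grp Delta H\<^esub>}"
    moreover have "subgroup (centralizer (perm_grp Delta H) (hperm ` T0)) (perm_grp Delta H)"
      using TH by (intro P.centralizer_subgroup) simp
    ultimately show "x \<in> centralizer (perm_grp Delta H) (hperm ` T0)"
      using subgroup.one_closed by fastforce
  qed
qed

lemma H_almost_simple: "almost_simple (perm_grp Delta H)"
  using H_simple_normal group.subgroup_imp_group[OF group_BijGroup H_subgroup]
  by (intro almost_simpleI) auto

lemma H_socle: "perm_grp Delta (socle (perm_grp Delta H)) \<cong> G\<lparr>carrier := T0\<rparr>"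
proof -
  interpret P: perm_group Delta H using H_perm by unfold_locales
  have "socle (perm_grp Delta H) = hperm ` T0"
    using H_simple_normal by (intro P.socle_of_simple P.finite_carrier) auto
  thus ?thesis using H_simple_normal(3) by simp
qed

section \<open>Projections to the factors and the direct power structure of \<open>N\<close>\<close>

definition proj :: "'a set \<Rightarrow> 'a \<Rightarrow> 'a" where
  "proj T n = (THE t. t \<in> T \<and> inv t \<otimes> n \<in> centralizer G T)"

lemma proj_eqI:
  assumes T: "factor T" and t: "t \<in> T" "inv t \<otimes> n \<in> centralizer G T" and n: "n \<in> carrier G"
  shows "proj T n = t"
  unfolding proj_def
proof (rule the_equality)
  show "t \<in> T \<and> inv t \<otimes> n \<in> centralizer G T" using t by simp
  note f = factorD[OF T] and cs = centralizer_subgroup[OF factorD(5)[OF T]]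
  fix s assume s: "s \<in> T \<and> inv s \<otimes> n \<in> centralizer G T"
  have c: "s \<in> carrier G" "t \<in> carrier G" using s t f by auto
  have "inv t \<otimes> n \<otimes> inv (inv s \<otimes> n) \<in> centralizer G T"
    using subgroup.m_closed[OF cs t(2) subgroup.m_inv_closed[OF cs]] s by simp
  moreover have "inv t \<otimes> n \<otimes> inv (inv s \<otimes> n) = inv t \<otimes> s" using c n by (simp add: word_simps)
  moreover have "inv t \<otimes> s \<in> T" using s t f(1) by (simp add: subgroup.m_closed subgroup.m_inv_closed)
  ultimately have "inv t \<otimes> s = \<one>" using factor_center[OF T] by simp
  hence "t \<otimes> (inv t \<otimes> s) = t" using c by simp
  thus "s = t" using c by (simp add: word_simps)
qed

lemma projE:
  assumes T: "factor T" and n: "n \<in> N"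
  shows "proj T n \<in> T \<and> inv (proj T n) \<otimes> n \<in> centralizer G T"
proof -
  note f = factorD[OF T]
  obtain t c where tc: "t \<in> T" "c \<in> centralizer G T" "n = t \<otimes> c" using factor_decomposition[OF T n] by blast
  have cc: "t \<in> carrier G" "c \<in> carrier G" using tc f centralizer_carrier by auto
  have i: "inv t \<otimes> n \<in> centralizer G T" using tc cc by (simp add: word_simps)
  have "proj T n = t" using proj_eqI[OF T tc(1) i N_carrier[OF n]] .
  thus ?thesis using tc(1) i by simp
qed

lemma proj_mult:
  assumes T: "factor T" and mn: "m \<in> N" "n \<in> N"
  shows "proj T (m \<otimes> n) = proj T m \<otimes> proj T n"
proof (rule proj_eqI[OF T])
  note f = factorD[OF T] and cs = centralizer_subgroup[OF factorD(5)[OF T]]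
  note pm = projE[OF T mn(1)] and pn = projE[OF T mn(2)]
  show "proj T m \<otimes> proj T n \<in> T" using pm pn f(1) by (simp add: subgroup.m_closed)
  define a where "a = inv (proj T m) \<otimes> m"
  have c: "m \<in> carrier G" "n \<in> carrier G" "proj T m \<in> carrier G" "proj T n \<in> carrier G"
    "inv (proj T n) \<in> T" "inv (proj T n) \<in> carrier G" "a \<in> carrier G"
    using mn N_carrier pm pn f by (auto simp: a_def subgroup.m_inv_closed)
  have "inv (proj T m \<otimes> proj T n) \<otimes> (m \<otimes> n) = inv (proj T n) \<otimes> a \<otimes> n"
    using c by (simp add: a_def word_simps)
  also have "inv (proj T n) \<otimes> a = a \<otimes> inv (proj T n)"
    using pm c(5) centralizerD[of a T] by (simp add: a_def)
  also have "a \<otimes> inv (proj T n) \<otimes> n = a \<otimes> (inv (proj T n) \<otimes> n)" using c by (simp add: m_assoc)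
  finally show "inv (proj T m \<otimes> proj T n) \<otimes> (m \<otimes> n) \<in> centralizer G T"
    using pm pn subgroup.m_closed[OF cs] by (simp add: a_def)
  show "m \<otimes> n \<in> carrier G" using c by simp
qed

lemma gc_inv_conj: "\<lbrakk>i < k; t \<in> Tf i\<rbrakk> \<Longrightarrow> inv (gc i) \<otimes> t \<otimes> gc i \<in> T0"
  using conj_image_inv[OF T0_subset gc(1)] gc by (force simp: conj_image_def)

text \<open>The component in \<open>Tf i\<close> is brought back to \<open>T0\<close> by the
  conjugator \<open>gc i\<close>. Two elements with equal components differ by one that commutes
  with all factors, which gives injectivity; surjectivity is
  \<open>factors_independent\<close>.\<close>

lemma N_iso_power: "G\<lparr>carrier := N\<rparr> \<cong> product_group {..<k} (\<lambda>_. G\<lparr>carrier := T0\<rparr>)"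
proof -
  let ?h = "\<lambda>n. \<lambda>i\<in>{..<k}. inv (gc i) \<otimes> proj (Tf i) n \<otimes> gc i"
  let ?P = "product_group {..<k} (\<lambda>_. G\<lparr>carrier := T0\<rparr>)"
  have closed: "?h n \<in> carrier ?P" if "n \<in> N" for n
    using that projE[OF Tf_factor that] gc_inv_conj by auto
  have pc: "proj (Tf i) n \<in> carrier G" if "i < k" "n \<in> N" for i n
    using projE[OF Tf_factor[OF that(1)] that(2)] factorD(5)[OF Tf_factor[OF that(1)]] by blast
  have hom: "?h (m \<otimes> n) = ?h m \<otimes>\<^bsub>?P\<^esub> ?h n" if "m \<in> N" "n \<in> N" for m n
    using that pc gc(1) by (auto simp: proj_mult[OF Tf_factor] restrict_def fun_eq_iff word_simps)
  have inj: "inj_on ?h N"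
  proof (rule inj_onI)
    fix m n assume mn: "m \<in> N" "n \<in> N" "?h m = ?h n"
    have c: "m \<in> carrier G" "n \<in> carrier G" using mn N_carrier by auto
    have "inv m \<otimes> n = \<one>"
    proof (rule commute_all_factors)
      show "inv m \<otimes> n \<in> carrier G" using c by simp
      fix T t assume T: "factor T" and t: "t \<in> T"
      note cs = centralizer_subgroup[OF factorD(5)[OF T]]
      obtain i where i: "i < k" "T = Tf i" using factor_Tf[OF T] by blast
      have "inv (gc i) \<otimes> proj T m \<otimes> gc i = inv (gc i) \<otimes> proj T n \<otimes> gc i"
        using fun_cong[OF mn(3), of i] i by simp
      hence e: "proj T m = proj T n" using pc[OF i(1)] mn gc(1)[OF i(1)] i by (simp add: m_assoc)
      define p where "p = proj T n"
      have pcc: "p \<in> carrier G" using pc[OF i(1) mn(2)] i by (simp add: p_def)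
      have "inv (inv p \<otimes> m) \<otimes> (inv p \<otimes> n) \<in> centralizer G T"
        using projE[OF T mn(1)] projE[OF T mn(2)] e
        by (auto simp: p_def intro: subgroup.m_closed[OF cs] subgroup.m_inv_closed[OF cs])
      moreover have "inv (inv p \<otimes> m) \<otimes> (inv p \<otimes> n) = inv m \<otimes> n" using pcc c by (simp add: word_simps)
      ultimately show "inv m \<otimes> n \<otimes> t = t \<otimes> (inv m \<otimes> n)" using t centralizerD by simp
    qed
    hence "m \<otimes> (inv m \<otimes> n) = m" using c by simp
    thus "m = n" using c by (simp add: word_simps)
  qed
  have surj: "\<exists>n\<in>N. ?h n = z" if z: "z \<in> carrier ?P" for z
  proof -
    define t where "t T = (let i = inv_into {..<k} Tf T in gc i \<otimes> z i \<otimes> inv (gc i))" for T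
    have tTf: "t (Tf i) = gc i \<otimes> z i \<otimes> inv (gc i)" "t (Tf i) \<in> Tf i" "z i \<in> T0" if i: "i < k" for i
    proof -
      show 1: "t (Tf i) = gc i \<otimes> z i \<otimes> inv (gc i)"
        using Tf i by (simp add: t_def Let_def bij_betw_def)
      show 2: "z i \<in> T0" using z i by auto
      show "t (Tf i) \<in> Tf i" unfolding 1 using gc(2)[OF i] 2 by (auto simp: conj_image_def)
    qed
    have tT: "t T \<in> T" if "factor T" for T using factor_Tf[OF that] tTf(2) by blast
    obtain n where n: "n \<in> N"
      "\<And>T. factor T \<Longrightarrow> (if T \<in> {T. factor T} then inv (t T) \<otimes> n else n) \<in> centralizer G T"
      using factors_independent[OF factors_finite, of t] tT by auto
    have "proj (Tf i) n = t (Tf i)" if i: "i < k" for i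
      using n(2)[OF Tf_factor[OF i]] Tf_factor[OF i] tTf(2)[OF i] N_carrier[OF n(1)] by (intro proj_eqI) auto
    hence "inv (gc i) \<otimes> proj (Tf i) n \<otimes> gc i = z i" if i: "i < k" for i
      using i tTf[OF i] gc(1)[OF i] T0_subset by (simp add: word_simps subset_iff)
    hence "?h n = z" using z by (auto simp: restrict_def PiE_def extensional_def fun_eq_iff)
    thus ?thesis using n(1) by blast
  qed
  have "?h \<in> iso (G\<lparr>carrier := N\<rparr>) ?P"
  proof (rule isoI)
    show "?h \<in> hom (G\<lparr>carrier := N\<rparr>) ?P" using closed hom by (intro homI) auto
    show "bij_betw ?h (carrier (G\<lparr>carrier := N\<rparr>)) (carrier ?P)"
      unfolding bij_betw_def
    proof
      show "inj_on ?h (carrier (G\<lparr>carrier := N\<rparr>))" using inj by simp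
      show "?h ` carrier (G\<lparr>carrier := N\<rparr>) = carrier ?P"
      proof (intro subset_antisym subsetI)
        fix z assume "z \<in> ?h ` carrier (G\<lparr>carrier := N\<rparr>)"
        then obtain n where n: "n \<in> N" "z = ?h n" by (elim imageE) simp
        show "z \<in> carrier ?P" unfolding n(2) by (rule closed[OF n(1)])
      next
        fix z assume "z \<in> carrier ?P"
        then obtain n where "n \<in> N" "?h n = z" using surj by blast
        thus "z \<in> ?h ` carrier (G\<lparr>carrier := N\<rparr>)" by (intro image_eqI[of _ _ n]) simp_all
      qed
    qed
  qed
  thus ?thesis by (rule is_isoI)
qed

end

section \<open>The embedding into the wreath product in product action\<close>

context product_type_indexed
begin

text \<open>Conjugation by \<open>x\<close> permutes the factors, and this is the induced
  permutation of indices; indices from \<open>k\<close> on are fixed because \<open>permutes\<close>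
  asks for it.\<close>

definition sg :: "'a \<Rightarrow> nat \<Rightarrow> nat" where
  "sg x = (\<lambda>i. if i < k then inv_into {..<k} Tf (conj_image G x (Tf i)) else i)"

lemma sg_less: 
  assumes "x \<in> carrier G" "i < k"
  shows "sg x i < k" "Tf (sg x i) = conj_image G x (Tf i)"
proof -
  have "conj_image G x (Tf i) \<in> Tf ` {..<k}"
    using factor_conj[OF Tf_factor[OF assms(2)] assms(1)] bij_betw_imp_surj_on[OF Tf] by simp
  thus "sg x i < k" "Tf (sg x i) = conj_image G x (Tf i)"
    using inv_into_into[of "conj_image G x (Tf i)" Tf "{..<k}"] assms(2)
    by (auto simp: sg_def f_inv_into_f)
qed

lemma sg_permutes:
  assumes x: "x \<in> carrier G" shows "sg x permutes {..<k}"
proof -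
  have "inj_on (sg x) {..<k}"
  proof (rule inj_onI)
    fix i j assume ij: "i \<in> {..<k}" "j \<in> {..<k}" "sg x i = sg x j"
    hence "conj_image G x (Tf i) = conj_image G x (Tf j)" using sg_less(2)[OF x] by (metis lessThan_iff)
    hence "conj_image G (inv x) (conj_image G x (Tf i)) = conj_image G (inv x) (conj_image G x (Tf j))"
      by simp
    hence "Tf i = Tf j" using ij x factorD(5)[OF Tf_factor] by (simp add: conj_image_inv)
    thus "i = j" using Tf ij by (auto simp: bij_betw_def dest: inj_onD)
  qed
  moreover have "sg x ` {..<k} \<subseteq> {..<k}" using sg_less(1)[OF x] by auto
  ultimately have "bij_betw (sg x) {..<k} {..<k}" by (simp add: bij_betw_def endo_inj_surj)
  thus ?thesis by (rule bij_imp_permutes) (simp add: sg_def)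
qed

text \<open>The usual cocycle of an induced action: if \<open>sg x\<close> sends \<open>i\<close> to
  \<open>j\<close>, then \<open>x \<otimes> gc i = gc j \<otimes> hx x j\<close>. Both sides
  conjugate \<open>T0\<close> to \<open>Tf j\<close>, so \<open>hx x j\<close> normalizes
  \<open>T0\<close>.\<close>

definition hx :: "'a \<Rightarrow> nat \<Rightarrow> 'a" where
  "hx x j = inv (gc j) \<otimes> x \<otimes> gc (inv_into UNIV (sg x) j)"

definition kap :: "'a \<Rightarrow> (nat \<Rightarrow> nat) \<Rightarrow> (nat \<Rightarrow> nat)" where
  "kap x = (\<lambda>\<delta>\<in>cartesian_power Delta k. \<lambda>j\<in>{..<k}. hperm (hx x j) (\<delta> (inv_into UNIV (sg x) j)))"

lemma sg_inv:
  assumes x: "x \<in> carrier G" and j: "j < k"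
  shows "inv_into UNIV (sg x) j < k" "sg x (inv_into UNIV (sg x) j) = j"
  using sg_permutes[OF x] j permutes_inverses(1)[OF sg_permutes[OF x]]
    permutes_in_image[OF permutes_inv[OF sg_permutes[OF x]], of j] by auto

lemma hx_Nm:
  assumes x: "x \<in> carrier G" and j: "j < k" shows "hx x j \<in> Nm"
proof -
  let ?i = "inv_into UNIV (sg x) j"
  note i = sg_inv[OF x j]
  have g: "gc ?i \<in> carrier G" "gc j \<in> carrier G" using gc i j by auto
  have "conj_image G (inv (gc j) \<otimes> x \<otimes> gc ?i) T0
      = conj_image G (inv (gc j)) (conj_image G x (conj_image G (gc ?i) T0))"
    using T0_subset g x by (simp add: conj_image_mult conj_image_subset)
  also have "conj_image G (gc ?i) T0 = Tf ?i" using gc(2) i by simp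
  also have "conj_image G x (Tf ?i) = Tf j" using sg_less(2)[OF x i(1)] i(2) by simp
  also have "conj_image G (inv (gc j)) (Tf j) = T0"
    using gc(2)[OF j] conj_image_inv[OF T0_subset g(2)] by simp
  finally show ?thesis using g x by (simp add: Nm_def hx_def)
qed

lemma kap_coord:
  assumes x: "x \<in> carrier G" and y: "y \<in> E" shows "kap x (coord y) = coord (\<phi> x y)"
proof -
  have "hperm (hx x j) (coord y (inv_into UNIV (sg x) j)) = crd (\<phi> (inv (gc j)) (\<phi> x y))" if j: "j < k" for j
  proof -
    let ?i = "inv_into UNIV (sg x) j"
    note i = sg_inv[OF x j]
    have g: "gc ?i \<in> carrier G" "gc j \<in> carrier G" using gc i j by auto
    have "hperm (hx x j) (coord y ?i) = crd (\<phi> (hx x j) (\<phi> (inv (gc ?i)) y))"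
      using hx_Nm[OF x j] i g y act_closed by (simp add: coord_def hperm_crd)
    also have "\<phi> (hx x j) (\<phi> (inv (gc ?i)) y) = \<phi> (inv (gc j)) (\<phi> x y)"
      using g x y by (simp add: hx_def composition_rule act_closed act_inv_right)
    finally show ?thesis .
  qed
  moreover have "coord y \<in> cartesian_power Delta k" using y coord_image by blast
  ultimately show ?thesis by (auto simp: kap_def coord_def restrict_def fun_eq_iff)
qed

lemma kap_action: "group_action G (cartesian_power Delta k) kap"
proof (rule group_action_equivariant_image[OF group_action_axioms coord_image])
  show "kap g \<in> extensional (cartesian_power Delta k)" for g by (simp add: kap_def)
qed (rule kap_coord)

lemma kap_wreath: "kap ` carrier G \<subseteq> wreath_product_action Delta H k"
proof
  fix z assume "z \<in> kap ` carrier G"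
  then obtain x where x: "x \<in> carrier G" "z = kap x" by blast
  show "z \<in> wreath_product_action Delta H k"
    unfolding wreath_product_action_def x(2) kap_def
  proof (intro CollectI exI[of _ "\<lambda>j. hperm (hx x j)"] exI[of _ "sg x"] conjI refl)
    show "(\<lambda>j. hperm (hx x j)) \<in> {..<k} \<rightarrow> H" using hx_Nm[OF x(1)] by (auto simp: H_def)
    show "sg x permutes {..<k}" using x(1) by (rule sg_permutes)
  qed
qed

text \<open>The elements fixing all coordinates form a normal subgroup. If it were nontrivial, it
  would be transitive on \<open>E\<close>, so the coordinates would be constant and
  \<open>Delta\<close> a single point.\<close>

lemma coord_kernel:
  assumes g: "g \<in> carrier G" and "\<And>x. x \<in> E \<Longrightarrow> coord (\<phi> g x) = coord x"
  shows "g = \<one>"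
proof (rule ccontr)
  assume ne: "g \<noteq> \<one>"
  define K where "K = {n \<in> carrier G. \<forall>x\<in>E. coord (\<phi> n x) = coord x}"
  have K1: "K \<lhd> G" unfolding normal_inv_iff
  proof (intro conjI ballI)
    show "subgroup K G"
    proof (rule subgroupI)
      show "K \<subseteq> carrier G" by (auto simp: K_def)
      show "K \<noteq> {}" using act_one by (auto simp: K_def intro!: exI[of _ \<one>])
      fix a assume a: "a \<in> K"
      hence ac: "a \<in> carrier G" by (simp add: K_def)
      have "coord (\<phi> (inv a) x) = coord x" if x: "x \<in> E" for x
      proof -
        have "coord (\<phi> a (\<phi> (inv a) x)) = coord (\<phi> (inv a) x)" using a x ac act_closed by (simp add: K_def)
        thus ?thesis using x ac by (simp add: act_inv_right)
      qed
      thus "inv a \<in> K" using ac by (simp add: K_def)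
      fix b assume b: "b \<in> K"
      thus "a \<otimes> b \<in> K" using a act_closed by (simp add: K_def composition_rule)
    qed
    fix x a assume x: "x \<in> carrier G" and a: "a \<in> K"
    have ac: "a \<in> carrier G" using a by (simp add: K_def)
    have "coord (\<phi> (x \<otimes> a \<otimes> inv x) y) = coord y" if y: "y \<in> E" for y
    proof -
      have y': "\<phi> (inv x) y \<in> E" using x y act_closed by simp
      have "coord (\<phi> (x \<otimes> a \<otimes> inv x) y) = kap x (coord (\<phi> a (\<phi> (inv x) y)))"
        using x y ac y' by (simp add: composition_rule kap_coord act_closed)
      also have "coord (\<phi> a (\<phi> (inv x) y)) = coord (\<phi> (inv x) y)" using a y' by (simp add: K_def)
      also have "kap x (coord (\<phi> (inv x) y)) = coord y" using x y y' by (simp add: kap_coord act_inv_right)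
      finally show ?thesis .
    qed
    thus "x \<otimes> a \<otimes> inv x \<in> K" using x ac by (simp add: K_def)
  qed
  have K2: "K \<noteq> {\<one>}" using assms ne by (auto simp: K_def)
  have c: "coord x = coord w" if x: "x \<in> E" for x
  proof -
    obtain n where n: "n \<in> K" "\<phi> n w = x" using quasi_transitive[OF K1 K2 base x] by blast
    thus ?thesis using base by (auto simp: K_def)
  qed
  have "crd x = crd w" if x: "x \<in> E" for x
    using c[OF x] coord_eq_iff[OF x base] crd_eq_iff[OF x base] T0 by simp
  hence "crd ` E \<subseteq> {crd w}" by (intro image_subsetI) simp
  hence "Delta \<subseteq> {crd w}" by (simp only: crd_image)
  hence "Delta = {crd w}" using crd_in[OF base] by (intro subset_antisym) simp_all
  thus False using Delta_card by blast
qed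

lemma coord_faithful:
  assumes gh: "g \<in> carrier G" "h \<in> carrier G" and e: "\<And>x. x \<in> E \<Longrightarrow> coord (\<phi> g x) = coord (\<phi> h x)"
  shows "g = h"
proof -
  have "inv h \<otimes> g = \<one>"
  proof (rule coord_kernel)
    show "inv h \<otimes> g \<in> carrier G" using gh by simp
    fix x assume x: "x \<in> E"
    have "coord (\<phi> (inv h \<otimes> g) x) = kap (inv h) (coord (\<phi> g x))"
      using gh x by (simp add: composition_rule kap_coord act_closed)
    also have "\<dots> = kap (inv h) (coord (\<phi> h x))" using e[OF x] by simp
    also have "\<dots> = coord x" using gh x by (simp add: kap_coord act_closed act_inv_left)
    finally show "coord (\<phi> (inv h \<otimes> g) x) = coord x" .
  qed
  hence "h \<otimes> (inv h \<otimes> g) = h" using gh by simp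
  thus ?thesis using gh by (simp add: word_simps)
qed

section \<open>The invariant partition into fibres of the coordinate map\<close>

definition cls :: "'b \<Rightarrow> 'b set" where "cls x = {y \<in> E. coord y = coord x}"
definition Pt :: "'b set set" where "Pt = cls ` E"

lemma cls_self: "x \<in> E \<Longrightarrow> x \<in> cls x" by (simp add: cls_def)

lemma cls_image:
  assumes g: "g \<in> carrier G" and x: "x \<in> E" shows "\<phi> g ` cls x = cls (\<phi> g x)"
proof (intro subset_antisym subsetI)
  fix z assume "z \<in> \<phi> g ` cls x"
  then obtain y where y: "y \<in> E" "coord y = coord x" "z = \<phi> g y" by (auto simp: cls_def)
  have "coord (\<phi> g y) = kap g (coord y)" by (rule kap_coord[OF g y(1), symmetric])
  also have "\<dots> = coord (\<phi> g x)" unfolding y(2) by (rule kap_coord[OF g x])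
  finally show "z \<in> cls (\<phi> g x)" using y g act_closed by (simp add: cls_def)
next
  fix z assume "z \<in> cls (\<phi> g x)"
  hence z: "z \<in> E" "coord z = coord (\<phi> g x)" by (auto simp: cls_def)
  have "coord (\<phi> (inv g) z) = kap (inv g) (coord z)"
    by (rule kap_coord[OF inv_closed[OF g] z(1), symmetric])
  also have "\<dots> = coord x" unfolding z(2) using g x by (simp add: kap_coord act_closed act_inv_left)
  finally have "\<phi> (inv g) z \<in> cls x" using g z act_closed by (simp add: cls_def)
  thus "z \<in> \<phi> g ` cls x" using g z by (force simp: act_inv_right)
qed

lemma Pt_partition: "partition_on E Pt"
  by (rule partition_onI) (auto simp: Pt_def cls_def disjnt_def)

lemma Pt_invariant: "\<lbrakk>g \<in> carrier G; B \<in> Pt\<rbrakk> \<Longrightarrow> \<phi> g ` B \<in> Pt"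
  using act_closed by (auto simp: Pt_def cls_image)

lemma pa_action: "group_action G Pt (\<lambda>g. partition_action Pt (\<phi> g))"
  by (rule group_action_equivariant_image[OF group_action_axioms, of cls])
    (auto simp: Pt_def partition_action_def cls_image)

lemma pa_inj: "inj_on (\<lambda>g. partition_action Pt (\<phi> g)) (carrier G)"
proof (rule inj_onI)
  fix g h assume gh: "g \<in> carrier G" "h \<in> carrier G" "partition_action Pt (\<phi> g) = partition_action Pt (\<phi> h)"
  show "g = h"
  proof (rule coord_faithful[OF gh(1,2)])
    fix x assume x: "x \<in> E"
    have "\<phi> g ` cls x = \<phi> h ` cls x"
      using fun_cong[OF gh(3), of "cls x"] x by (simp add: partition_action_def Pt_def)
    hence "cls (\<phi> g x) = cls (\<phi> h x)" using gh(1,2) x by (simp add: cls_image)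
    hence "\<phi> g x \<in> cls (\<phi> h x)" using cls_self[OF act_closed[OF gh(1) x]] by simp
    thus "coord (\<phi> g x) = coord (\<phi> h x)" by (simp add: cls_def)
  qed
qed

lemma kap_inj: "inj_on kap (carrier G)"
proof (rule inj_onI)
  fix g h assume gh: "g \<in> carrier G" "h \<in> carrier G" "kap g = kap h"
  show "g = h"
  proof (rule coord_faithful[OF gh(1,2)])
    fix x assume "x \<in> E"
    thus "coord (\<phi> g x) = coord (\<phi> h x)" using gh kap_coord[of g x] kap_coord[of h x] by simp
  qed
qed

lemma perm_equivalent_product:
  "perm_equivalent Pt ((\<lambda>g. partition_action Pt (\<phi> g)) ` carrier G) (cartesian_power Delta k) (kap ` carrier G)"
proof -
  let ?a = "\<lambda>g. partition_action Pt (\<phi> g)"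
  \<comment> \<open>Any element of the class may be chosen, since \<open>coord\<close> is constant
    on it.\<close>
  define F where "F B = coord (SOME x. x \<in> B)" for B
  have F: "F (cls x) = coord x" if x: "x \<in> E" for x
  proof -
    have "(SOME y. y \<in> cls x) \<in> cls x" using cls_self[OF x] by (rule someI)
    thus ?thesis by (simp add: F_def cls_def)
  qed
  have "inj_on F Pt"
  proof (rule inj_onI)
    fix A B assume "A \<in> Pt" "B \<in> Pt" "F A = F B"
    then obtain x y where "x \<in> E" "y \<in> E" "A = cls x" "B = cls y" "coord x = coord y"
      using F by (auto simp: Pt_def)
    thus "A = B" by (simp add: cls_def)
  qed
  moreover have "F ` Pt = cartesian_power Delta k"
    unfolding coord_image[symmetric] Pt_def image_image using F by (intro image_cong) auto
  ultimately have bij: "bij_betw F Pt (cartesian_power Delta k)" by (simp add: bij_betw_def)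
  have "?a \<in> hom G (BijGroup Pt)" "kap \<in> hom G (BijGroup (cartesian_power Delta k))"
    using pa_action kap_action by (auto simp: group_action_def group_hom_def group_hom_axioms_def)
  note isos = iso_image_of_inj_hom[OF this(1) pa_inj] iso_image_of_inj_hom[OF this(2) kap_inj]
  \<comment> \<open>Both image groups are faithful copies of \<open>G\<close>; \<open>p\<close>
    passes from one to the other through \<open>G\<close>.\<close>
  define p where "p = kap \<circ> inv_into (carrier G) ?a"
  have p: "p \<in> iso (perm_grp Pt (?a ` carrier G)) (perm_grp (cartesian_power Delta k) (kap ` carrier G))"
    unfolding p_def by (rule iso_set_trans[OF iso_set_sym[OF isos(1)] isos(2)])
  have pa: "p (?a g) = kap g" if g: "g \<in> carrier G" for g
    using g inv_into_f_f[OF pa_inj g] by (simp add: p_def)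
  have "F (?a g B) = p (?a g) (F B)" if g: "g \<in> carrier G" and B: "B \<in> Pt" for g B
  proof -
    obtain x where x: "x \<in> E" "B = cls x" using B by (auto simp: Pt_def)
    have "?a g B = cls (\<phi> g x)" using B x g by (simp add: partition_action_def cls_image)
    thus ?thesis using x g F act_closed by (simp add: pa kap_coord)
  qed
  thus ?thesis unfolding perm_equivalent_def using bij p by blast
qed

end

lemma (in product_type_action) ex_indexed:
  "\<exists>k Tf gc d. product_type_indexed G E \<phi> w N T0 k Tf gc d \<and> k = card {T. factor T}"
proof -
  let ?k = "card {T. factor T}"
  obtain Tf where Tf: "bij_betw Tf {..<?k} {T. factor T}"
    using ex_bij_betw_nat_finite[OF factors_finite] by (auto simp: lessThan_atLeast0)
  have "\<exists>g. g \<in> carrier G \<and> Tf i = conj_image G g T0" if "i < ?k" for i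
    using factors_conjugate[OF T0, of "Tf i"] Tf that by (auto simp: bij_betw_def)
  then obtain gc where gc: "\<And>i. i < ?k \<Longrightarrow> gc i \<in> carrier G" "\<And>i. i < ?k \<Longrightarrow> Tf i = conj_image G (gc i) T0"
    by metis
  have "finite (orb T0 ` E)" using finite_points by simp
  then obtain d where "bij_betw d (orb T0 ` E) {..<card (orb T0 ` E)}"
    using ex_bij_betw_finite_nat by (auto simp: lessThan_atLeast0)
  thus ?thesis using Tf gc
    by (intro exI[of _ ?k] exI[of _ Tf] exI[of _ gc] exI[of _ d] conjI product_type_indexed.intro
        product_type_indexed_axioms.intro product_type_action_axioms refl)
qed

section \<open>The alternatives for quasiprimitive permutation groups\<close>

theorem (in perm_group) quasiprimitive_cases:
  assumes q: "quasiprimitive \<Omega> G"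
  shows "(intersection_density \<Omega> G = 1 \<and> EKR_property \<Omega> G) \<or>
    almost_simple (perm_grp \<Omega> G) \<or> product_action_type \<Omega> G"
proof (cases "G = {\<one>\<^bsub>BijGroup \<Omega>\<^esub>}")
  case True
  \<comment> \<open>The trivial group need not be transitive here, but each of its stabilizers is
    the whole group.\<close>
  have "card F \<le> card (point_stabilizer \<Omega> G w)" if "w \<in> \<Omega>" "intersecting_set \<Omega> G F" for F w
  proof (rule card_mono)
    show "F \<subseteq> point_stabilizer \<Omega> G w"
      using that True subgroup.one_closed[OF stabilizer_subgroup[OF that(1)]]
      by (auto simp: intersecting_set_def)
    show "finite (point_stabilizer \<Omega> G w)" using finite_G by (simp add: stabilizer_def)
  qed
  thus ?thesis using EKR_of_bound by blast
next
  case False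
  interpret Q: quasiprimitive_action "perm_grp \<Omega> G" \<Omega> "\<lambda>g. g"
  proof unfold_locales
    show "carrier (perm_grp \<Omega> G) \<noteq> {\<one>\<^bsub>perm_grp \<Omega> G\<^esub>}" using False by simp
    show "\<exists>n\<in>N. n x = y"
      if "N \<lhd> perm_grp \<Omega> G" "N \<noteq> {\<one>\<^bsub>perm_grp \<Omega> G\<^esub>}" "x \<in> \<Omega>" "y \<in> \<Omega>" for N x y
      using that q perm_transitive_iff[OF normal_imp_subgroup[OF that(1)]] by (auto simp: quasiprimitive_def)
  qed
  show ?thesis
  proof (cases rule: Q.onan_scott_cases)
    case (regular R w)
    have "card F \<le> card (point_stabilizer \<Omega> G v)" if v: "v \<in> \<Omega>" and F: "intersecting_set \<Omega> G F" for F v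
    proof -
      have "card F \<le> card (point_stabilizer \<Omega> G w)"
      proof (rule intersecting_bound[OF regular(2,1,3,4)])
        show "\<exists>g\<in>carrier (perm_grp \<Omega> G). x = g w" if "x \<in> \<Omega>" for x
          using Q.transitive[OF regular(1) that] by auto
        show "F \<subseteq> carrier (perm_grp \<Omega> G)" using F by (simp add: intersecting_set_def)
        show "\<exists>a\<in>\<Omega>. (x \<otimes>\<^bsub>perm_grp \<Omega> G\<^esub> inv\<^bsub>perm_grp \<Omega> G\<^esub> y) a = a" if "x \<in> F" "y \<in> F" for x y
          using F that elements_intersect_iff[of y x] by (auto simp: intersecting_set_def)
      qed
      moreover obtain g where "g \<in> G" "g w = v" using Q.transitive[OF regular(1) v] by auto
      ultimately show ?thesis using card_stabilizer_eq[of g w] regular(1) by simp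
    qed
    thus ?thesis using EKR_of_bound by blast
  next
    case (simple T)
    thus ?thesis using almost_simpleI[OF is_group simple(1)] by simp
  next
    case (product w N T0)
    interpret P: product_type_action "perm_grp \<Omega> G" \<Omega> "\<lambda>g. g" w N T0 by fact
    obtain k Tf gc d where ix: "product_type_indexed (perm_grp \<Omega> G) \<Omega> (\<lambda>g. g) w N T0 k Tf gc d"
      and k: "k = card {T. P.factor T}" using P.ex_indexed by blast
    interpret X: product_type_indexed "perm_grp \<Omega> G" \<Omega> "\<lambda>g. g" w N T0 k Tf gc d by (rule ix)
    obtain T1 where T1: "P.factor T1" "T1 \<noteq> T0" using product(2) by blast
    have "card {T0, T1} \<le> k"
      unfolding k using T1 P.T0 P.factors_finite by (intro card_mono) auto
    hence k2: "k \<ge> 2" using T1 by simp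
    have nreg: "\<not> perm_regular \<Omega> N"
    proof
      assume "perm_regular \<Omega> N"
      hence "point_stabilizer \<Omega> N w = {\<one>\<^bsub>BijGroup \<Omega>\<^esub>}" using P.base by (simp add: perm_regular_def)
      moreover have "point_stabilizer \<Omega> N w = N \<inter> point_stabilizer \<Omega> G w"
        using P.N_subset by (auto simp: stabilizer_def)
      ultimately show False using P.nonregular by simp
    qed
    have inv: "invariant_partition \<Omega> G X.Pt"
      using X.Pt_partition X.Pt_invariant by (simp add: invariant_partition_def)
    have K: "subgroup (X.kap ` G) (BijGroup (cartesian_power X.Delta k))"
      using group_hom.img_is_subgroup[OF group_action.group_hom[OF X.kap_action]] by simp
    have "product_action_type \<Omega> G"
      unfolding product_action_type_def
    proof (intro conjI exI[of _ N] exI[of _ "perm_grp \<Omega> T0"] exI[of _ k] exI[of _ X.Pt] exI[of _ X.Delta]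
        exI[of _ X.H] exI[of _ "X.kap ` G"])
      show "{M. minimal_normal (perm_grp \<Omega> G) M} = {N}" by (rule P.unique_minimal_normal)
      show "nonabelian_simple (perm_grp \<Omega> T0)" using P.factor_nonabelian_simple[OF P.T0] by simp
      show "perm_grp \<Omega> N \<cong> product_group {..<k} (\<lambda>_. perm_grp \<Omega> T0)" using X.N_iso_power by simp
      show "inj_on (partition_action X.Pt) G" using X.pa_inj by simp
      show "finite_permutation_group X.Delta X.H" by (rule X.H_perm)
      show "almost_simple (perm_grp X.Delta X.H)" by (rule X.H_almost_simple)
      show "perm_grp X.Delta (socle (perm_grp X.Delta X.H)) \<cong> perm_grp \<Omega> T0" using X.H_socle by simp
      show "X.kap ` G \<subseteq> wreath_product_action X.Delta X.H k" using X.kap_wreath by simp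
      show "perm_equivalent X.Pt (partition_action X.Pt ` G) (cartesian_power X.Delta k) (X.kap ` G)"
        using X.perm_equivalent_product by simp
    qed (use q k2 nreg inv K in auto)
    thus ?thesis by blast
  qed
qed

section \<open>Coset actions\<close>

text \<open>The coset action is obtained below as an equivariant image of this one.\<close>

lemma (in group) regular_action: "group_action G (carrier G) (\<lambda>g. \<lambda>x\<in>carrier G. g \<otimes> x)"
proof -
  have bij: "(\<lambda>x\<in>carrier G. g \<otimes> x) \<in> Bij (carrier G)" if g: "g \<in> carrier G" for g
  proof -
    have "bij_betw (\<lambda>x\<in>carrier G. g \<otimes> x) (carrier G) (carrier G)"
      using g by (intro bij_betw_byWitness[of _ "\<lambda>x. inv g \<otimes> x"]) (auto simp: word_simps)
    thus ?thesis by (simp add: Bij_def)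
  qed
  have "(\<lambda>x\<in>carrier G. g \<otimes> h \<otimes> x) =
      (\<lambda>x\<in>carrier G. g \<otimes> x) \<otimes>\<^bsub>BijGroup (carrier G)\<^esub> (\<lambda>x\<in>carrier G. h \<otimes> x)"
    if "g \<in> carrier G" "h \<in> carrier G" for g h
    using that bij[of g] bij[of h]
    by (auto simp: BijGroup_def compose_def restrict_def fun_eq_iff m_assoc)
  moreover have "carrier (BijGroup (carrier G)) = Bij (carrier G)" by (simp add: BijGroup_def)
  ultimately show ?thesis using bij
    by (auto simp: group_action_def group_hom_def group_hom_axioms_def hom_def group_BijGroup is_group)
qed

text \<open>\<open>G\<close> acts on the cosets of \<open>H\<close>, which are numbered so that the
  points are naturals. The block of the coset \<open>H\<close> corresponds to an overgroup of
  \<open>H\<close>, so maximality gives primitivity; the kernel lies in \<open>H\<close>, so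
  core-freeness gives faithfulness. An element fixes some coset exactly if it is conjugate into
  \<open>H\<close>, so the hypothesis on \<open>Y\<close> says that \<open>Y\<close> acts as an
  intersecting set.\<close>

lemma (in group) coset_permutation_group:
  assumes fin: "finite (carrier G)" and H: "subgroup H G" "H \<noteq> carrier G"
    and maximal: "\<And>M. \<lbrakk>subgroup M G; H \<subseteq> M\<rbrakk> \<Longrightarrow> M = H \<or> M = carrier G"
    and core_free: "\<And>N. \<lbrakk>N \<lhd> G; N \<subseteq> H\<rbrakk> \<Longrightarrow> N = {\<one>}"
    and Y: "Y \<subseteq> carrier G" "\<And>x y. \<lbrakk>x \<in> Y; y \<in> Y\<rbrakk> \<Longrightarrow> \<exists>g\<in>carrier G. inv g \<otimes> (x \<otimes> inv y) \<otimes> g \<in> H"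
  shows "\<exists>(\<Gamma> :: nat set) A. finite_permutation_group \<Gamma> A \<and> primitive \<Gamma> A \<and> G \<cong> perm_grp \<Gamma> A \<and>
    intersection_density \<Gamma> A \<ge> card Y / card H"
proof -
  have Hc: "h \<in> carrier G" if "h \<in> H" for h using H(1) that by (rule subgroup.mem_carrier)
  let ?cosets = "(\<lambda>x. x <# H) ` carrier G"
  obtain d where d: "bij_betw d ?cosets {..<card ?cosets}"
    using ex_bij_betw_finite_nat[of ?cosets] fin by (auto simp: lessThan_atLeast0)
  define f where "f x = d (x <# H)" for x
  define \<Gamma> where "\<Gamma> = f ` carrier G"
  have f_eq: "f x = f y \<longleftrightarrow> inv x \<otimes> y \<in> H" if xy: "x \<in> carrier G" "y \<in> carrier G" for x y
  proof -
    have "f x = f y \<longleftrightarrow> x <# H = y <# H" using d xy by (auto simp: f_def bij_betw_def dest: inj_onD)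
    also have "\<dots> \<longleftrightarrow> inv x \<otimes> y \<in> H"
    proof
      assume "x <# H = y <# H"
      moreover have "y \<in> y <# H" using xy subgroup.one_closed[OF H(1)] by (force simp: l_coset_def)
      ultimately obtain h where "h \<in> H" "y = x \<otimes> h" by (auto simp: l_coset_def)
      thus "inv x \<otimes> y \<in> H" using xy Hc by (simp add: word_simps)
    next
      assume h: "inv x \<otimes> y \<in> H"
      have "y \<otimes> k \<in> x <# H" if "k \<in> H" for k
      proof -
        have "y \<otimes> k = x \<otimes> (inv x \<otimes> y \<otimes> k)" using xy Hc[OF that] by (simp add: word_simps)
        moreover have "inv x \<otimes> y \<otimes> k \<in> H" using subgroup.m_closed[OF H(1) h that] .
        ultimately show ?thesis unfolding l_coset_def by blast
      qed
      moreover have "x \<otimes> k \<in> y <# H" if "k \<in> H" for k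
      proof -
        have "x \<otimes> k = y \<otimes> (inv (inv x \<otimes> y) \<otimes> k)" using xy Hc[OF that] by (simp add: word_simps)
        moreover have "inv (inv x \<otimes> y) \<otimes> k \<in> H"
          using subgroup.m_closed[OF H(1) subgroup.m_inv_closed[OF H(1) h] that] .
        ultimately show ?thesis unfolding l_coset_def by blast
      qed
      ultimately show "x <# H = y <# H" unfolding l_coset_def by blast
    qed
    finally show ?thesis .
  qed
  define act where "act g = (\<lambda>a\<in>\<Gamma>. f (g \<otimes> inv_into (carrier G) f a))" for g
  have act_f: "act g (f x) = f (g \<otimes> x)" if gx: "g \<in> carrier G" "x \<in> carrier G" for g x
  proof -
    define y where "y = inv_into (carrier G) f (f x)"
    have y: "y \<in> carrier G" "f y = f x" using gx by (auto simp: y_def inv_into_into f_inv_into_f)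
    have "f (g \<otimes> y) = f (g \<otimes> x)" using y gx f_eq[of y x] f_eq[of "g \<otimes> y" "g \<otimes> x"] by (simp add: word_simps)
    thus ?thesis using gx by (simp add: act_def y_def \<Gamma>_def)
  qed
  interpret act: group_action G \<Gamma> act
  proof (rule group_action_equivariant_image[OF regular_action])
    show "f ` carrier G = \<Gamma>" by (simp add: \<Gamma>_def)
    show "act g \<in> extensional \<Gamma>" for g by (simp add: act_def)
    show "act g (f x) = f ((\<lambda>x\<in>carrier G. g \<otimes> x) x)" if "g \<in> carrier G" "x \<in> carrier G" for g x
      using that by (simp add: act_f)
  qed
  interpret hom: group_hom G "BijGroup \<Gamma>" act by (rule act.group_hom)
  note hom.hom_mult [simp del] hom.hom_inv [simp del]
  define A where "A = act ` carrier G"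
  have A: "subgroup A (BijGroup \<Gamma>)" unfolding A_def by (rule hom.img_is_subgroup)
  have "finite \<Gamma>" "\<Gamma> \<noteq> {}" using fin by (auto simp: \<Gamma>_def)
  hence perm: "finite_permutation_group \<Gamma> A" using A by (simp add: finite_permutation_group_def)
  then interpret A: perm_group \<Gamma> A by unfold_locales
  have one: "f \<one> \<in> \<Gamma>" by (simp add: \<Gamma>_def)
  have inj: "inj_on act (carrier G)"
  proof -
    have "kernel G (BijGroup \<Gamma>) act \<subseteq> H"
    proof
      fix g assume "g \<in> kernel G (BijGroup \<Gamma>) act"
      hence g: "g \<in> carrier G" "act g = (\<lambda>a\<in>\<Gamma>. a)" by (auto simp: kernel_def BijGroup_def)
      have "f g = f \<one>" using act_f[OF g(1) one_closed] g one by simp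
      hence "inv \<one> \<otimes> g \<in> H" using f_eq[of \<one> g] g by simp
      thus "g \<in> H" using g by simp
    qed
    hence "kernel G (BijGroup \<Gamma>) act = {\<one>}" using hom.normal_kernel core_free by blast
    thus ?thesis using hom.inj_iff_trivial_ker by simp
  qed
  have iso: "G \<cong> perm_grp \<Gamma> A"
    unfolding A_def using iso_image_of_inj_hom[OF hom.homh inj] by (auto simp: is_iso_def)
  have tr: "perm_transitive \<Gamma> A"
    unfolding A.G_transitive_iff
  proof (intro ballI)
    fix a b assume "a \<in> \<Gamma>" "b \<in> \<Gamma>"
    then obtain x y where xy: "x \<in> carrier G" "y \<in> carrier G" "a = f x" "b = f y" by (auto simp: \<Gamma>_def)
    have "act (y \<otimes> inv x) (f x) = f (y \<otimes> inv x \<otimes> x)" by (rule act_f) (use xy in simp_all)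
    hence "act (y \<otimes> inv x) a = b" using xy(1,2) unfolding xy(3,4) by (simp only: m_assoc l_inv r_one inv_closed)
    moreover have "act (y \<otimes> inv x) \<in> A" unfolding A_def by (rule imageI) (use xy in simp)
    ultimately show "\<exists>g\<in>A. g a = b" by (rule bexI)
  qed
  have stab: "point_stabilizer \<Gamma> A (f \<one>) = act ` H"
  proof -
    have "act g (f \<one>) = f \<one> \<longleftrightarrow> g \<in> H" if "g \<in> carrier G" for g
      using that f_eq[of \<one> g] act_f[OF that one_closed] by auto
    thus ?thesis using Hc by (auto simp: stabilizer_def A_def)
  qed
  have "primitive \<Gamma> A"
    unfolding primitive_def
  proof (intro conjI allI impI tr)
    fix P assume "invariant_partition \<Gamma> A P"
    hence P: "partition_on \<Gamma> P" "\<And>g B. \<lbrakk>g \<in> carrier G; B \<in> P\<rbrakk> \<Longrightarrow> act g ` B \<in> P"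
      by (auto simp: invariant_partition_def A_def)
    have P_eq: "B = C" if "B \<in> P" "C \<in> P" "a \<in> B" "a \<in> C" for B C a
      using partition_onD2[OF P(1)] that by (auto simp: disjoint_def)
    have cover: "\<exists>B\<in>P. a \<in> B" if "a \<in> \<Gamma>" for a using partition_onD1[OF P(1)] that by auto
    have sub: "B \<subseteq> \<Gamma>" if "B \<in> P" for B using partition_onD1[OF P(1)] that by auto
    obtain B where B: "B \<in> P" "f \<one> \<in> B" using cover[OF one] by blast
    \<comment> \<open>The setwise stabilizer of the block \<open>B\<close> of the base point: as a
      block meeting its translate equals it, preserving \<open>B\<close> and sending the base point
      into \<open>B\<close> are the same.\<close>
    define M where "M = {g \<in> carrier G. f g \<in> B}"
    have M_act: "act g ` B = B" if "g \<in> M" for g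
    proof (rule P_eq[OF P(2) B(1)])
      show g: "g \<in> carrier G" using that by (simp add: M_def)
      show "B \<in> P" by (rule B(1))
      show "f g \<in> act g ` B" using B(2) act_f[OF g one_closed] g by (metis imageI r_one)
      show "f g \<in> B" using that by (simp add: M_def)
    qed
    have Ms: "subgroup M G"
    proof (rule subgroupI)
      show "M \<subseteq> carrier G" by (auto simp: M_def)
      show "M \<noteq> {}" using B(2) by (auto simp: M_def)
      fix a assume a: "a \<in> M"
      hence ac: "a \<in> carrier G" by (simp add: M_def)
      have "act (inv a) ` B = B"
      proof (rule P_eq[OF P(2) B(1)])
        show "inv a \<in> carrier G" "B \<in> P" using ac B by auto
        have "act (inv a) (f a) = f \<one>" using ac by (simp add: act_f)
        thus "f \<one> \<in> act (inv a) ` B" using a unfolding M_def by (metis (mono_tags, lifting) imageI mem_Collect_eq)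
        show "f \<one> \<in> B" by (rule B(2))
      qed
      hence "act (inv a) (f \<one>) \<in> B" using B(2) by blast
      thus "inv a \<in> M" using ac by (simp add: M_def act_f)
      fix b assume b: "b \<in> M"
      hence "act a (f b) \<in> B" using M_act[OF a] by (auto simp: M_def)
      thus "a \<otimes> b \<in> M" using ac b by (simp add: M_def act_f)
    qed
    have "H \<subseteq> M"
    proof
      fix h assume h: "h \<in> H"
      hence "f \<one> = f h" using f_eq[of \<one> h] Hc by simp
      thus "h \<in> M" using B(2) Hc[OF h] by (simp add: M_def)
    qed
    with Ms consider "M = H" | "M = carrier G" using maximal by blast
    thus "P = {\<Gamma>} \<or> P = (\<lambda>\<omega>. {\<omega>}) ` \<Gamma>"
    proof cases
      case 1
      have B1: "B = {f \<one>}"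
      proof (intro subset_antisym subsetI)
        fix a assume a: "a \<in> B"
        then obtain g where g: "g \<in> carrier G" "a = f g" using sub[OF B(1)] by (auto simp: \<Gamma>_def)
        hence "g \<in> H" using a 1 by (auto simp: M_def)
        thus "a \<in> {f \<one>}" using g f_eq[of \<one> g] by simp
      qed (use B in auto)
      have sing: "C = {f g}" if C: "C \<in> P" "f g \<in> C" and g: "g \<in> carrier G" for C g
      proof (rule P_eq[OF C(1) _ C(2)])
        have "act g ` B = {f g}" using g by (simp add: B1 act_f)
        thus "{f g} \<in> P" using P(2)[OF g B(1)] by simp
      qed simp
      have "P = (\<lambda>\<omega>. {\<omega>}) ` \<Gamma>"
      proof (intro subset_antisym subsetI)
        fix C assume C: "C \<in> P"
        then obtain a where "a \<in> C" using partition_onD3[OF P(1)] by fastforce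
        then obtain g where "g \<in> carrier G" "f g \<in> C" using sub[OF C] by (auto simp: \<Gamma>_def)
        thus "C \<in> (\<lambda>\<omega>. {\<omega>}) ` \<Gamma>" using sing[OF C] by (auto simp: \<Gamma>_def)
      next
        fix C assume "C \<in> (\<lambda>\<omega>. {\<omega>}) ` \<Gamma>"
        then obtain g where g: "g \<in> carrier G" "C = {f g}" by (auto simp: \<Gamma>_def)
        then obtain D where "D \<in> P" "f g \<in> D" using cover[of "f g"] by (auto simp: \<Gamma>_def)
        thus "C \<in> P" using sing g by auto
      qed
      thus ?thesis ..
    next
      case 2
      have BG: "B = \<Gamma>" using 2 sub[OF B(1)] by (auto simp: M_def \<Gamma>_def)
      have all: "C = \<Gamma>" if C: "C \<in> P" for C
      proof -
        obtain a where "a \<in> C" using C partition_onD3[OF P(1)] by fastforce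
        thus ?thesis using P_eq[OF C B(1)] sub[OF C] BG by auto
      qed
      have "P = {\<Gamma>}"
      proof (intro subset_antisym subsetI)
        fix C assume "C \<in> P"
        thus "C \<in> {\<Gamma>}" using all by blast
      next
        fix C assume "C \<in> {\<Gamma>}"
        thus "C \<in> P" using B(1) BG by simp
      qed
      thus ?thesis ..
    qed
  qed
  moreover have "intersection_density \<Gamma> A \<ge> card Y / card H"
  proof -
    have "intersecting_set \<Gamma> A (act ` Y)"
      unfolding intersecting_set_def
    proof (intro conjI ballI)
      show "act ` Y \<subseteq> A" using Y(1) by (auto simp: A_def)
      fix a b assume "a \<in> act ` Y" "b \<in> act ` Y"
      then obtain x y where xy: "x \<in> Y" "y \<in> Y" "a = act x" "b = act y" by auto
      have c: "x \<in> carrier G" "y \<in> carrier G" using xy Y(1) by auto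
      \<comment> \<open>The coset of this \<open>g\<close> is the point fixed by
        \<open>x \<otimes> inv y\<close>.\<close>
      obtain g where g: "g \<in> carrier G" "inv g \<otimes> (x \<otimes> inv y) \<otimes> g \<in> H" using Y(2)[OF xy(1,2)] by blast
      have "a \<otimes>\<^bsub>BijGroup \<Gamma>\<^esub> inv\<^bsub>BijGroup \<Gamma>\<^esub> b = act (x \<otimes> inv y)"
        using xy c by (simp add: hom.hom_mult hom.hom_inv)
      moreover have "act (x \<otimes> inv y) (f g) = f g"
      proof -
        have "act (x \<otimes> inv y) (f g) = f (x \<otimes> inv y \<otimes> g)" by (rule act_f) (use c g in simp_all)
        moreover have "f g = f (x \<otimes> inv y \<otimes> g)"
          using g c by (subst f_eq) (simp_all add: m_assoc)
        ultimately show ?thesis by (simp only:)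
      qed
      ultimately show "elements_intersect \<Gamma> a b"
        unfolding elements_intersect_def using g by (auto simp: \<Gamma>_def intro!: bexI[of _ "f g"])
    qed
    from A.intersection_density_ge[OF tr one this]
    have "card (act ` Y) / card (act ` H) \<le> intersection_density \<Gamma> A" by (simp add: stab)
    moreover have "card (act ` Y) = card Y" "card (act ` H) = card H"
      using inj Y(1) Hc by (auto intro!: card_image elim: inj_on_subset)
    ultimately show ?thesis by simp
  qed
  ultimately show ?thesis using perm iso by blast
qed

text \<open>The orbits of a normal subgroup form an invariant partition. If they are singletons, the
  subgroup acts trivially and so is trivial.\<close>

lemma primitive_imp_quasiprimitive:
  assumes "finite_permutation_group \<Omega> G" "primitive \<Omega> G"
  shows "quasiprimitive \<Omega> G"
  unfolding quasiprimitive_def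
proof (intro allI impI)
  interpret perm_group \<Omega> G using assms by unfold_locales
  fix N assume N: "N \<lhd> perm_grp \<Omega> G \<and> N \<noteq> {\<one>\<^bsub>BijGroup \<Omega>\<^esub>}"
  have Ns: "subgroup N (perm_grp \<Omega> G)" using N by (simp add: normal_imp_subgroup)
  interpret N: group_action "perm_grp \<Omega> G\<lparr>carrier := N\<rparr>" \<Omega> "\<lambda>g. g" using Ns by (rule group_action_subgroup)
  define ob where "ob = orbit (perm_grp \<Omega> G\<lparr>carrier := N\<rparr>) (\<lambda>g. g)"
  have ob: "ob x = {n x | n. n \<in> N}" for x by (simp add: ob_def orbit_def)
  define P where "P = orbits (perm_grp \<Omega> G\<lparr>carrier := N\<rparr>) \<Omega> (\<lambda>g. g)"
  have P: "P = ob ` \<Omega>" by (auto simp: P_def orbits_def ob_def)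
  have Nc: "n \<in> G" if "n \<in> N" for n using normal_carrier[of N n] N that by simp
  have "partition_on \<Omega> P"
  proof (rule partition_onI)
    show "\<Union> P = \<Omega>" using N.orbits_coverture by (simp add: P_def)
    show "{} \<notin> P" using N.orbit_refl by (auto simp: P ob_def)
    show "disjnt p q" if "p \<in> P" "q \<in> P" "p \<noteq> q" for p q
      using N.disjoint_union that by (auto simp: P_def disjnt_def)
  qed
  moreover have "g ` B \<in> P" if g: "g \<in> G" and B: "B \<in> P" for g B
  proof -
    obtain x where x: "x \<in> \<Omega>" "B = ob x" using B P by auto
    have "g ` ob x = ob (g x)"
    proof (intro subset_antisym subsetI)
      fix y assume "y \<in> g ` ob x"
      then obtain n where n: "n \<in> N" "y = g (n x)" by (auto simp: ob)
      define m where "m = g \<otimes>\<^bsub>perm_grp \<Omega> G\<^esub> n \<otimes>\<^bsub>perm_grp \<Omega> G\<^esub> inv\<^bsub>perm_grp \<Omega> G\<^esub> g"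
      have "m \<in> N" using N n g by (simp add: normal_inv_iff m_def)
      moreover have "m (g x) = y"
        using n g Nc x composition_rule[of x] composition_rule[of "g x"] act_inv_left[of g x] act_closed
          m_closed[of g n] inv_closed[of g]
        by (auto simp: m_def)
      ultimately show "y \<in> ob (g x)" by (auto simp: ob)
    next
      fix y assume "y \<in> ob (g x)"
      then obtain n where n: "n \<in> N" "y = n (g x)" by (auto simp: ob)
      define m where "m = inv\<^bsub>perm_grp \<Omega> G\<^esub> g \<otimes>\<^bsub>perm_grp \<Omega> G\<^esub> n \<otimes>\<^bsub>perm_grp \<Omega> G\<^esub> g"
      have "m \<in> N" using normal.inv_op_closed1[of N "perm_grp \<Omega> G" g n] N n g by (simp add: m_def)
      moreover have "g (m x) = y" 
        using n g Nc x composition_rule[of x] composition_rule[of "g x"] act_inv_right[of g "n (g x)"] act_closed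
          m_closed[of "inv\<^bsub>perm_grp \<Omega> G\<^esub> g" n] inv_closed[of g]
        by (auto simp: m_def)
      ultimately show "y \<in> g ` ob x" by (auto simp: ob)
    qed
    thus ?thesis using x act_closed g P by auto
  qed
  ultimately have "P = {\<Omega>} \<or> P = (\<lambda>\<omega>. {\<omega>}) ` \<Omega>"
    using assms by (auto simp: primitive_def invariant_partition_def)
  thus "perm_transitive \<Omega> N"
  proof
    assume "P = {\<Omega>}"
    hence "ob x = \<Omega>" if "x \<in> \<Omega>" for x using P that by auto
    thus ?thesis unfolding perm_transitive_iff[OF Ns] ob by blast
  next
    assume P1: "P = (\<lambda>\<omega>. {\<omega>}) ` \<Omega>"
    have "n = \<one>\<^bsub>perm_grp \<Omega> G\<^esub>" if n: "n \<in> N" for n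
    proof (rule faithfulI)
      fix x assume x: "x \<in> \<Omega>"
      obtain y where "ob x = {y}" using P P1 x by blast
      hence "ob x = {x}" using N.orbit_refl[OF x] by (auto simp: ob_def)
      hence "n x = x" using n by (auto simp: ob)
      thus "n x = \<one>\<^bsub>perm_grp \<Omega> G\<^esub> x" using act_one[OF x] by simp
    qed (use Nc n one_closed in auto)
    hence "N \<subseteq> {\<one>\<^bsub>perm_grp \<Omega> G\<^esub>}" by (intro subsetI singleton_iff[THEN iffD2])
    moreover have "{\<one>\<^bsub>perm_grp \<Omega> G\<^esub>} \<subseteq> N" using subgroup.one_closed[OF Ns] by simp
    ultimately have "N = {\<one>\<^bsub>perm_grp \<Omega> G\<^esub>}" by (rule subset_antisym)
    thus ?thesis using N by simp
  qed
qed

section \<open>Recovering the socle of an almost simple group\<close>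

lemma (in group) center_of_nonabelian_simple:
  assumes "nonabelian_simple G" shows "centralizer G (carrier G) = {\<one>}"
proof -
  interpret s: simple_group G using assms by (simp add: nonabelian_simple_def)
  have sub: "subgroup (centralizer G (carrier G)) G" by (rule centralizer_subgroup) simp
  have "x \<otimes> c \<otimes> inv x = c" if "x \<in> carrier G" "c \<in> centralizer G (carrier G)" for x c
    using that by (intro iffD2[OF conj_eq_self_iff]) (auto simp: centralizer_def)
  hence "centralizer G (carrier G) \<lhd> G" using sub by (simp add: normal_inv_iff)
  hence "centralizer G (carrier G) = carrier G \<or> ?thesis" by (rule s.no_real_normal_subgroup)
  thus ?thesis
  proof
    assume "centralizer G (carrier G) = carrier G"
    hence "comm_group G" by (intro group_comm_groupI) (auto simp: centralizer_def)
    thus ?thesis using assms by (simp add: nonabelian_simple_def)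
  qed
qed

lemma almost_simple_of_nonabelian_simple:
  fixes G :: "'a monoid" (structure)
  assumes "nonabelian_simple G" shows "almost_simple G"
proof -
  interpret group G using assms by (simp add: nonabelian_simple_def simple_group_def)
  show ?thesis
    by (rule almost_simpleI[OF is_group, of "carrier G"])
      (use assms center_of_nonabelian_simple in \<open>auto simp: normal_inv_iff subgroup_self\<close>)
qed

text \<open>Let \<open>j t\<close> be the element of \<open>G\<close> that induces conjugation by
  \<open>t\<close>. Then \<open>g (j t) g^-1 = j (\<phi> g t)\<close>, so the copy of
  \<open>T\<close> given by \<open>j\<close> is normal. An element commuting with this copy induces
  the identity on \<open>T\<close>, as \<open>j\<close> is injective, and is therefore
  trivial.\<close>

lemma almost_simple_socle:
  fixes G :: "'a monoid" (structure)
  assumes "almost_simple G"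
  shows "\<exists>T. T \<lhd> G \<and> nonabelian_simple (G\<lparr>carrier := T\<rparr>) \<and> centralizer G T = {\<one>}"
proof -
  obtain T :: "'a monoid" and \<phi> where gr: "group G" and T: "nonabelian_simple T"
    and hom: "\<phi> \<in> hom G (AutoGroup T)" and inj: "inj_on \<phi> (carrier G)"
    and inner: "inner_automorphisms T \<subseteq> \<phi> ` carrier G"
    using assms by (auto simp: almost_simple_def)
  interpret group G by (rule gr)
  interpret T: group T using T by (simp add: nonabelian_simple_def simple_group_def)
  interpret h: group_hom G "AutoGroup T" \<phi>
    using hom T.AutoGroup gr by (simp add: group_hom_def group_hom_axioms_def)
  note h.hom_mult [simp del] h.hom_inv [simp del]
  define inn where "inn t = (\<lambda>x\<in>carrier T. t \<otimes>\<^bsub>T\<^esub> x \<otimes>\<^bsub>T\<^esub> inv\<^bsub>T\<^esub> t)" for t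
  have "\<exists>g. g \<in> carrier G \<and> \<phi> g = inn t" if "t \<in> carrier T" for t
  proof -
    have "inn t \<in> inner_automorphisms T"
      unfolding inner_automorphisms_def inn_def using that by (intro CollectI exI[of _ t] conjI refl)
    with inner have "inn t \<in> \<phi> ` carrier G" by (rule subsetD)
    thus ?thesis by (elim imageE) (rule exI, rule conjI, assumption, erule sym)
  qed
  then obtain j where j: "\<And>t. t \<in> carrier T \<Longrightarrow> j t \<in> carrier G" "\<And>t. t \<in> carrier T \<Longrightarrow> \<phi> (j t) = inn t"
    by metis
  have auto: "\<phi> g \<in> hom T T" "\<phi> g \<in> Bij (carrier T)" if "g \<in> carrier G" for g
    using h.hom_closed[OF that] by (auto simp: AutoGroup_def auto_def)
  have ap: "\<phi> (g \<otimes> h) x = \<phi> g (\<phi> h x)" if "g \<in> carrier G" "h \<in> carrier G" "x \<in> carrier T" for g h x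
    using h.hom_mult[OF that(1,2)] auto(2) that by (simp add: AutoGroup_def BijGroup_def compose_def)
  have cl: "\<phi> g x \<in> carrier T" if "g \<in> carrier G" "x \<in> carrier T" for g x
    using auto(1)[OF that(1)] that(2) by (auto simp: hom_def)
  have mul: "\<phi> g (x \<otimes>\<^bsub>T\<^esub> y) = \<phi> g x \<otimes>\<^bsub>T\<^esub> \<phi> g y" if "g \<in> carrier G" "x \<in> carrier T" "y \<in> carrier T" for g x y
    using auto(1)[OF that(1)] that(2,3) by (auto simp: hom_def)
  have ginv: "\<phi> g (inv\<^bsub>T\<^esub> x) = inv\<^bsub>T\<^esub> (\<phi> g x)" if "g \<in> carrier G" "x \<in> carrier T" for g x
    using group_hom.hom_inv[of T T "\<phi> g" x] auto(1)[OF that(1)] that(2) T.is_group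
    by (simp add: group_hom_def group_hom_axioms_def)
  have eqI: "g = h" if "g \<in> carrier G" "h \<in> carrier G" "\<And>x. x \<in> carrier T \<Longrightarrow> \<phi> g x = \<phi> h x" for g h
  proof -
    have "\<phi> g = \<phi> h" using auto(2)[OF that(1)] auto(2)[OF that(2)] that(3)
      by (intro extensionalityI[of _ "carrier T"]) (auto dest: Bij_imp_extensional)
    thus ?thesis using inj that by (auto dest: inj_onD)
  qed
  have j_conj: "g \<otimes> j t \<otimes> inv g = j (\<phi> g t)" if g: "g \<in> carrier G" and t: "t \<in> carrier T" for g t
  proof (rule eqI)
    show "g \<otimes> j t \<otimes> inv g \<in> carrier G" "j (\<phi> g t) \<in> carrier G" using g t j cl by auto
    fix x assume x: "x \<in> carrier T"
    have x': "\<phi> (inv g) x \<in> carrier T" using cl g x by simp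
    have "\<phi> g (\<phi> (inv g) x) = \<phi> \<one> x" using ap[of g "inv g" x] g x by simp
    also have "\<dots> = x" using x by (simp add: AutoGroup_def BijGroup_def)
    finally have xx: "\<phi> g (\<phi> (inv g) x) = x" .
    have "\<phi> (g \<otimes> j t \<otimes> inv g) x = \<phi> g (inn t (\<phi> (inv g) x))"
      using g t x j x' cl by (simp only: ap m_closed inv_closed)
    also have "\<dots> = inn (\<phi> g t) x" using g t x x' cl by (simp add: inn_def mul ginv xx)
    finally show "\<phi> (g \<otimes> j t \<otimes> inv g) x = \<phi> (j (\<phi> g t)) x" using j cl g t by simp
  qed
  have j_mult: "j (s \<otimes>\<^bsub>T\<^esub> t) = j s \<otimes> j t" if st: "s \<in> carrier T" "t \<in> carrier T" for s t
  proof (rule eqI)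
    show "j (s \<otimes>\<^bsub>T\<^esub> t) \<in> carrier G" "j s \<otimes> j t \<in> carrier G" using st j by auto
    fix x assume x: "x \<in> carrier T"
    have "\<phi> (j s \<otimes> j t) x = inn s (inn t x)" using st j x by (simp only: ap)
    also have "\<dots> = inn (s \<otimes>\<^bsub>T\<^esub> t) x" using st x by (simp add: inn_def T.word_simps)
    finally show "\<phi> (j (s \<otimes>\<^bsub>T\<^esub> t)) x = \<phi> (j s \<otimes> j t) x" using st j by simp
  qed
  have inn_inj: "s = t" if st: "s \<in> carrier T" "t \<in> carrier T" "inn s = inn t" for s t
  proof -
    have "inv\<^bsub>T\<^esub> t \<otimes>\<^bsub>T\<^esub> s \<otimes>\<^bsub>T\<^esub> x = x \<otimes>\<^bsub>T\<^esub> (inv\<^bsub>T\<^esub> t \<otimes>\<^bsub>T\<^esub> s)" if x: "x \<in> carrier T" for x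
    proof -
      have "s \<otimes>\<^bsub>T\<^esub> x \<otimes>\<^bsub>T\<^esub> inv\<^bsub>T\<^esub> s = t \<otimes>\<^bsub>T\<^esub> x \<otimes>\<^bsub>T\<^esub> inv\<^bsub>T\<^esub> t"
        using fun_cong[OF st(3), of x] x by (simp add: inn_def)
      hence "inv\<^bsub>T\<^esub> t \<otimes>\<^bsub>T\<^esub> (s \<otimes>\<^bsub>T\<^esub> x \<otimes>\<^bsub>T\<^esub> inv\<^bsub>T\<^esub> s) \<otimes>\<^bsub>T\<^esub> s
          = inv\<^bsub>T\<^esub> t \<otimes>\<^bsub>T\<^esub> (t \<otimes>\<^bsub>T\<^esub> x \<otimes>\<^bsub>T\<^esub> inv\<^bsub>T\<^esub> t) \<otimes>\<^bsub>T\<^esub> s" by simp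
      thus ?thesis using st x by (simp add: T.word_simps)
    qed
    hence "inv\<^bsub>T\<^esub> t \<otimes>\<^bsub>T\<^esub> s \<in> centralizer T (carrier T)" using st by (simp add: centralizer_def)
    hence "inv\<^bsub>T\<^esub> t \<otimes>\<^bsub>T\<^esub> s = \<one>\<^bsub>T\<^esub>" using T.center_of_nonabelian_simple[OF T] by simp
    hence "t \<otimes>\<^bsub>T\<^esub> (inv\<^bsub>T\<^esub> t \<otimes>\<^bsub>T\<^esub> s) = t" using st by simp
    thus ?thesis using st by (simp add: T.word_simps)
  qed
  define S where "S = j ` carrier T"
  have jh: "group_hom T G j" using j j_mult T.is_group is_group
    by (auto simp: group_hom_def group_hom_axioms_def hom_def)
  have Ss: "subgroup S G" unfolding S_def by (rule group_hom.img_is_subgroup[OF jh])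
  have "S \<lhd> G" using Ss j_conj cl by (auto simp: normal_inv_iff S_def)
  moreover have "nonabelian_simple (G\<lparr>carrier := S\<rparr>)"
  proof (rule nonabelian_simple_iso[OF T])
    have "inj_on j (carrier T)" using j inn_inj by (metis inj_onI)
    thus "j \<in> iso T (G\<lparr>carrier := S\<rparr>)" unfolding S_def
      using group_hom.homh[OF jh] by (intro iso_image_of_inj_hom)
    show "group (G\<lparr>carrier := S\<rparr>)" using Ss by (rule subgroup_imp_group)
  qed
  moreover have "centralizer G S = {\<one>}"
  proof (intro subset_antisym subsetI)
    fix g assume g: "g \<in> centralizer G S"
    hence gc: "g \<in> carrier G" by (simp add: centralizer_def)
    have "g = \<one>"
    proof (rule eqI[OF gc one_closed])
      fix t assume t: "t \<in> carrier T"
      have "g \<otimes> j t = j t \<otimes> g" using g t by (auto simp: centralizer_def S_def)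
      hence "g \<otimes> j t \<otimes> inv g = j t" using gc j(1)[OF t] by (intro iffD2[OF conj_eq_self_iff])
      hence "j (\<phi> g t) = j t" using j_conj[OF gc t] by simp
      hence "inn (\<phi> g t) = inn t" using j(2) cl[OF gc t] t by metis
      hence "\<phi> g t = t" by (rule inn_inj[OF cl[OF gc t] t])
      thus "\<phi> g t = \<phi> \<one> t" using t by (simp add: AutoGroup_def BijGroup_def)
    qed
    thus "g \<in> {\<one>}" by simp
  qed (use Ss in \<open>auto simp: centralizer_def dest: subgroup.mem_carrier\<close>)
  ultimately show ?thesis by blast
qed

lemma almost_simple_iso_socle:
  assumes "group W" "W \<cong> P" "almost_simple (P :: 'a monoid)"
  shows "\<exists>T. T \<lhd> W \<and> nonabelian_simple (W\<lparr>carrier := T\<rparr>) \<and> centralizer W T = {\<one>\<^bsub>W\<^esub>}"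
proof -
  interpret W: group W by fact
  obtain T where T: "T \<lhd> P" "nonabelian_simple (P\<lparr>carrier := T\<rparr>)" "centralizer P T = {\<one>\<^bsub>P\<^esub>}"
    using almost_simple_socle[OF assms(3)] by blast
  interpret P: group P using T(1) by (simp add: normal_def)
  obtain f where f: "f \<in> iso P W" using W.iso_sym[OF assms(2)] by (auto simp: is_iso_def)
  have fh: "group_hom P W f" using f by (auto simp: iso_def group_hom_def group_hom_axioms_def)
  have inj: "inj_on f (carrier P)" and surj: "f ` carrier P = carrier W"
    using f by (auto simp: iso_def bij_betw_def)
  have Tc: "t \<in> carrier P" if "t \<in> T" for t using T(1) that by (rule P.normal_carrier)
  note Ts = normal_imp_subgroup[OF T(1)]
  have n: "f ` T \<lhd> W" using iso_normal_subgroup[OF f] T(1) by blast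
  have "nonabelian_simple (W\<lparr>carrier := f ` T\<rparr>)"
    using P.iso_image_subgroup[OF fh Ts inj_on_subset[OF inj subgroup.subset[OF Ts]]]
      W.subgroup_imp_group[OF normal_imp_subgroup[OF n]]
    by (rule nonabelian_simple_iso[OF T(2)])
  moreover have "centralizer W (f ` T) = {\<one>\<^bsub>W\<^esub>}"
  proof (intro subset_antisym subsetI)
    fix x assume x: "x \<in> centralizer W (f ` T)"
    then obtain p where p: "p \<in> carrier P" "x = f p" using surj by (auto simp: centralizer_def)
    have "p \<otimes>\<^bsub>P\<^esub> t = t \<otimes>\<^bsub>P\<^esub> p" if t: "t \<in> T" for t
    proof -
      have "f p \<otimes>\<^bsub>W\<^esub> f t = f t \<otimes>\<^bsub>W\<^esub> f p" using x t p by (auto simp: centralizer_def)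
      hence "f (p \<otimes>\<^bsub>P\<^esub> t) = f (t \<otimes>\<^bsub>P\<^esub> p)" using group_hom.hom_mult[OF fh] p Tc[OF t] by simp
      thus ?thesis using inj p Tc[OF t] by (auto dest: inj_onD)
    qed
    hence "p = \<one>\<^bsub>P\<^esub>" using T(3) p by (auto simp: centralizer_def)
    thus "x \<in> {\<one>\<^bsub>W\<^esub>}" using p group_hom.hom_one[OF fh] by simp
  next
    fix x assume "x \<in> {\<one>\<^bsub>W\<^esub>}"
    thus "x \<in> centralizer W (f ` T)"
      using W.normal_carrier[OF n] by (auto simp: centralizer_def)
  qed
  ultimately show ?thesis using n by blast
qed

section \<open>The wreath product with a group of order two\<close>

text \<open>\<open>(a, b, s)\<close> stands for the map on pairs that first swaps the coordinates if \<open>s\<close> holds and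
  then applies \<open>a\<close> and \<open>b\<close> to them.\<close>

definition wreath2 :: "('a, 'b) monoid_scheme \<Rightarrow> ('a \<times> 'a \<times> bool) monoid" where
  "wreath2 G = \<lparr>carrier = carrier G \<times> carrier G \<times> UNIV,
    monoid.mult = (\<lambda>(a, b, s) (c, d, t). if s then (a \<otimes>\<^bsub>G\<^esub> d, b \<otimes>\<^bsub>G\<^esub> c, s \<noteq> t) else (a \<otimes>\<^bsub>G\<^esub> c, b \<otimes>\<^bsub>G\<^esub> d, s \<noteq> t)),
    monoid.one = (\<one>\<^bsub>G\<^esub>, \<one>\<^bsub>G\<^esub>, False)\<rparr>"

lemma carrier_wreath2: "(a, b, s) \<in> carrier (wreath2 G) \<longleftrightarrow> a \<in> carrier G \<and> b \<in> carrier G"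
  by (simp add: wreath2_def)

lemma mult_wreath2:
  "(a, b, s) \<otimes>\<^bsub>wreath2 G\<^esub> (c, d, t) =
    (if s then (a \<otimes>\<^bsub>G\<^esub> d, b \<otimes>\<^bsub>G\<^esub> c, s \<noteq> t) else (a \<otimes>\<^bsub>G\<^esub> c, b \<otimes>\<^bsub>G\<^esub> d, s \<noteq> t))"
  by (simp add: wreath2_def)

lemma one_wreath2: "\<one>\<^bsub>wreath2 G\<^esub> = (\<one>\<^bsub>G\<^esub>, \<one>\<^bsub>G\<^esub>, False)"
  by (simp add: wreath2_def)

lemmas wreath2_simps = carrier_wreath2 mult_wreath2 one_wreath2

context group
begin

lemma group_wreath2: "group (wreath2 G)"
proof (rule groupI)
  fix x assume "x \<in> carrier (wreath2 G)"
  then obtain a b s where x: "x = (a, b, s)" "a \<in> carrier G" "b \<in> carrier G"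
    by (cases x) (auto simp: carrier_wreath2)
  show "\<exists>y\<in>carrier (wreath2 G). y \<otimes>\<^bsub>wreath2 G\<^esub> x = \<one>\<^bsub>wreath2 G\<^esub>"
    using x by (intro bexI[of _ "if s then (inv b, inv a, s) else (inv a, inv b, s)"]) (auto simp: wreath2_simps)
qed (auto simp: wreath2_simps split_paired_all m_assoc)

lemma inv_wreath2:
  assumes "a \<in> carrier G" "b \<in> carrier G"
  shows "inv\<^bsub>wreath2 G\<^esub> (a, b, s) = (if s then (inv b, inv a, s) else (inv a, inv b, s))"
  by (rule group.inv_equality[OF group_wreath2]) (use assms in \<open>auto simp: wreath2_simps\<close>)

text \<open>A simple normal \<open>T\<close> with trivial centralizer either lies in a subgroup
  normalized by it or meets it trivially. Applied to the base group and then to its first factor,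
  the second outcome makes \<open>T\<close> commute with that subgroup. So \<open>T\<close> would
  lie in the first factor, which the swap moves to the second.\<close>

lemma wreath2_not_almost_simple:
  assumes nontriv: "carrier G \<noteq> {\<one>}" and iso: "wreath2 G \<cong> P" and as: "almost_simple (P :: 'c monoid)"
  shows False
proof -
  let ?W = "wreath2 G"
  interpret W: group ?W by (rule group_wreath2)
  obtain T where T: "T \<lhd> ?W" "nonabelian_simple (?W\<lparr>carrier := T\<rparr>)" "centralizer ?W T = {\<one>\<^bsub>?W\<^esub>}"
    using almost_simple_iso_socle[OF group_wreath2 iso as] by blast
  interpret s: simple_group "?W\<lparr>carrier := T\<rparr>" using T(2) by (simp add: nonabelian_simple_def)
  have Ts: "subgroup T ?W" using T(1) by (rule normal_imp_subgroup)
  have Tc: "t \<in> carrier ?W" if "t \<in> T" for t using T(1) that by (rule W.normal_carrier)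
  have Tinv: "conj_invariant ?W (carrier ?W) T" using T(1) by (simp add: W.normal_iff_conj_invariant)
  have T1: "T \<noteq> {\<one>\<^bsub>?W\<^esub>}" using s.simple_not_triv by simp
  obtain g where g: "g \<in> carrier G" "g \<noteq> \<one>" using nontriv one_closed by blast
  define A where "A = {(a, b, False) | a b. a \<in> carrier G \<and> b \<in> carrier G}"
  define A1 where "A1 = {(a, \<one>, False) | a. a \<in> carrier G}"
  have A: "subgroup A ?W"
    by (rule W.subgroupI) (auto simp: A_def wreath2_simps inv_wreath2)
  have A1: "subgroup A1 ?W"
    by (rule W.subgroupI) (auto simp: A1_def wreath2_simps inv_wreath2)
  have A_inv: "conj_invariant ?W (carrier ?W) A"
    by (auto simp: conj_invariant_def A_def wreath2_simps inv_wreath2 split_paired_all)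
  have A1_inv: "conj_invariant ?W A A1"
    by (auto simp: conj_invariant_def A_def A1_def wreath2_simps inv_wreath2)
  \<comment> \<open>The element \<open>(g, \<one>, False)\<close> belongs both to the base group and
    to its first factor, so it serves against commuting with either.\<close>
  have not_central: "\<not> (\<forall>t\<in>T. (g, \<one>, False) \<otimes>\<^bsub>?W\<^esub> t = t \<otimes>\<^bsub>?W\<^esub> (g, \<one>, False))"
  proof
    assume "\<forall>t\<in>T. (g, \<one>, False) \<otimes>\<^bsub>?W\<^esub> t = t \<otimes>\<^bsub>?W\<^esub> (g, \<one>, False)"
    hence "(g, \<one>, False) \<in> centralizer ?W T" using g by (simp add: centralizer_def carrier_wreath2)
    thus False using T(3) g by (simp add: one_wreath2)
  qed
  have dich: "T \<inter> B = T \<or> T \<inter> B = {\<one>\<^bsub>?W\<^esub>}" if B: "subgroup B ?W" "conj_invariant ?W T B" for B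
  proof -
    have "conj_invariant ?W T (T \<inter> B)"
      using B(2) Tinv Tc by (auto simp: conj_invariant_def)
    hence "T \<inter> B \<lhd> ?W\<lparr>carrier := T\<rparr>"
      using W.subgroups_Inter_pair[OF Ts B(1)] by (simp add: W.normal_subgroup_iff[OF Ts])
    thus ?thesis using s.no_real_normal_subgroup by fastforce
  qed
  have "conj_invariant ?W T A" using A_inv Tc by (auto simp: conj_invariant_def)
  with A have "T \<inter> A = T \<or> T \<inter> A = {\<one>\<^bsub>?W\<^esub>}" by (rule dich)
  hence TA: "T \<subseteq> A"
  proof
    assume i: "T \<inter> A = {\<one>\<^bsub>?W\<^esub>}"
    have "(g, \<one>, False) \<otimes>\<^bsub>?W\<^esub> t = t \<otimes>\<^bsub>?W\<^esub> (g, \<one>, False)" if "t \<in> T" for t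
      using W.commute_of_conj_invariant[OF A Ts, of "(g, \<one>, False)" t] Tinv A_inv i that g Tc
        subgroup.mem_carrier[OF A]
      by (auto simp: conj_invariant_def A_def Int_commute)
    thus ?thesis using not_central by blast
  qed blast
  have "conj_invariant ?W T A1" using A1_inv TA by (auto simp: conj_invariant_def)
  with A1 have "T \<inter> A1 = T \<or> T \<inter> A1 = {\<one>\<^bsub>?W\<^esub>}" by (rule dich)
  thus False
  proof
    assume "T \<inter> A1 = T"
    hence T_A1: "T \<subseteq> A1" by blast
    have "T \<subseteq> {\<one>\<^bsub>?W\<^esub>}"
    proof
      fix t assume t: "t \<in> T"
      then obtain a where a: "a \<in> carrier G" "t = (a, \<one>, False)" using T_A1 by (auto simp: A1_def)
      have "(\<one>, \<one>, True) \<in> carrier ?W" by (simp add: carrier_wreath2)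
      hence "(\<one>, \<one>, True) \<otimes>\<^bsub>?W\<^esub> t \<otimes>\<^bsub>?W\<^esub> inv\<^bsub>?W\<^esub> (\<one>, \<one>, True) \<in> T"
        using Tinv t by (auto simp: conj_invariant_def)
      hence "(\<one>, a, False) \<in> T" using a by (simp add: wreath2_simps inv_wreath2)
      hence "a = \<one>" using T_A1 by (auto simp: A1_def)
      thus "t \<in> {\<one>\<^bsub>?W\<^esub>}" using a by (simp add: one_wreath2)
    qed
    thus False using T1 subgroup.one_closed[OF Ts] by blast
  next
    assume i: "T \<inter> A1 = {\<one>\<^bsub>?W\<^esub>}"
    have "(g, \<one>, False) \<otimes>\<^bsub>?W\<^esub> t = t \<otimes>\<^bsub>?W\<^esub> (g, \<one>, False)" if "t \<in> T" for t
      using W.commute_of_conj_invariant[OF A1 Ts, of "(g, \<one>, False)" t] Tinv A1_inv TA i that g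
        subgroup.mem_carrier[OF A1]
      by (auto simp: conj_invariant_def A1_def Int_commute)
    thus False using not_central by blast
  qed
qed

text \<open>The wreath product acts on the cosets of \<open>K\<close>, the wreath product of
  \<open>H\<close> with the group of order two, and \<open>Y \<times> Y\<close> is intersecting
  there. Since \<open>K\<close> has order \<open>2 |H|^2\<close>, the density is at least half the
  square. As \<open>r \<ge> 1\<close>, this density excludes the EKR alternative of
  \<open>quasiprimitive_cases\<close>; almost simplicity is excluded by
  \<open>wreath2_not_almost_simple\<close>.\<close>

lemma primitive_examples:
  assumes fin: "finite (carrier G)" and simple: "nonabelian_simple G"
    and H: "subgroup H G" "H \<noteq> carrier G" "H \<noteq> {\<one>}"
    and maximal: "\<And>M. \<lbrakk>subgroup M G; H \<subseteq> M\<rbrakk> \<Longrightarrow> M = H \<or> M = carrier G"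
    and Y: "Y \<subseteq> carrier G" "\<And>x y. \<lbrakk>x \<in> Y; y \<in> Y\<rbrakk> \<Longrightarrow> \<exists>g\<in>carrier G. inv g \<otimes> (x \<otimes> inv y) \<otimes> g \<in> H"
    and ratio: "card Y / card H > r" "(card Y / card H)\<^sup>2 / 2 > r" and r: "r \<ge> 1"
  shows "\<exists>(\<Gamma> :: nat set) A. finite_permutation_group \<Gamma> A \<and> primitive \<Gamma> A \<and>
           almost_simple (perm_grp \<Gamma> A) \<and> intersection_density \<Gamma> A > r"
    and "\<exists>(\<Delta> :: nat set) P. finite_permutation_group \<Delta> P \<and> primitive \<Delta> P \<and>
           product_action_type \<Delta> P \<and> intersection_density \<Delta> P > r"
proof -
  interpret s: simple_group G using simple by (simp add: nonabelian_simple_def)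
  have Hc: "h \<in> carrier G" if "h \<in> H" for h using H(1) that by (rule subgroup.mem_carrier)
  have core: "N = {\<one>}" if "N \<lhd> G" "N \<subseteq> H" for N
    using s.no_real_normal_subgroup[OF that(1)] that(2) H(2) subgroup.subset[OF H(1)] by blast
  obtain \<Gamma> :: "nat set" and A where \<Gamma>: "finite_permutation_group \<Gamma> A" "primitive \<Gamma> A" "G \<cong> perm_grp \<Gamma> A"
      "intersection_density \<Gamma> A \<ge> card Y / card H"
    using coset_permutation_group[OF fin H(1,2) maximal core Y] by blast
  interpret A: perm_group \<Gamma> A using \<Gamma>(1) by unfold_locales
  obtain \<phi> where "\<phi> \<in> iso G (perm_grp \<Gamma> A)" using \<Gamma>(3) by (auto simp: is_iso_def)
  hence "almost_simple (perm_grp \<Gamma> A)"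
    using nonabelian_simple_iso[OF simple _ A.is_group] almost_simple_of_nonabelian_simple by blast
  thus "\<exists>(\<Gamma> :: nat set) A. finite_permutation_group \<Gamma> A \<and> primitive \<Gamma> A \<and>
           almost_simple (perm_grp \<Gamma> A) \<and> intersection_density \<Gamma> A > r"
    using \<Gamma> ratio(1) by (intro exI[of _ \<Gamma>] exI[of _ A]) auto
  let ?W = "wreath2 G"
  interpret W: group ?W by (rule group_wreath2)
  define K :: "('a \<times> 'a \<times> bool) set" where "K = {(a, b, s) | a b s. a \<in> H \<and> b \<in> H}"
  define Z where "Z = {(a, b, False) | a b. a \<in> Y \<and> b \<in> Y}"
  have Kmem: "(a, b, s) \<in> K \<longleftrightarrow> a \<in> H \<and> b \<in> H" for a b and s :: bool by (auto simp: K_def)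
  note Hcl = subgroup.m_closed[OF H(1)] subgroup.m_inv_closed[OF H(1)] subgroup.one_closed[OF H(1)]
  have Ws: "K \<subseteq> carrier ?W" using Hc by (auto simp: K_def carrier_wreath2)
  have K: "subgroup K ?W"
    using Ws by (rule W.subgroupI) (use Hc Hcl in \<open>auto simp: K_def wreath2_simps inv_wreath2\<close>)
  obtain u where u: "u \<in> carrier G" "u \<notin> H" using H(1,2) subgroup.subset by blast
  have finW: "finite (carrier ?W)" using fin by (simp add: wreath2_def)
  have K2: "K \<noteq> carrier ?W"
  proof -
    have "(u, u, False) \<in> carrier ?W" "(u, u, False) \<notin> K" using u by (auto simp: carrier_wreath2 Kmem)
    thus ?thesis by blast
  qed
  have K3: "M = K \<or> M = carrier ?W" if M: "subgroup M ?W" "K \<subseteq> M" for M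
  proof -
    have Mc: "a \<in> carrier G" "b \<in> carrier G" if "(a, b, s) \<in> M" for a b s
      using subgroup.mem_carrier[OF M(1) that] by (auto simp: carrier_wreath2)
    note Mm = subgroup.m_closed[OF M(1)] and Mi = subgroup.m_inv_closed[OF M(1)]
    have t: "(\<one>, \<one>, s) \<in> M" for s using M(2) Hcl by (auto simp: Kmem)
    have drop: "(a, b, s') \<in> M" if "(a, b, s) \<in> M" for a b s s'
      using Mm[OF that t[of "s \<noteq> s'"]] Mc[OF that] by (cases s; cases s') (auto simp: mult_wreath2)
    have swap: "(b, a, s) \<in> M" if "(a, b, s) \<in> M" for a b s
    proof -
      have "(b, a, \<not> s) \<in> M" using Mm[OF t[of True] that] Mc[OF that] by (simp add: mult_wreath2)
      thus ?thesis by (rule drop)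
    qed
    have mul: "(a \<otimes> c, b \<otimes> d, s) \<in> M" if "(a, b, s) \<in> M" "(c, d, s) \<in> M" for a b c d s
    proof -
      have "(a \<otimes> c, b \<otimes> d, s) \<in> M"
        using Mm[OF drop[OF that(1), of False] that(2)] by (simp add: mult_wreath2)
      thus ?thesis by (rule drop)
    qed
    have invM: "(inv a, inv b, s) \<in> M" if "(a, b, s) \<in> M" for a b s
    proof -
      have "(inv a, inv b, False) \<in> M"
        using Mi[OF drop[OF that, of False]] Mc[OF that] by (simp add: inv_wreath2)
      thus ?thesis by (rule drop)
    qed
    \<comment> \<open>\<open>K\<close> contains the swap, so \<open>M\<close> is closed under
      exchanging the two coordinates and under changing the swap bit. Its first projection contains
      \<open>H\<close> and is therefore \<open>H\<close> or \<open>G\<close>.\<close>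
    define M0 where "M0 = {a. \<exists>b. (a, b, False) \<in> M}"
    have "subgroup M0 G"
    proof (rule subgroupI)
      show "M0 \<subseteq> carrier G" using Mc by (auto simp: M0_def)
      show "M0 \<noteq> {}" using t by (auto simp: M0_def)
      show "inv a \<in> M0" if "a \<in> M0" for a using that invM unfolding M0_def by blast
      show "a \<otimes> b \<in> M0" if "a \<in> M0" "b \<in> M0" for a b using that mul unfolding M0_def by blast
    qed
    moreover have "H \<subseteq> M0"
    proof
      fix h assume "h \<in> H"
      hence "(h, \<one>, False) \<in> M" using M(2) Hcl(3) by (auto simp: Kmem)
      thus "h \<in> M0" by (auto simp: M0_def)
    qed
    ultimately consider "M0 = H" | "M0 = carrier G" using maximal by blast
    thus ?thesis
    proof cases
      case 1
      have "M \<subseteq> K"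
      proof
        fix z assume z: "z \<in> M"
        obtain a b s where ab: "z = (a, b, s)" by (cases z) auto
        have "(a, b, False) \<in> M" "(b, a, False) \<in> M" using z ab drop swap by blast+
        hence "a \<in> M0" "b \<in> M0" by (auto simp: M0_def)
        thus "z \<in> K" using 1 ab by (simp add: Kmem)
      qed
      thus ?thesis using M(2) by blast
    next
      case 2
      \<comment> \<open>As \<open>M0\<close> is all of \<open>G\<close>, conjugation inside
        \<open>M\<close> makes \<open>M1\<close> normal in \<open>G\<close>. It contains the
        nontrivial \<open>H\<close>, so \<open>M1 = G\<close> by simplicity, and the swap provides
        the other coordinate as well.\<close>
      define M1 where "M1 = {a. (a, \<one>, False) \<in> M}"
      have M1s: "subgroup M1 G"
      proof (rule subgroupI)
        show "M1 \<subseteq> carrier G" using Mc by (auto simp: M1_def)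
        show "M1 \<noteq> {}" using t by (auto simp: M1_def)
        fix a assume a: "a \<in> M1"
        thus "inv a \<in> M1" using invM[of a \<one> False] by (simp add: M1_def)
        fix b assume b: "b \<in> M1"
        thus "a \<otimes> b \<in> M1" using a mul[of a \<one> False b \<one>] by (simp add: M1_def)
      qed
      have "M1 \<lhd> G" unfolding normal_inv_iff
      proof (intro conjI ballI M1s)
        fix x a assume x: "x \<in> carrier G" and a: "a \<in> M1"
        obtain b where b: "(x, b, False) \<in> M" using x 2 by (auto simp: M0_def)
        have "(x \<otimes> a \<otimes> inv x, b \<otimes> \<one> \<otimes> inv b, False) \<in> M"
          using mul[OF mul[OF b, of a \<one>] invM[OF b]] a by (simp add: M1_def)
        thus "x \<otimes> a \<otimes> inv x \<in> M1" using Mc(2)[OF b] by (simp add: M1_def)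
      qed
      moreover have "H \<subseteq> M1" using M(2) Hcl(3) by (auto simp: M1_def Kmem)
      ultimately have M1: "M1 = carrier G"
        using s.no_real_normal_subgroup[of M1] H(3) Hcl(3) by blast
      have "carrier ?W \<subseteq> M"
      proof
        fix z assume z: "z \<in> carrier ?W"
        obtain a b s where ab: "z = (a, b, s)" by (cases z) auto
        have c: "a \<in> carrier G" "b \<in> carrier G" using z ab by (auto simp: carrier_wreath2)
        have 1: "(a, \<one>, s) \<in> M" by (rule drop[of _ _ False]) (use c M1 in \<open>simp add: M1_def set_eq_iff\<close>)
        have 2: "(\<one>, b, s) \<in> M"
          by (rule swap, rule drop[of _ _ False]) (use c M1 in \<open>simp add: M1_def set_eq_iff\<close>)
        from mul[OF 1 2] show "z \<in> M" using ab c by simp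
      qed
      thus ?thesis using subgroup.subset[OF M(1)] by blast
    qed
  qed
  have K4: "N = {\<one>\<^bsub>?W\<^esub>}" if N: "N \<lhd> ?W" "N \<subseteq> K" for N
  proof -
    have Ns: "subgroup N ?W" using N(1) by (rule normal_imp_subgroup)
    have Ncj: "x \<otimes>\<^bsub>?W\<^esub> z \<otimes>\<^bsub>?W\<^esub> inv\<^bsub>?W\<^esub> x \<in> K" if "x \<in> carrier ?W" "z \<in> N" for x z
      using N that by (auto simp: W.normal_inv_iff)
    have F: "s = False" if z: "(a, b, s) \<in> N" for a b s
    proof (rule ccontr)
      assume "s \<noteq> False"
      hence z': "(a, b, True) \<in> N" using z by simp
      have ab: "a \<in> H" "b \<in> H" using z' N(2) by (auto simp: Kmem)
      \<comment> \<open>Conjugating an element with swap bit by \<open>(u, \<one>, False)\<close>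
        multiplies its first coordinate by \<open>u\<close> on the left, and on the other side only
        the second coordinate changes.\<close>
      have "(u, \<one>, False) \<otimes>\<^bsub>?W\<^esub> (a, b, True) \<otimes>\<^bsub>?W\<^esub> inv\<^bsub>?W\<^esub> (u, \<one>, False) \<in> K"
        by (rule Ncj) (use u z' in \<open>auto simp: carrier_wreath2\<close>)
      hence "u \<otimes> a \<in> H" using u ab Hc by (simp add: mult_wreath2 inv_wreath2 Kmem)
      hence "u \<otimes> a \<otimes> inv a \<in> H" using ab Hcl by blast
      thus False using u ab Hc by (simp add: m_assoc)
    qed
    have ab1: "a = \<one> \<and> b = \<one>" if z: "(a, b, s) \<in> N" for a b s
    proof -
      have z': "(a, b, False) \<in> N" using z F[OF z] by simp
      have ab: "a \<in> carrier G" "b \<in> carrier G" using z' W.normal_carrier[OF N(1)] by (auto simp: carrier_wreath2)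
      have cj: "x \<otimes> a \<otimes> inv x \<in> H \<and> x \<otimes> b \<otimes> inv x \<in> H" if x: "x \<in> carrier G" for x
        using Ncj[of "(x, x, False)", OF _ z'] x ab by (simp add: wreath2_simps inv_wreath2 Kmem)
      \<comment> \<open>All conjugates of \<open>c\<close> lie in \<open>H\<close>, hence so does
        its normal closure, and \<open>core\<close> applies.\<close>
      have core1: "c = \<one>" if c: "c \<in> carrier G" "\<And>x. x \<in> carrier G \<Longrightarrow> x \<otimes> c \<otimes> inv x \<in> H" for c
      proof -
        let ?A = "(\<lambda>x. x \<otimes> c \<otimes> inv x) ` carrier G"
        have Ac: "?A \<subseteq> carrier G" using c by auto
        have "generate G ?A \<lhd> G"
        proof (rule normal_generateI[OF Ac])
          fix h g assume "h \<in> ?A" and g: "g \<in> carrier G"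
          then obtain x where x: "x \<in> carrier G" "h = x \<otimes> c \<otimes> inv x" by blast
          have "g \<otimes> h \<otimes> inv g = (g \<otimes> x) \<otimes> c \<otimes> inv (g \<otimes> x)" using g x c by (simp add: word_simps)
          thus "g \<otimes> h \<otimes> inv g \<in> ?A" using g x(1) by blast
        qed
        moreover have "generate G ?A \<subseteq> H" using c(2) by (intro generate_subgroup_incl[OF _ H(1)]) auto
        ultimately have "generate G ?A = {\<one>}" by (rule core)
        moreover have "\<one> \<otimes> c \<otimes> inv \<one> \<in> generate G ?A" by (intro generate.incl) blast
        ultimately show ?thesis using c(1) by simp
      qed
      show ?thesis using core1[OF ab(1)] core1[OF ab(2)] cj by blast
    qed
    have "N \<subseteq> {\<one>\<^bsub>?W\<^esub>}"
    proof
      fix z assume z: "z \<in> N"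
      obtain a b s where ab: "z = (a, b, s)" by (cases z) auto
      show "z \<in> {\<one>\<^bsub>?W\<^esub>}" using ab1[of a b s] F[of a b s] z ab by (simp add: one_wreath2)
    qed
    thus ?thesis using subgroup.one_closed[OF Ns] by blast
  qed
  have Z1: "Z \<subseteq> carrier ?W" using Y(1) by (auto simp: Z_def carrier_wreath2)
  have Z2: "\<exists>g\<in>carrier ?W. inv\<^bsub>?W\<^esub> g \<otimes>\<^bsub>?W\<^esub> (x \<otimes>\<^bsub>?W\<^esub> inv\<^bsub>?W\<^esub> y) \<otimes>\<^bsub>?W\<^esub> g \<in> K"
    if xy: "x \<in> Z" "y \<in> Z" for x y
  proof -
    obtain a b c d where xy': "x = (a, b, False)" "y = (c, d, False)" "a \<in> Y" "b \<in> Y" "c \<in> Y" "d \<in> Y"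
      using xy by (auto simp: Z_def)
    obtain g h where gh: "g \<in> carrier G" "inv g \<otimes> (a \<otimes> inv c) \<otimes> g \<in> H"
      "h \<in> carrier G" "inv h \<otimes> (b \<otimes> inv d) \<otimes> h \<in> H" using Y(2) xy' by meson
    have cc: "a \<in> carrier G" "b \<in> carrier G" "c \<in> carrier G" "d \<in> carrier G" using xy' Y(1) by auto
    show ?thesis
      by (rule bexI[of _ "(g, h, False)"])
        (use gh cc in \<open>simp_all add: xy'(1,2) wreath2_simps inv_wreath2 Kmem\<close>)
  qed
  obtain \<Delta> :: "nat set" and P where \<Delta>: "finite_permutation_group \<Delta> P" "primitive \<Delta> P" "?W \<cong> perm_grp \<Delta> P"
      "intersection_density \<Delta> P \<ge> card Z / card K"
    using W.coset_permutation_group[OF finW K K2 K3 K4 Z1 Z2] by blast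
  have "Z = (\<lambda>(a, b). (a, b, False)) ` (Y \<times> Y)" by (auto simp: Z_def)
  hence cZ: "card Z = card Y * card Y"
    by (simp add: card_image inj_on_def card_cartesian_product)
  have "K = H \<times> H \<times> UNIV" by (auto simp: K_def)
  hence cK: "card K = card H * (card H * 2)" by (simp add: card_cartesian_product)
  have "card Z / card K = (card Y / card H)\<^sup>2 / 2"
    unfolding cZ cK by (simp add: power2_eq_square)
  hence dens: "intersection_density \<Delta> P > r" using \<Delta>(4) ratio(2) by linarith
  interpret P: perm_group \<Delta> P using \<Delta>(1) by unfold_locales
  have "\<not> almost_simple (perm_grp \<Delta> P)"
    using wreath2_not_almost_simple[OF s.simple_not_triv \<Delta>(3)] by blast
  hence "product_action_type \<Delta> P"
    using P.quasiprimitive_cases[OF primitive_imp_quasiprimitive[OF \<Delta>(1,2)]] dens r by auto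
  thus "\<exists>(\<Delta> :: nat set) P. finite_permutation_group \<Delta> P \<and> primitive \<Delta> P \<and>
           product_action_type \<Delta> P \<and> intersection_density \<Delta> P > r"
    using \<Delta> dens by blast
qed

end

section \<open>General linear groups over the field with two elements\<close>

declare add_bit_eq_xor [simp del] mult_bit_eq_and [simp del]

definition smul :: "bit \<Rightarrow> ('i \<Rightarrow> bit) \<Rightarrow> 'i \<Rightarrow> bit" where
  "smul b v = (\<lambda>i. b * v i)"

lemma smul_simps [simp]: "smul 0 v = 0" "smul 1 v = v" "smul b 0 = 0"
  by (auto simp: smul_def fun_eq_iff)

lemma smul_add: "smul (a + b) v = smul a v + smul b v" "smul b (v + w) = smul b v + smul b w"
  by (auto simp: smul_def fun_eq_iff algebra_simps)

lemma bit_add_self [simp]: "(b::bit) + b = 0"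
  by (cases b) simp_all

lemma vec_add_self [simp]: "(x :: 'i \<Rightarrow> bit) + x = 0"
  by (simp add: fun_eq_iff)

lemma vec_cancel [simp]: "(x :: 'i \<Rightarrow> bit) + (x + y) = y"
  by (simp flip: add.assoc)

lemma vec_eq_iff: "(x :: 'i \<Rightarrow> bit) = y \<longleftrightarrow> x + y = 0"
  by (metis add.right_neutral vec_add_self vec_cancel)

definition basis_vec :: "'i \<Rightarrow> 'i \<Rightarrow> bit" where
  "basis_vec i = (\<lambda>j. if j = i then 1 else 0)"

definition supported :: "'i set \<Rightarrow> ('i \<Rightarrow> bit) set" where
  "supported J = {x. \<forall>i. i \<notin> J \<longrightarrow> x i = 0}"

text \<open>Over the field with two elements additivity is linearity. With it, the second condition
  says that the value depends only on the coordinates in \<open>J\<close>.\<close>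

definition functionals_on :: "'i set \<Rightarrow> (('i \<Rightarrow> bit) \<Rightarrow> bit) set" where
  "functionals_on J = {\<theta>. (\<forall>x y. \<theta> (x + y) = \<theta> x + \<theta> y) \<and> (\<forall>x. (\<forall>i\<in>J. x i = 0) \<longrightarrow> \<theta> x = 0)}"

lemma supported_zero [simp]: "0 \<in> supported J" by (simp add: supported_def)
lemma supported_add: "\<lbrakk>x \<in> supported J; y \<in> supported J\<rbrakk> \<Longrightarrow> x + y \<in> supported J"
  by (simp add: supported_def)
lemma supported_smul: "x \<in> supported J \<Longrightarrow> smul b x \<in> supported J"
  by (cases b) simp_all
lemma supported_basis: "i \<in> J \<Longrightarrow> basis_vec i \<in> supported J"
  by (auto simp: supported_def basis_vec_def)
lemma supported_mono: "J \<subseteq> K \<Longrightarrow> supported J \<subseteq> supported K"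
  by (auto simp: supported_def)

lemma coordinate_functional: "i \<in> J \<Longrightarrow> (\<lambda>x. x i) \<in> functionals_on J"
  by (simp add: functionals_on_def)
lemma functionals_on_add:
  "\<lbrakk>\<theta> \<in> functionals_on J; \<eta> \<in> functionals_on J\<rbrakk> \<Longrightarrow> (\<lambda>x. \<theta> x + \<eta> x) \<in> functionals_on J"
  unfolding functionals_on_def by (simp only: mem_Collect_eq add_0 simp_thms add_ac) simp

lemma bij_betw_supported: "bij_betw (\<lambda>A i. if i \<in> A then 1 else 0 :: bit) (Pow J) (supported J)"
proof (rule bij_betw_byWitness[of _ "\<lambda>x. {i. x i = 1}"])
  show "\<forall>x\<in>supported J. (\<lambda>i. if i \<in> {i. x i = 1} then 1 else 0) = x"
  proof
    fix x :: "'a \<Rightarrow> bit"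
    show "(\<lambda>i. if i \<in> {i. x i = 1} then 1 else 0) = x"
    proof
      fix i show "(if i \<in> {i. x i = 1} then 1 else 0) = x i" by (cases "x i") auto
    qed
  qed
qed (auto simp: supported_def)

lemma card_supported: "finite J \<Longrightarrow> card (supported J) = 2 ^ card J"
  using bij_betw_same_card[OF bij_betw_supported[of J]] by (simp add: card_Pow)

lemma finite_supported: "finite J \<Longrightarrow> finite (supported J)"
  using bij_betw_finite[OF bij_betw_supported[of J]] by simp

text \<open>One coordinate suffices unless the support of \<open>y\<close> lies inside that of
  \<open>u\<close>; then the sum of a coordinate in the smaller support and one in the difference
  works.\<close>

lemma separating_functional:
  assumes "u \<in> supported J" "y \<in> supported J" "y \<noteq> 0" "u \<noteq> y"
  obtains \<theta> where "\<theta> \<in> functionals_on J" "\<theta> u = 0" "\<theta> y = 1"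
proof (cases "\<exists>i. y i = 1 \<and> u i = 0")
  case True
  then obtain i where i: "y i = 1" "u i = 0" by blast
  hence "i \<in> J" using assms by (auto simp: supported_def)
  thus ?thesis using that[OF coordinate_functional] i by blast
next
  case False
  have sub: "u i = 1" if "y i = 1" for i
  proof -
    have "u i \<noteq> 0" using False that by blast
    thus ?thesis by (simp only: bit_not_zero_iff)
  qed
  obtain i where i: "y i = 1" using assms(3) by (auto simp: fun_eq_iff)
  obtain j where uj: "u j \<noteq> y j" using assms(4) by (auto simp: fun_eq_iff)
  hence "y j \<noteq> 1" using sub[of j] by metis
  hence j: "u j = 1" "y j = 0" using uj by simp_all
  have "i \<in> J" "j \<in> J" using i j assms by (auto simp: supported_def)
  thus ?thesis using that[OF functionals_on_add[OF coordinate_functional[of i J] coordinate_functional[of j J]]]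
      i j sub[OF i] by simp
qed

text \<open>Take a common coordinate of the supports, or else the sum of one from each. Such a
  functional is the axis of a transvection with centre \<open>u + y\<close> that exchanges
  \<open>u\<close> and \<open>y\<close>.\<close>

lemma common_functional:
  assumes "u \<in> supported J" "y \<in> supported J" "u \<noteq> 0" "y \<noteq> 0"
  obtains \<theta> where "\<theta> \<in> functionals_on J" "\<theta> u = 1" "\<theta> y = 1"
proof (cases "\<exists>i. y i = 1 \<and> u i = 1")
  case True
  then obtain i where i: "y i = 1" "u i = 1" by blast
  hence "i \<in> J" using assms by (auto simp: supported_def)
  thus ?thesis using that[OF coordinate_functional] i by blast
next
  case False
  obtain i where i: "u i = 1" using assms(3) by (auto simp: fun_eq_iff)
  obtain j where j: "y j = 1" using assms(4) by (auto simp: fun_eq_iff)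
  have "y i \<noteq> 1" "u j \<noteq> 1" using False i j by blast+
  hence n: "y i = 0" "u j = 0" by (simp_all only: bit_not_one_iff)
  have "i \<in> J" "j \<in> J" using i j assms by (auto simp: supported_def)
  thus ?thesis using that[OF functionals_on_add[OF coordinate_functional[of i J] coordinate_functional[of j J]]]
      i j n by simp
qed

lemma card_kernel:
  assumes fin: "finite S" and add: "\<And>x y. \<lbrakk>x \<in> S; y \<in> S\<rbrakk> \<Longrightarrow> x + y \<in> S"
    and \<theta>: "\<And>x y. \<lbrakk>x \<in> S; y \<in> S\<rbrakk> \<Longrightarrow> \<theta> (x + y) = \<theta> x + (\<theta> y :: bit)"
    and a: "a \<in> S" "\<theta> a = 1"
  shows "card (S :: ('i \<Rightarrow> bit) set) = 2 * card {x \<in> S. \<theta> x = 0}"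
proof -
  let ?K = "{x \<in> S. \<theta> x = 0}" and ?L = "{x \<in> S. \<theta> x = 1}"
  have "(\<lambda>x. a + x) ` ?K = ?L"
  proof (intro Set.set_eqI iffI)
    fix x assume "x \<in> (\<lambda>x. a + x) ` ?K"
    thus "x \<in> ?L" using add \<theta> a by auto
  next
    fix x assume x: "x \<in> ?L"
    hence "a + x \<in> ?K" using add[OF a(1)] \<theta>[OF a(1)] a by auto
    moreover have "x = a + (a + x)" by simp
    ultimately show "x \<in> (\<lambda>x. a + x) ` ?K" by blast
  qed
  hence "card ?L = card ?K" using card_image[of "\<lambda>x. a + x" ?K] by (simp add: inj_on_def)
  moreover have "card (?K \<union> ?L) = card ?K + card ?L" using fin by (intro card_Un_disjoint) auto
  moreover have "?K \<union> ?L = S" by auto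
  ultimately show ?thesis by simp
qed

lemma card_kernel_ge:
  assumes "finite S" "\<And>x y. \<lbrakk>x \<in> S; y \<in> S\<rbrakk> \<Longrightarrow> x + y \<in> S"
    and "\<And>x y. \<lbrakk>x \<in> S; y \<in> S\<rbrakk> \<Longrightarrow> \<theta> (x + y) = \<theta> x + (\<theta> y :: bit)"
  shows "card (S :: ('i \<Rightarrow> bit) set) \<le> 2 * card {x \<in> S. \<theta> x = 0}"
proof (cases "\<exists>a\<in>S. \<theta> a = 1")
  case True
  thus ?thesis using card_kernel[OF assms] by fastforce
next
  case False
  hence "{x \<in> S. \<theta> x = 0} = S" by auto
  thus ?thesis by simp
qed

lemma ex_third:
  assumes "card S \<ge> 3" shows "\<exists>d\<in>S. d \<noteq> a \<and> d \<noteq> b"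
proof (rule ccontr)
  assume "\<not> ?thesis"
  hence "S \<subseteq> {a, b}" by blast
  hence "card S \<le> card {a, b}" by (intro card_mono) auto
  also have "\<dots> \<le> 2" by (simp add: card_insert_if)
  finally show False using assms by simp
qed

section \<open>Transvections and elementary matrices over the field with two elements\<close>

locale gl2 =
  fixes I :: "'i set"
  assumes finite_I: "finite I"
begin

definition V :: "('i \<Rightarrow> bit) set" where "V = supported I"

definition GL :: "(('i \<Rightarrow> bit) \<Rightarrow> 'i \<Rightarrow> bit) set" where
  "GL = {g \<in> Bij V. \<forall>x\<in>V. \<forall>y\<in>V. g (x + y) = g x + g y}"

definition dual :: "(('i \<Rightarrow> bit) \<Rightarrow> bit) set" where
  "dual = {\<theta>. \<forall>x\<in>V. \<forall>y\<in>V. \<theta> (x + y) = \<theta> x + \<theta> y}"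

text \<open>The transvection with centre \<open>v\<close> and axis the kernel of
  \<open>\<theta>\<close>. It is an involution or the identity when \<open>\<theta> v = 0\<close>;
  otherwise it sends \<open>v\<close> to 0.\<close>

definition tv :: "('i \<Rightarrow> bit) \<Rightarrow> (('i \<Rightarrow> bit) \<Rightarrow> bit) \<Rightarrow> ('i \<Rightarrow> bit) \<Rightarrow> 'i \<Rightarrow> bit" where
  "tv v \<theta> = (\<lambda>x\<in>V. x + smul (\<theta> x) v)"

lemma V_closed [simp]: "0 \<in> V" "\<lbrakk>x \<in> V; y \<in> V\<rbrakk> \<Longrightarrow> x + y \<in> V" "x \<in> V \<Longrightarrow> smul b x \<in> V"
  "i \<in> I \<Longrightarrow> basis_vec i \<in> V"
  by (simp_all add: V_def supported_add supported_smul supported_basis)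

lemma finite_V: "finite V" using finite_I by (simp add: V_def finite_supported)

lemma dualI: "\<theta> \<in> functionals_on J \<Longrightarrow> \<theta> \<in> dual" by (simp add: functionals_on_def dual_def)
lemma coord_dual [simp]: "(\<lambda>x. x i) \<in> dual" by (simp add: dual_def)
lemma dual_add: "\<lbrakk>\<theta> \<in> dual; x \<in> V; y \<in> V\<rbrakk> \<Longrightarrow> \<theta> (x + y) = \<theta> x + \<theta> y" by (simp add: dual_def)
lemma dual_zero: "\<theta> \<in> dual \<Longrightarrow> \<theta> 0 = 0"
  using dual_add[of \<theta> 0 0] V_closed(1) by (cases "\<theta> 0") auto
lemma dual_smul: "\<lbrakk>\<theta> \<in> dual; x \<in> V\<rbrakk> \<Longrightarrow> \<theta> (smul b x) = b * \<theta> x"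
  using dual_zero by (cases b) auto
lemma dual_sum: "\<lbrakk>\<theta> \<in> dual; \<eta> \<in> dual\<rbrakk> \<Longrightarrow> (\<lambda>x. \<theta> x + \<eta> x) \<in> dual"
  unfolding dual_def mem_Collect_eq
proof (intro ballI)
  fix x y assume a: "\<forall>x\<in>V. \<forall>y\<in>V. \<theta> (x + y) = \<theta> x + \<theta> y" "\<forall>x\<in>V. \<forall>y\<in>V. \<eta> (x + y) = \<eta> x + \<eta> y"
    and xy: "x \<in> V" "y \<in> V"
  have "\<theta> (x + y) = \<theta> x + \<theta> y" "\<eta> (x + y) = \<eta> x + \<eta> y" using a xy by blast+
  thus "\<theta> (x + y) + \<eta> (x + y) = \<theta> x + \<eta> x + (\<theta> y + \<eta> y)" by (simp only: add_ac)
qed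

lemma GL_subgroup: "subgroup GL (BijGroup V)"
proof (rule group.subgroupI[OF group_BijGroup])
  show "GL \<subseteq> carrier (BijGroup V)" by (auto simp: GL_def BijGroup_def)
  have "(\<lambda>x\<in>V. x) \<in> GL" by (simp add: GL_def id_Bij)
  thus "GL \<noteq> {}" by blast
  fix a assume a: "a \<in> GL"
  hence aB: "a \<in> Bij V" and lin: "\<And>x y. \<lbrakk>x \<in> V; y \<in> V\<rbrakk> \<Longrightarrow> a (x + y) = a x + a y" by (auto simp: GL_def)
  have "inv_into V a (x + y) = inv_into V a x + inv_into V a y" if "x \<in> V" "y \<in> V" for x y
    using Bij_inv_into_lemma[of V a "(+)" x y] lin aB that by auto
  thus "inv\<^bsub>BijGroup V\<^esub> a \<in> GL"
    using restrict_inv_into_Bij[OF aB] by (simp add: inv_BijGroup[OF aB] GL_def)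
  fix b assume b: "b \<in> GL"
  have "b x \<in> V" if "x \<in> V" for x using b that Bij_imp_funcset by (auto simp: GL_def)
  thus "a \<otimes>\<^bsub>BijGroup V\<^esub> b \<in> GL"
    using a b compose_Bij[of a V b] by (auto simp: GL_def BijGroup_def compose_def)
qed

lemma GL_perm: "finite_permutation_group V GL"
  using GL_subgroup finite_V V_closed(1) unfolding finite_permutation_group_def by blast

end

sublocale gl2 \<subseteq> perm_group V GL
  using GL_perm by unfold_locales

context gl2
begin

abbreviation "GG \<equiv> perm_grp V GL"

lemma GL_V: "\<lbrakk>g \<in> GL; x \<in> V\<rbrakk> \<Longrightarrow> g x \<in> V" using act_closed by simp
lemma GL_add: "\<lbrakk>g \<in> GL; x \<in> V; y \<in> V\<rbrakk> \<Longrightarrow> g (x + y) = g x + g y" by (simp add: GL_def)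
lemma GL_zero: "g \<in> GL \<Longrightarrow> g 0 = 0"
  using GL_add[of g 0 0] V_closed(1) by simp
lemma GL_smul: "\<lbrakk>g \<in> GL; x \<in> V\<rbrakk> \<Longrightarrow> g (smul b x) = smul b (g x)"
  using GL_zero by (cases b) auto
lemma GL_inv: "g \<in> GL \<Longrightarrow> inv\<^bsub>GG\<^esub> g \<in> GL" using inv_closed by simp
lemma GL_mult: "\<lbrakk>g \<in> GL; h \<in> GL\<rbrakk> \<Longrightarrow> g \<otimes>\<^bsub>GG\<^esub> h \<in> GL" using m_closed by simp
lemma GL_mult_apply: "\<lbrakk>g \<in> GL; h \<in> GL; x \<in> V\<rbrakk> \<Longrightarrow> (g \<otimes>\<^bsub>GG\<^esub> h) x = g (h x)"
  using composition_rule by simp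
lemma GL_inj: "\<lbrakk>g \<in> GL; x \<in> V; y \<in> V; g x = g y\<rbrakk> \<Longrightarrow> x = y"
  using inj_prop[of g] by (auto dest: inj_onD)
lemma GL_eqI: "\<lbrakk>g \<in> GL; h \<in> GL; \<And>x. x \<in> V \<Longrightarrow> g x = h x\<rbrakk> \<Longrightarrow> g = h"
  using faithfulI by simp
lemma GL_inv_apply: "\<lbrakk>g \<in> GL; x \<in> V\<rbrakk> \<Longrightarrow> (inv\<^bsub>GG\<^esub> g) (g x) = x" "\<lbrakk>g \<in> GL; x \<in> V\<rbrakk> \<Longrightarrow> g ((inv\<^bsub>GG\<^esub> g) x) = x"
  using act_inv_left act_inv_right by auto
lemma dual_comp: "\<lbrakk>\<theta> \<in> dual; g \<in> GL\<rbrakk> \<Longrightarrow> (\<lambda>x. \<theta> (g x)) \<in> dual"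
  using GL_V by (auto simp: dual_def GL_add[of g])

lemma tv_apply: "x \<in> V \<Longrightarrow> tv v \<theta> x = x + smul (\<theta> x) v" by (simp add: tv_def)

lemma tv_GL:
  assumes v: "v \<in> V" and \<theta>: "\<theta> \<in> dual" "\<theta> v = 0" shows "tv v \<theta> \<in> GL"
proof -
  have "bij_betw (tv v \<theta>) V V"
    by (rule bij_betw_byWitness[of _ "tv v \<theta>"])
      (use v \<theta> in \<open>auto simp: tv_def dual_add dual_smul add.assoc\<close>)
  thus ?thesis using v \<theta>
    by (auto simp: GL_def Bij_def tv_def dual_add smul_add algebra_simps)
qed

lemma tv_mult:
  assumes "v \<in> V" "w \<in> V" "\<theta> \<in> dual" "\<theta> v = 0" "\<theta> w = 0"
  shows "tv v \<theta> \<otimes>\<^bsub>GG\<^esub> tv w \<theta> = tv (v + w) \<theta>"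
proof (rule GL_eqI)
  show "tv v \<theta> \<otimes>\<^bsub>GG\<^esub> tv w \<theta> \<in> GL" "tv (v + w) \<theta> \<in> GL"
    using assms GL_mult[of "tv v \<theta>" "tv w \<theta>"] tv_GL by (auto simp: dual_add)
  fix x assume x: "x \<in> V"
  have "(tv v \<theta> \<otimes>\<^bsub>GG\<^esub> tv w \<theta>) x = tv v \<theta> (tv w \<theta> x)" using assms x by (intro GL_mult_apply tv_GL)
  thus "(tv v \<theta> \<otimes>\<^bsub>GG\<^esub> tv w \<theta>) x = tv (v + w) \<theta> x"
    using assms x by (simp only:) (simp add: tv_apply dual_add dual_smul smul_add algebra_simps)
qed

lemma tv_mult_dual:
  assumes "v \<in> V" "\<theta> \<in> dual" "\<eta> \<in> dual" "\<theta> v = 0" "\<eta> v = 0"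
  shows "tv v \<theta> \<otimes>\<^bsub>GG\<^esub> tv v \<eta> = tv v (\<lambda>x. \<theta> x + \<eta> x)"
proof (rule GL_eqI)
  show "tv v \<theta> \<otimes>\<^bsub>GG\<^esub> tv v \<eta> \<in> GL" "tv v (\<lambda>x. \<theta> x + \<eta> x) \<in> GL"
    using assms GL_mult[of "tv v \<theta>" "tv v \<eta>"] tv_GL[of v \<theta>] tv_GL[of v \<eta>]
      tv_GL[OF _ dual_sum, of v \<theta> \<eta>] by simp_all
  fix x assume x: "x \<in> V"
  have "(tv v \<theta> \<otimes>\<^bsub>GG\<^esub> tv v \<eta>) x = tv v \<theta> (tv v \<eta> x)" using assms x by (intro GL_mult_apply tv_GL)
  thus "(tv v \<theta> \<otimes>\<^bsub>GG\<^esub> tv v \<eta>) x = tv v (\<lambda>x. \<theta> x + \<eta> x) x"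
    using assms x by (simp only:) (simp add: tv_apply dual_add dual_smul smul_add algebra_simps)
qed

text \<open>\<open>\<eta>\<close> is \<open>\<theta>\<close> composed with the inverse of
  \<open>g\<close>. Describing it through \<open>\<eta> (g x) = \<theta> x\<close> spares
  applications with an explicit \<open>\<eta>\<close> from handling the inverse.\<close>

lemma tv_conj:
  assumes g: "g \<in> GL" and v: "v \<in> V" and \<theta>: "\<theta> \<in> dual" "\<theta> v = 0"
    and \<eta>: "\<eta> \<in> dual" "\<And>x. x \<in> V \<Longrightarrow> \<eta> (g x) = \<theta> x"
  shows "g \<otimes>\<^bsub>GG\<^esub> tv v \<theta> \<otimes>\<^bsub>GG\<^esub> inv\<^bsub>GG\<^esub> g = tv (g v) \<eta>"
proof (rule GL_eqI)
  have t: "tv v \<theta> \<in> GL" "tv (g v) \<eta> \<in> GL" using assms GL_V by (auto intro!: tv_GL)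
  show "g \<otimes>\<^bsub>GG\<^esub> tv v \<theta> \<otimes>\<^bsub>GG\<^esub> inv\<^bsub>GG\<^esub> g \<in> GL" "tv (g v) \<eta> \<in> GL" using t g GL_mult GL_inv by auto
  fix x assume x: "x \<in> V"
  define y where "y = (inv\<^bsub>GG\<^esub> g) x"
  have y: "y \<in> V" "g y = x" using x g GL_V GL_inv GL_inv_apply by (auto simp: y_def)
  have "(g \<otimes>\<^bsub>GG\<^esub> tv v \<theta> \<otimes>\<^bsub>GG\<^esub> inv\<^bsub>GG\<^esub> g) x = (g \<otimes>\<^bsub>GG\<^esub> tv v \<theta>) y"
    unfolding y_def using g t x by (intro GL_mult_apply GL_mult GL_inv)
  also have "\<dots> = g (tv v \<theta> y)" using g t y by (intro GL_mult_apply)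
  also have "\<dots> = x + smul (\<theta> y) (g v)" using g y v by (simp add: tv_apply GL_add[OF g] GL_smul[OF g])
  also have "\<dots> = tv (g v) \<eta> x" using x \<eta>(2)[OF y(1)] y(2) by (simp add: tv_apply)
  finally show "(g \<otimes>\<^bsub>GG\<^esub> tv v \<theta> \<otimes>\<^bsub>GG\<^esub> inv\<^bsub>GG\<^esub> g) x = tv (g v) \<eta> x" .
qed

lemma fixes_supported:
  assumes "finite J" "J \<subseteq> I" "g \<in> GL" "h \<in> GL" "\<And>i. i \<in> J \<Longrightarrow> g (basis_vec i) = h (basis_vec i)" "x \<in> supported J"
  shows "g x = h x"
  using assms(1,2,5,6)
proof (induction J arbitrary: x)
  case empty
  hence "x = 0" by (simp add: supported_def fun_eq_iff)
  thus ?case by (simp only: GL_zero[OF assms(3)] GL_zero[OF assms(4)])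
next
  case (insert i J)
  define y where "y = x + smul (x i) (basis_vec i)"
  have y: "y \<in> supported J"
    using insert.prems by (auto simp: supported_def y_def smul_def basis_vec_def)
  have c: "y \<in> V" "basis_vec i \<in> V" "x = y + smul (x i) (basis_vec i)"
    using y insert.prems supported_mono[of J I] by (auto simp: V_def supported_basis y_def add.assoc)
  have "g y = h y" using insert y by auto
  hence "g (y + smul (x i) (basis_vec i)) = h (y + smul (x i) (basis_vec i))"
    using assms(3,4) c(1,2) insert.prems(2)[of i]
    by (simp add: GL_add[OF assms(3)] GL_add[OF assms(4)] GL_smul[OF assms(3)] GL_smul[OF assms(4)])
  thus ?case by (simp only: c(3)[symmetric])
qed

lemma GL_eq_basis:
  assumes "g \<in> GL" "h \<in> GL" "\<And>i. i \<in> I \<Longrightarrow> g (basis_vec i) = h (basis_vec i)"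
  shows "g = h"
  using fixes_supported[OF finite_I subset_refl assms] assms(1,2) by (intro GL_eqI) (auto simp: V_def)

definition elem :: "'i \<Rightarrow> 'i \<Rightarrow> ('i \<Rightarrow> bit) \<Rightarrow> 'i \<Rightarrow> bit" where
  "elem i j = tv (basis_vec i) (\<lambda>x. x j)"

lemma basis_vec_apply: "basis_vec i j = (if j = i then 1 else 0)" by (simp add: basis_vec_def)

text \<open>Gaussian elimination; \<open>J\<close> is the set of columns that are not yet those of the identity.\<close>

lemma generated_by_elementary:
  assumes M: "subgroup M GG" and el: "\<And>i j. \<lbrakk>i \<in> I; j \<in> I; i \<noteq> j\<rbrakk> \<Longrightarrow> elem i j \<in> M"
  shows "M = GL"
proof
  show "M \<subseteq> GL" using subgroup.subset[OF M] by simp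
  note Mm = subgroup.m_closed[OF M] and Mi = subgroup.m_inv_closed[OF M]
  \<comment> \<open>A transvection along a coordinate is a product of elementary ones with the same
    axis, one for each element of the support of its centre.\<close>
  have col: "tv v (\<lambda>x. x j) \<in> M" if "finite J" "J \<subseteq> I" "j \<in> I" "v \<in> supported J" "v j = 0" for J j v
    using that
  proof (induction J arbitrary: v)
    case empty
    hence "v = 0" by (simp add: supported_def fun_eq_iff)
    hence "tv v (\<lambda>x. x j) = \<one>\<^bsub>GG\<^esub>" by (simp add: tv_def BijGroup_def)
    thus ?case using subgroup.one_closed[OF M] by simp
  next
    case (insert i J)
    define w where "w = v + smul (v i) (basis_vec i)"
    have w: "w \<in> supported J" "w j = 0" "v = w + smul (v i) (basis_vec i)"
      using insert.prems by (auto simp: supported_def w_def smul_def basis_vec_def add.assoc)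
    have wM: "tv w (\<lambda>x. x j) \<in> M" using insert w by auto
    show ?case
    proof (cases "v i = 1")
      case False
      thus ?thesis using wM w(3) by simp
    next
      case 1: True
      hence "i \<noteq> j" using insert.prems by auto
      hence "elem i j \<in> M" "basis_vec i j = 0" using el insert.prems by (auto simp: basis_vec_apply)
      moreover have "w \<in> V" "basis_vec i \<in> V"
        using w insert.prems supported_mono[of J I] by (auto simp: V_def supported_basis)
      ultimately have "tv (w + basis_vec i) (\<lambda>x. x j) \<in> M"
        using Mm[OF wM, of "elem i j"] tv_mult[of w "basis_vec i" "\<lambda>x. x j"] w by (simp add: elem_def)
      thus ?thesis using w(3) 1 by (simp only: smul_simps)
    qed
  qed
  have "g \<in> M" if "finite J" "J \<subseteq> I" "g \<in> GL" "\<And>i. i \<in> I - J \<Longrightarrow> g (basis_vec i) = basis_vec i" for g J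
    using that
  proof (induction J arbitrary: g)
    case empty
    have "g = \<one>\<^bsub>GG\<^esub>"
    proof (rule GL_eq_basis)
      show "g \<in> GL" "\<one>\<^bsub>GG\<^esub> \<in> GL" using empty one_closed by auto
      show "g (basis_vec i) = \<one>\<^bsub>GG\<^esub> (basis_vec i)" if "i \<in> I" for i
        using empty that act_one[of "basis_vec i"] by simp
    qed
    thus ?case using subgroup.one_closed[OF M] by simp
  next
    case (insert k J)
    have k: "k \<in> I" and J: "finite J" "J \<subseteq> I" using insert by auto
    define w where "w = g (basis_vec k)"
    have w: "w \<in> V" using insert k GL_V by (simp add: w_def)
    have fix_basis: "tv v (\<lambda>x. x j) (basis_vec i) = basis_vec i" if "i \<in> I" "i \<noteq> j" for v i j
      using that by (simp add: tv_apply basis_vec_apply)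
    \<comment> \<open>With pivot 1 in row \<open>k\<close>, the transvection with centre
      \<open>g' (basis_vec k) + basis_vec k\<close> along coordinate \<open>k\<close> turns column
      \<open>k\<close> into the basis vector and leaves the finished columns alone.\<close>
    have clear: "g' \<in> M"
      if g': "g' \<in> GL" "\<And>i. i \<in> I - insert k J \<Longrightarrow> g' (basis_vec i) = basis_vec i"
        and one: "g' (basis_vec k) k = 1" for g'
    proof -
      define v where "v = g' (basis_vec k) + basis_vec k"
      have v: "v \<in> V" "v k = 0" using g' k one GL_V by (auto simp: v_def basis_vec_apply)
      define t where "t = tv v (\<lambda>x. x k)"
      have t: "t \<in> M" "t \<in> GL" unfolding t_def
        using col[OF finite_I subset_refl k, of v] v tv_GL by (auto simp: V_def)
      have ap: "(t \<otimes>\<^bsub>GG\<^esub> g') x = t (g' x)" if "x \<in> V" for x using t g' that by (intro GL_mult_apply)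
      have "(t \<otimes>\<^bsub>GG\<^esub> g') (basis_vec i) = basis_vec i" if i: "i \<in> I - J" for i
      proof (cases "i = k")
        case True
        have "g' (basis_vec k) \<in> V" using g' k GL_V by simp
        thus ?thesis using True ap[of "basis_vec k"] k one by (simp add: t_def tv_apply v_def algebra_simps)
      next
        case False
        thus ?thesis using ap[of "basis_vec i"] g'(2)[of i] i fix_basis[of i k v] by (simp add: t_def)
      qed
      moreover have "t \<otimes>\<^bsub>GG\<^esub> g' \<in> GL" using t g' by (intro GL_mult)
      ultimately have "t \<otimes>\<^bsub>GG\<^esub> g' \<in> M" using insert.IH[OF J(2), of "t \<otimes>\<^bsub>GG\<^esub> g'"] by blast
      hence "inv\<^bsub>GG\<^esub> t \<otimes>\<^bsub>GG\<^esub> (t \<otimes>\<^bsub>GG\<^esub> g') \<in> M" using Mm Mi t by blast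
      moreover have "inv\<^bsub>GG\<^esub> t \<otimes>\<^bsub>GG\<^esub> (t \<otimes>\<^bsub>GG\<^esub> g') = g'" using t g' by (intro inv_mult_cancel) auto
      ultimately show ?thesis by (simp only:)
    qed
    show ?case
    proof (cases "w k = 1")
      case True
      thus ?thesis using clear[of g] insert.prems by (simp add: w_def)
    next
      case False
      hence 0: "w k = 0" by simp
      \<comment> \<open>A missing pivot is fetched from another unfinished row. One exists, since
        otherwise \<open>w\<close> would be a combination of basis vectors fixed by
        \<open>g\<close>, so that \<open>g w = w = g (basis_vec k)\<close> and injectivity would
        give \<open>w = basis_vec k\<close>.\<close>
      have "\<exists>j\<in>J. w j = 1"
      proof (rule ccontr)
        assume n: "\<not> (\<exists>j\<in>J. w j = 1)"
        have ws: "w \<in> supported (I - insert k J)"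
          using w n 0 by (auto simp: V_def supported_def)
        have "g w = \<one>\<^bsub>GG\<^esub> w"
        proof (rule fixes_supported[OF _ _ _ _ _ ws])
          show "finite (I - insert k J)" using finite_I by simp
          show "I - insert k J \<subseteq> I" by blast
          show "g \<in> GL" "\<one>\<^bsub>GG\<^esub> \<in> GL" using insert one_closed by auto
          show "g (basis_vec i) = \<one>\<^bsub>GG\<^esub> (basis_vec i)" if "i \<in> I - insert k J" for i
            using insert that act_one[of "basis_vec i"] by simp
        qed
        hence "g w = g (basis_vec k)" using act_one[OF w] by (simp add: w_def)
        hence "w = basis_vec k" using GL_inj insert.prems(2) w k by simp
        thus False using 0 by (simp add: basis_vec_apply)
      qed
      then obtain j where j: "j \<in> J" "w j = 1" by blast
      have jk: "j \<noteq> k" "j \<in> I" using j J insert.hyps by auto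
      define t where "t = elem k j"
      have t: "t \<in> M" "t \<in> GL" using el[OF k jk(2)] jk subgroup.mem_carrier[OF M] by (auto simp: t_def)
      have ap: "(t \<otimes>\<^bsub>GG\<^esub> g) x = t (g x)" if "x \<in> V" for x using t insert.prems(2) that by (intro GL_mult_apply)
      have "t \<otimes>\<^bsub>GG\<^esub> g \<in> M"
      proof (rule clear)
        show "t \<otimes>\<^bsub>GG\<^esub> g \<in> GL" using t insert.prems by (intro GL_mult)
        show "(t \<otimes>\<^bsub>GG\<^esub> g) (basis_vec i) = basis_vec i" if "i \<in> I - insert k J" for i
          using ap[of "basis_vec i"] insert.prems(3)[OF that] that j fix_basis[of i j "basis_vec k"]
          by (auto simp: t_def elem_def)
        show "(t \<otimes>\<^bsub>GG\<^esub> g) (basis_vec k) k = 1"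
          using ap[of "basis_vec k"] k w j 0 by (simp add: t_def elem_def tv_apply basis_vec_apply flip: w_def)
      qed
      hence "inv\<^bsub>GG\<^esub> t \<otimes>\<^bsub>GG\<^esub> (t \<otimes>\<^bsub>GG\<^esub> g) \<in> M" using Mm Mi t by blast
      moreover have "inv\<^bsub>GG\<^esub> t \<otimes>\<^bsub>GG\<^esub> (t \<otimes>\<^bsub>GG\<^esub> g) = g" using t insert.prems by (intro inv_mult_cancel) auto
      ultimately show ?thesis by (simp only:)
    qed
  qed
  from this[OF finite_I subset_refl] show "GL \<subseteq> M" by blast
qed

end

section \<open>Simplicity of GL(n, 2) for n at least 4\<close>

lemma bit_cancel [simp]: "(a::bit) + (a + b) = b"
  by (cases a; cases b) simp_all

lemma (in group) commutator_assoc: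
  "\<lbrakk>x \<in> carrier G; y \<in> carrier G\<rbrakk> \<Longrightarrow>
    x \<otimes> (y \<otimes> inv x \<otimes> inv y) = x \<otimes> y \<otimes> inv x \<otimes> inv y"
  by (simp add: m_assoc)

context gl2
begin

text \<open>Each functional at most halves the number of vectors, so at least four of at least
  sixteen remain, enough to avoid two given vectors with \<open>ex_third\<close>.\<close>

lemma common_kernel:
  assumes "card I \<ge> 4" "\<theta> \<in> dual" "\<eta> \<in> dual"
  shows "card {x \<in> V. \<theta> x = 0 \<and> \<eta> x = 0} \<ge> 3"
proof -
  let ?S = "{x \<in> V. \<theta> x = 0}"
  have "(2::nat) ^ 4 \<le> 2 ^ card I" using assms(1) by (intro power_increasing) auto
  hence "16 \<le> card V" using card_supported[OF finite_I] by (simp add: V_def)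
  also have "card V \<le> 2 * card ?S"
    using finite_V assms by (intro card_kernel_ge) (auto simp: dual_add)
  finally have "8 \<le> card ?S" by simp
  also have "card ?S \<le> 2 * card {x \<in> ?S. \<eta> x = 0}"
    using finite_V assms by (intro card_kernel_ge) (auto simp: dual_add)
  also have "{x \<in> ?S. \<eta> x = 0} = {x \<in> V. \<theta> x = 0 \<and> \<eta> x = 0}" by auto
  finally show ?thesis by simp
qed

lemma tv_conj_normal:
  assumes "N \<lhd> GG" "tv v \<theta> \<in> N" "g \<in> GL" "v \<in> V" "\<theta> \<in> dual" "\<theta> v = 0"
    and "\<eta> \<in> dual" "\<And>x. x \<in> V \<Longrightarrow> \<eta> (g x) = \<theta> x"
  shows "tv (g v) \<eta> \<in> N"
proof -
  have "g \<otimes>\<^bsub>GG\<^esub> tv v \<theta> \<otimes>\<^bsub>GG\<^esub> inv\<^bsub>GG\<^esub> g \<in> N"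
    using assms(1-3) unfolding normal_inv_iff by simp
  thus ?thesis by (simp only: tv_conj[OF assms(3-8)])
qed

text \<open>The transvection with centre \<open>u + p\<close> along a functional that is 1 on both
  vectors sends \<open>u\<close> to \<open>p\<close>. It preserves \<open>\<theta>\<close> because
  \<open>\<theta>\<close> vanishes on its centre.\<close>

lemma tv_move_center:
  assumes N: "N \<lhd> GG" and t: "tv u \<theta> \<in> N" and \<theta>: "\<theta> \<in> dual" "\<theta> u = 0" "\<theta> p = 0"
    and up: "u \<in> V" "u \<noteq> 0" "p \<in> V" "p \<noteq> 0"
  shows "tv p \<theta> \<in> N"
proof -
  obtain \<eta> where "\<eta> \<in> functionals_on I" and \<eta>: "\<eta> u = 1" "\<eta> p = 1"
    using common_functional[of u I p] up by (auto simp: V_def)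
  hence d: "\<eta> \<in> dual" by (intro dualI)
  define s where "s = tv (u + p) \<eta>"
  have s: "s \<in> GL" unfolding s_def using up d \<eta> by (intro tv_GL) (auto simp: dual_add)
  have "\<theta> (s x) = \<theta> x" if x: "x \<in> V" for x
    using x up \<theta> d by (simp add: s_def tv_apply dual_add[OF \<theta>(1)] dual_smul[OF \<theta>(1)])
  hence "tv (s u) \<theta> \<in> N" using tv_conj_normal[OF N t s up(1) \<theta>(1,2) \<theta>(1)] by blast
  moreover have "s u = p" using up \<eta> by (simp add: s_def tv_apply)
  ultimately show ?thesis by simp
qed

text \<open>Choose \<open>q\<close> with \<open>\<theta> q = \<eta> q = 1\<close>: one of
  \<open>a\<close>, \<open>b\<close>, \<open>a + b\<close> qualifies. The transvection with centre
  \<open>q\<close> along \<open>\<theta> + \<eta>\<close> fixes \<open>p\<close> and carries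
  \<open>\<theta>\<close> to \<open>\<eta>\<close>.\<close>

lemma tv_move_axis:
  assumes N: "N \<lhd> GG" and t: "tv p \<theta> \<in> N" and p: "p \<in> V"
    and \<theta>: "\<theta> \<in> dual" "\<theta> p = 0" "a \<in> V" "\<theta> a = 1"
    and \<eta>: "\<eta> \<in> dual" "\<eta> p = 0" "b \<in> V" "\<eta> b = 1"
  shows "tv p \<eta> \<in> N"
proof -
  have "\<exists>q\<in>V. \<theta> q = 1 \<and> \<eta> q = 1"
  proof (cases "\<eta> a = 1 \<or> \<theta> b = 1")
    case True
    thus ?thesis using \<theta> \<eta> by blast
  next
    case False
    hence "\<theta> (a + b) = 1" "\<eta> (a + b) = 1" using \<theta> \<eta> by (auto simp: dual_add)
    thus ?thesis using \<theta> \<eta> by (intro bexI[of _ "a + b"]) auto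
  qed
  then obtain q where q: "q \<in> V" "\<theta> q = 1" "\<eta> q = 1" by blast
  define s where "s = tv q (\<lambda>x. \<theta> x + \<eta> x)"
  have s: "s \<in> GL" unfolding s_def using q \<theta> \<eta> by (intro tv_GL dual_sum) auto
  have "\<eta> (s x) = \<theta> x" if x: "x \<in> V" for x
    using x q \<theta>(1) \<eta>(1) by (simp add: s_def tv_apply dual_add[OF \<eta>(1)] dual_smul[OF \<eta>(1)] add_ac)
  hence "tv (s p) \<eta> \<in> N" using tv_conj_normal[OF N t s p \<theta>(1,2) \<eta>(1)] by blast
  moreover have "s p = p" using p \<theta> \<eta> by (simp add: s_def tv_apply)
  ultimately show ?thesis by simp
qed

text \<open>Moving the axis requires a centre on which both functionals vanish. So the centre first
  goes to a nonzero \<open>p\<close> in the common kernel, then the axis is changed, and then the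
  centre goes to the basis vector.\<close>

lemma normal_with_transvection:
  assumes I4: "card I \<ge> 4" and N: "N \<lhd> GG" and t: "tv u \<theta> \<in> N"
    and u: "u \<in> V" "u \<noteq> 0" and \<theta>: "\<theta> \<in> dual" "\<theta> u = 0" "a \<in> V" "\<theta> a = 1"
  shows "N = GL"
proof (rule generated_by_elementary)
  show "subgroup N GG" using N by (rule normal_imp_subgroup)
  fix i j assume ij: "i \<in> I" "j \<in> I" "i \<noteq> j"
  let ?e = "basis_vec i" and ?\<phi> = "\<lambda>x :: 'i \<Rightarrow> bit. x j"
  have e: "?e \<in> V" "?e \<noteq> 0" "?\<phi> ?e = 0" "basis_vec j \<in> V" "?\<phi> (basis_vec j) = 1"
    using ij by (auto simp: basis_vec_apply fun_eq_iff)
  obtain p where p: "p \<in> V" "\<theta> p = 0" "?\<phi> p = 0" "p \<noteq> 0"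
    using ex_third[OF common_kernel[OF I4 \<theta>(1) coord_dual[of j]], of 0] by auto
  have "tv p \<theta> \<in> N" using tv_move_center[OF N t \<theta>(1,2) p(2) u p(1,4)] .
  hence "tv p ?\<phi> \<in> N" using tv_move_axis[OF N _ p(1) \<theta>(1) p(2) \<theta>(3,4) coord_dual p(3) e(4,5)] by blast
  hence "tv ?e ?\<phi> \<in> N" using tv_move_center[OF N _ coord_dual p(3) e(3) p(1,4) e(1,2)] by blast
  thus "elem i j \<in> N" by (simp add: elem_def)
qed

text \<open>Two commutators produce a transvection. The commutator \<open>h\<close> of
  \<open>g\<close> with a transvection is a product of two transvections and so fixes the common
  kernel of their axes. The commutator of \<open>h\<close> with a transvection whose centre
  \<open>u\<close> is in that kernel is a product of two with the same centre, that is, again a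
  transvection.\<close>

lemma GL_normal_subgroups:
  assumes I4: "card I \<ge> 4" and N: "N \<lhd> GG" and ne: "N \<noteq> {\<one>\<^bsub>GG\<^esub>}"
  shows "N = GL"
proof -
  have Ns: "subgroup N GG" using N by (rule normal_imp_subgroup)
  have NGL: "g \<in> GL" if "g \<in> N" for g using subgroup.mem_carrier[OF Ns that] by simp
  have Ncj: "g \<otimes>\<^bsub>GG\<^esub> h \<otimes>\<^bsub>GG\<^esub> inv\<^bsub>GG\<^esub> g \<in> N" if "g \<in> GL" "h \<in> N" for g h
    using N that unfolding normal_inv_iff by simp
  obtain g where g: "g \<in> N" "g \<noteq> \<one>\<^bsub>GG\<^esub>" using ne subgroup.one_closed[OF Ns] by blast
  have gG: "g \<in> GL" using g NGL by blast
  obtain v where v: "v \<in> V" "g v \<noteq> v"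
    using GL_eqI[OF gG, of "\<one>\<^bsub>GG\<^esub>"] g(2) act_one one_closed by auto
  have v0: "v \<noteq> 0" using v(2) GL_zero[OF gG] by blast
  have gv: "g v \<in> V" using gG v GL_V by blast
  have "16 \<le> card V"
    using power_increasing[OF I4, of "2::nat"] card_supported[OF finite_I] by (simp add: V_def)
  \<comment> \<open>Avoiding both 0 and \<open>v\<close> lets a functional vanish on
    \<open>v\<close> but not on \<open>z\<close>, so that the transvection along it is
    nontrivial.\<close>
  then obtain z where z: "z \<in> V" "z \<noteq> 0" "z \<noteq> v" using ex_third[of V 0 v] by auto
  obtain \<phi> where "\<phi> \<in> functionals_on I" and \<phi>: "\<phi> v = 0" "\<phi> z = 1"
    using separating_functional[of v I z] z v by (auto simp: V_def)
  hence \<phi>d: "\<phi> \<in> dual" by (intro dualI)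
  define \<phi>' where "\<phi>' = (\<lambda>x. \<phi> ((inv\<^bsub>GG\<^esub> g) x))"
  have \<phi>'d: "\<phi>' \<in> dual" unfolding \<phi>'_def by (rule dual_comp[OF \<phi>d GL_inv[OF gG]])
  have \<phi>'g: "\<phi>' (g x) = \<phi> x" if "x \<in> V" for x using that gG GL_inv_apply(1) by (simp add: \<phi>'_def)
  let ?t = "tv v \<phi>" and ?t' = "tv (g v) \<phi>'"
  have tG: "?t \<in> GL" "?t' \<in> GL" using v gv \<phi> \<phi>d \<phi>'d \<phi>'g by (auto intro!: tv_GL)
  define h where "h = ?t' \<otimes>\<^bsub>GG\<^esub> inv\<^bsub>GG\<^esub> ?t"
  have hN: "h \<in> N"
  proof -
    have "g \<otimes>\<^bsub>GG\<^esub> (?t \<otimes>\<^bsub>GG\<^esub> inv\<^bsub>GG\<^esub> g \<otimes>\<^bsub>GG\<^esub> inv\<^bsub>GG\<^esub> ?t) \<in> N"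
      using g(1) Ncj[OF tG(1) subgroup.m_inv_closed[OF Ns g(1)]] by (rule subgroup.m_closed[OF Ns])
    moreover have "g \<otimes>\<^bsub>GG\<^esub> (?t \<otimes>\<^bsub>GG\<^esub> inv\<^bsub>GG\<^esub> g \<otimes>\<^bsub>GG\<^esub> inv\<^bsub>GG\<^esub> ?t) =
        g \<otimes>\<^bsub>GG\<^esub> ?t \<otimes>\<^bsub>GG\<^esub> inv\<^bsub>GG\<^esub> g \<otimes>\<^bsub>GG\<^esub> inv\<^bsub>GG\<^esub> ?t"
      by (rule commutator_assoc) (use gG tG in simp_all)
    moreover have "g \<otimes>\<^bsub>GG\<^esub> ?t \<otimes>\<^bsub>GG\<^esub> inv\<^bsub>GG\<^esub> g = ?t'"
      using gG v(1) \<phi>d \<phi>(1) \<phi>'d \<phi>'g by (rule tv_conj)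
    ultimately show ?thesis by (simp only: h_def)
  qed
  have hG: "h \<in> GL" using hN NGL by blast
  have tinv: "inv\<^bsub>GG\<^esub> ?t = ?t"
  proof (rule inv_equality)
    show "?t \<otimes>\<^bsub>GG\<^esub> ?t = \<one>\<^bsub>GG\<^esub>"
      using tv_mult[OF v(1) v(1) \<phi>d \<phi>(1) \<phi>(1)] by (simp add: tv_def BijGroup_def)
  qed (use tG in auto)
  have hap: "h x = ?t' (?t x)" if "x \<in> V" for x
    unfolding h_def tinv using tG that by (intro GL_mult_apply)
  \<comment> \<open>If \<open>h\<close> fixed \<open>z\<close>, then \<open>v\<close> would be a
    multiple of \<open>g v\<close>, that is \<open>g v\<close> or 0; both are excluded by the choice
    of \<open>v\<close>.\<close>
  have "\<exists>x\<in>V. h x \<noteq> x"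
  proof (rule ccontr)
    assume "\<not> ?thesis"
    hence "?t' (?t z) = z" using hap z by simp
    moreover have "?t z = z + v" using z \<phi> by (simp add: tv_apply)
    ultimately have "z + v + smul (\<phi>' (z + v)) (g v) = z" using z v by (simp add: tv_apply)
    hence "z + (z + v + smul (\<phi>' (z + v)) (g v)) = z + z" by (simp only:)
    hence "v + smul (\<phi>' (z + v)) (g v) = 0" by (simp only: add.assoc vec_cancel vec_add_self)
    hence e: "v = smul (\<phi>' (z + v)) (g v)" by (rule iffD2[OF vec_eq_iff])
    show False
    proof (cases "\<phi>' (z + v) = 1")
      case True
      thus False using e v(2) by (metis smul_simps(2))
    next
      case False
      hence "\<phi>' (z + v) = 0" by simp
      thus False using e v0 by (metis smul_simps(1))
    qed
  qed
  then obtain x where x: "x \<in> V" "h x \<noteq> x" by blast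
  define y where "y = x + h x"
  have y: "y \<in> V" "y \<noteq> 0" using x GL_V[OF hG] by (auto simp: y_def simp flip: vec_eq_iff)
  \<comment> \<open>Avoiding \<open>y\<close> allows \<open>\<theta>\<close> to be 0 at
    \<open>u\<close> and 1 at \<open>y = x + h x\<close>; the latter makes the axis
    \<open>\<theta>' + \<theta>\<close> of the second commutator nonzero at
    \<open>h x\<close>.\<close>
  obtain u where u: "u \<in> V" "\<phi> u = 0" "\<phi>' u = 0" "u \<noteq> 0" "u \<noteq> y"
    using ex_third[OF common_kernel[OF I4 \<phi>d \<phi>'d], of 0 y] by auto
  have hu: "h u = u" using hap[OF u(1)] u by (simp add: tv_apply)
  obtain \<theta> where "\<theta> \<in> functionals_on I" and \<theta>: "\<theta> u = 0" "\<theta> y = 1"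
    using separating_functional[of u I y] u y by (auto simp: V_def)
  hence \<theta>d: "\<theta> \<in> dual" by (intro dualI)
  define \<theta>' where "\<theta>' = (\<lambda>x. \<theta> ((inv\<^bsub>GG\<^esub> h) x))"
  have \<theta>'d: "\<theta>' \<in> dual" unfolding \<theta>'_def by (rule dual_comp[OF \<theta>d GL_inv[OF hG]])
  have \<theta>'h: "\<theta>' (h x) = \<theta> x" if "x \<in> V" for x using that hG GL_inv_apply(1) by (simp add: \<theta>'_def)
  have \<theta>'u: "\<theta>' u = 0" using \<theta>'h[OF u(1)] hu \<theta> by simp
  let ?s = "tv u \<theta>" and ?s' = "tv u \<theta>'"
  have sG: "?s \<in> GL" "?s' \<in> GL" using u \<theta> \<theta>d \<theta>'d \<theta>'u by (auto intro!: tv_GL)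
  have sinv: "inv\<^bsub>GG\<^esub> ?s = ?s"
  proof (rule inv_equality)
    show "?s \<otimes>\<^bsub>GG\<^esub> ?s = \<one>\<^bsub>GG\<^esub>"
      using tv_mult[OF u(1) u(1) \<theta>d \<theta>(1) \<theta>(1)] by (simp add: tv_def BijGroup_def)
  qed (use sG in auto)
  have "tv u (\<lambda>x. \<theta>' x + \<theta> x) \<in> N"
  proof -
    have "h \<otimes>\<^bsub>GG\<^esub> (?s \<otimes>\<^bsub>GG\<^esub> inv\<^bsub>GG\<^esub> h \<otimes>\<^bsub>GG\<^esub> inv\<^bsub>GG\<^esub> ?s) \<in> N"
      using hN Ncj[OF sG(1) subgroup.m_inv_closed[OF Ns hN]] by (rule subgroup.m_closed[OF Ns])
    moreover have "h \<otimes>\<^bsub>GG\<^esub> (?s \<otimes>\<^bsub>GG\<^esub> inv\<^bsub>GG\<^esub> h \<otimes>\<^bsub>GG\<^esub> inv\<^bsub>GG\<^esub> ?s) =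
        h \<otimes>\<^bsub>GG\<^esub> ?s \<otimes>\<^bsub>GG\<^esub> inv\<^bsub>GG\<^esub> h \<otimes>\<^bsub>GG\<^esub> inv\<^bsub>GG\<^esub> ?s"
      by (rule commutator_assoc) (use hG sG in simp_all)
    moreover have "h \<otimes>\<^bsub>GG\<^esub> ?s \<otimes>\<^bsub>GG\<^esub> inv\<^bsub>GG\<^esub> h = tv (h u) \<theta>'"
      using hG u(1) \<theta>d \<theta>(1) \<theta>'d \<theta>'h by (rule tv_conj)
    moreover have "?s' \<otimes>\<^bsub>GG\<^esub> ?s = tv u (\<lambda>x. \<theta>' x + \<theta> x)"
      using u(1) \<theta>'d \<theta>d \<theta>'u \<theta>(1) by (rule tv_mult_dual)
    ultimately show ?thesis by (simp only: hu sinv)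
  qed
  moreover have "\<theta>' u + \<theta> u = 0" using \<theta>'u \<theta> by simp
  moreover have "\<theta>' (h x) + \<theta> (h x) = 1"
  proof -
    have "\<theta> y = \<theta> x + \<theta> (h x)" using dual_add[OF \<theta>d x(1) GL_V[OF hG x(1)]] by (simp add: y_def)
    thus ?thesis using \<theta>'h[OF x(1)] \<theta> by simp
  qed
  ultimately show ?thesis
    using normal_with_transvection[OF I4 N _ u(1,4) dual_sum[OF \<theta>'d \<theta>d] _ GL_V[OF hG x(1)]] by blast
qed

lemma GL_nonabelian_simple:
  assumes I4: "card I \<ge> 4" shows "nonabelian_simple GG"
proof -
  have "I \<noteq> {}" using I4 by auto
  then obtain i where i: "i \<in> I" by blast
  have I3: "card I \<ge> 3" using I4 by simp
  obtain j where j: "j \<in> I" "j \<noteq> i" using ex_third[OF I3, of i i] by blast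
  obtain k where k: "k \<in> I" "k \<noteq> i" "k \<noteq> j" using ex_third[OF I3, of i j] by blast
  have el: "elem a b \<in> GL" if "a \<in> I" "b \<in> I" "a \<noteq> b" for a b
    unfolding elem_def using that by (intro tv_GL) (auto simp: basis_vec_apply)
  let ?a = "elem i j" and ?b = "elem k i"
  have G: "?a \<in> GL" "?b \<in> GL" using el i j k by auto
  have ab: "?a \<otimes>\<^bsub>GG\<^esub> ?b \<noteq> ?b \<otimes>\<^bsub>GG\<^esub> ?a"
  proof
    assume "?a \<otimes>\<^bsub>GG\<^esub> ?b = ?b \<otimes>\<^bsub>GG\<^esub> ?a"
    hence "?a (?b (basis_vec j)) k = ?b (?a (basis_vec j)) k"
      using GL_mult_apply[OF G, of "basis_vec j"] GL_mult_apply[OF G(2,1), of "basis_vec j"] j by simp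
    thus False using i j k by (simp add: elem_def tv_apply basis_vec_apply)
  qed
  have "\<not> comm_group GG"
  proof
    assume "comm_group GG"
    then interpret c: comm_group GG .
    show False using ab c.m_comm[of ?a ?b] G by simp
  qed
  moreover have "simple_group GG"
  proof
    have "card {?a, \<one>\<^bsub>GG\<^esub>} \<le> card GL" using G one_closed finite_G by (intro card_mono) auto
    moreover have "?a \<noteq> \<one>\<^bsub>GG\<^esub>"
    proof
      assume e: "?a = \<one>\<^bsub>GG\<^esub>"
      have "?a \<otimes>\<^bsub>GG\<^esub> ?b = ?b \<otimes>\<^bsub>GG\<^esub> ?a" unfolding e using l_one[of ?b] r_one[of ?b] G by simp
      thus False using ab by blast
    qed
    ultimately show "order GG > 1" by (simp add: order_def)
    show "N = carrier GG \<or> N = {\<one>\<^bsub>GG\<^esub>}" if "N \<lhd> GG" for N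
      using GL_normal_subgroups[OF I4 that] by auto
  qed
  ultimately show ?thesis by (simp add: nonabelian_simple_def)
qed

end

section \<open>Stabilizers of block decompositions\<close>

lemma smul_apply: "smul b v i = b * v i" by (simp add: smul_def)

lemma basis_vec_nonzero: "basis_vec i \<noteq> 0"
  by (metis basis_vec_def zero_fun_apply zero_neq_one)

context gl2
begin

lemma dual_nonzero_basis:
  assumes \<theta>: "\<theta> \<in> dual" and z: "z \<in> V" "\<theta> z = 1"
  shows "\<exists>q\<in>I. \<theta> (basis_vec q) = 1"
proof (rule ccontr)
  assume n: "\<not> ?thesis"
  have "\<theta> x = 0" if "finite J" "J \<subseteq> I" "x \<in> supported J" for J x
    using that
  proof (induction J arbitrary: x)
    case empty
    hence "x = 0" by (simp add: supported_def fun_eq_iff)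
    thus ?case using dual_zero[OF \<theta>] by (simp only:)
  next
    case (insert i J)
    define y where "y = x + smul (x i) (basis_vec i)"
    have y: "y \<in> supported J"
      using insert.prems by (auto simp: supported_def y_def smul_def basis_vec_def)
    have c: "y \<in> V" "basis_vec i \<in> V" "x = y + smul (x i) (basis_vec i)"
      using y insert.prems supported_mono[of J I] by (auto simp: V_def supported_basis y_def add.assoc)
    have "\<theta> (basis_vec i) \<noteq> 1" using n insert.prems by blast
    hence "\<theta> (y + smul (x i) (basis_vec i)) = 0"
      using insert y c(1,2) by (simp add: dual_add[OF \<theta>] dual_smul[OF \<theta>])
    thus ?case by (simp only: c(3)[symmetric])
  qed
  from this[OF finite_I subset_refl, of z] show False using z by (simp add: V_def)
qed

lemma tv_conj_subgroup:
  assumes M: "subgroup M GG" and "tv v \<theta> \<in> M" "g \<in> M" "v \<in> V" "\<theta> \<in> dual" "\<theta> v = 0"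
    and "\<eta> \<in> dual" "\<And>x. x \<in> V \<Longrightarrow> \<eta> (g x) = \<theta> x"
  shows "tv (g v) \<eta> \<in> M"
proof -
  have g: "g \<in> GL" using subgroup.mem_carrier[OF M assms(3)] by simp
  have "g \<otimes>\<^bsub>GG\<^esub> tv v \<theta> \<otimes>\<^bsub>GG\<^esub> inv\<^bsub>GG\<^esub> g \<in> M"
    by (rule subgroup.m_closed[OF M subgroup.m_closed[OF M assms(3,2)] subgroup.m_inv_closed[OF M assms(3)]])
  thus ?thesis by (simp only: tv_conj[OF g assms(4-8)])
qed

end

section \<open>The stabilizer of a block decomposition and its maximality\<close>

locale block_gl2 = gl2 "{..<B} \<times> {..<a}" for B a :: nat +
  assumes B2: "B \<ge> 2" and a4: "a \<ge> 4"
begin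

abbreviation "I \<equiv> {..<B} \<times> {..<a}"

definition blk :: "nat \<Rightarrow> (nat \<times> nat) set" where "blk b = {b} \<times> {..<a}"

definition U :: "(nat \<times> nat \<Rightarrow> bit) set" where "U = (\<Union>b<B. supported (blk b))"

text \<open>Only the union of the blocks is asked to be preserved. A sum of nonzero vectors from two
  different blocks is outside \<open>U\<close>, so a linear map preserving \<open>U\<close> maps
  blocks to blocks, and this is the stabilizer of the decomposition.\<close>

definition H :: "((nat \<times> nat \<Rightarrow> bit) \<Rightarrow> nat \<times> nat \<Rightarrow> bit) set" where "H = {g \<in> GL. g ` U = U}"

lemma blk_I: "b < B \<Longrightarrow> blk b \<subseteq> I" by (auto simp: blk_def)
lemma I_blk: "p \<in> I \<Longrightarrow> p \<in> blk (fst p) \<and> fst p < B" by (cases p) (auto simp: blk_def)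
lemma blk_fst: "p \<in> blk b \<Longrightarrow> fst p = b" by (auto simp: blk_def)
lemma blk_V: "b < B \<Longrightarrow> x \<in> supported (blk b) \<Longrightarrow> x \<in> V"
  using supported_mono[OF blk_I] by (auto simp: V_def)
lemma U_V: "U \<subseteq> V" using blk_V by (auto simp: U_def)
lemma finite_U: "finite U" using U_V finite_V by (rule finite_subset)
lemma UI: "\<lbrakk>b < B; x \<in> supported (blk b)\<rbrakk> \<Longrightarrow> x \<in> U" by (auto simp: U_def)
lemma UE: "x \<in> U \<Longrightarrow> \<exists>b<B. x \<in> supported (blk b)" by (auto simp: U_def)

lemma card_blk: "card (supported (blk b)) \<ge> 16"
proof -
  have "(2::nat) ^ 4 \<le> 2 ^ a" using a4 by (intro power_increasing) auto
  thus ?thesis by (simp add: card_supported blk_def card_cartesian_product)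
qed

lemma HI:
  assumes g: "g \<in> GL" "\<And>x. x \<in> U \<Longrightarrow> g x \<in> U" shows "g \<in> H"
proof -
  have "inj_on g U" using GL_inj[OF g(1)] U_V by (intro inj_onI) blast
  moreover have "g ` U \<subseteq> U" using g(2) by blast
  ultimately have "g ` U = U" using finite_U by (intro endo_inj_surj)
  thus ?thesis using g by (simp add: H_def)
qed

lemma H_subgroup: "subgroup H GG"
proof (rule subgroupI)
  show "H \<subseteq> carrier GG" by (auto simp: H_def)
  have "\<one>\<^bsub>GG\<^esub> \<in> H"
  proof (rule HI)
    show "\<one>\<^bsub>GG\<^esub> \<in> GL" using one_closed by simp
    show "\<one>\<^bsub>GG\<^esub> x \<in> U" if "x \<in> U" for x using act_one[of x] that U_V by auto
  qed
  thus "H \<noteq> {}" by blast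
  fix g assume g: "g \<in> H"
  hence gG: "g \<in> GL" "g ` U = U" by (auto simp: H_def)
  show "inv\<^bsub>GG\<^esub> g \<in> H"
  proof (rule HI[OF GL_inv[OF gG(1)]])
    fix x assume "x \<in> U"
    then obtain y where "y \<in> U" "x = g y" using gG(2) by blast
    thus "(inv\<^bsub>GG\<^esub> g) x \<in> U" using GL_inv_apply(1)[OF gG(1), of y] U_V by auto
  qed
  fix h assume h: "h \<in> H"
  hence hG: "h \<in> GL" "h ` U = U" by (auto simp: H_def)
  show "g \<otimes>\<^bsub>GG\<^esub> h \<in> H"
  proof (rule HI[OF GL_mult[OF gG(1) hG(1)]])
    fix x assume x: "x \<in> U"
    have "(g \<otimes>\<^bsub>GG\<^esub> h) x = g (h x)" using gG hG x U_V by (intro GL_mult_apply) auto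
    thus "(g \<otimes>\<^bsub>GG\<^esub> h) x \<in> U" using gG hG x by auto
  qed
qed

lemma tv_H:
  assumes b: "b < B" and d: "d \<in> supported (blk b)" and \<eta>: "\<eta> \<in> functionals_on (blk b)" "\<eta> d = 0"
  shows "tv d \<eta> \<in> H"
proof (rule HI)
  show "tv d \<eta> \<in> GL" using blk_V[OF b d] dualI[OF \<eta>(1)] \<eta>(2) by (rule tv_GL)
  fix x assume x: "x \<in> U"
  then obtain b' where b': "b' < B" "x \<in> supported (blk b')" using UE by blast
  have xV: "x \<in> V" using x U_V by blast
  show "tv d \<eta> x \<in> U"
  proof (cases "b' = b")
    case True
    hence "x + smul (\<eta> x) d \<in> supported (blk b)" using b' d by (intro supported_add supported_smul) auto
    thus ?thesis using xV UI[OF b] by (simp add: tv_apply)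
  next
    case False
    hence "\<forall>i\<in>blk b. x i = 0" using b'(2) by (auto simp: supported_def blk_def)
    hence "\<eta> x = 0" using \<eta>(1) by (simp add: functionals_on_def)
    thus ?thesis using xV x by (simp add: tv_apply)
  qed
qed

text \<open>Conjugation by the element \<open>elem q r\<close> of \<open>H\<close>, whose centre and
  axis are in block \<open>j\<close>, changes the axis from \<open>\<psi>\<close> to
  \<open>\<psi>\<close> plus the coordinate \<open>r\<close> and fixes the centre. The product of
  the two transvections leaves only the coordinate.\<close>

lemma change_axis:
  assumes M: "subgroup M GG" "H \<subseteq> M" and t: "tv d \<psi> \<in> M"
    and d: "i < B" "d \<in> supported (blk i)" and \<psi>: "\<psi> \<in> dual" "\<psi> d = 0" "\<psi> (basis_vec q) = 1"
    and qr: "j < B" "j \<noteq> i" "q \<in> blk j" "r \<in> blk j" "r \<noteq> q"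
  shows "tv d (\<lambda>x. x r) \<in> M"
proof -
  have qI: "q \<in> I" using qr blk_I by blast
  have dV: "d \<in> V" using d blk_V by blast
  have dr: "d r = 0" using d(2) qr by (auto simp: supported_def blk_def)
  define s where "s = tv (basis_vec q) (\<lambda>x. x r)"
  have sH: "s \<in> H" unfolding s_def
    using qr by (intro tv_H[of j] supported_basis coordinate_functional) (auto simp: basis_vec_apply)
  have \<eta>: "(\<lambda>x. \<psi> x + x r) \<in> dual" using dual_sum[OF \<psi>(1) coord_dual] .
  have "(\<lambda>x. \<psi> x + x r) (s x) = \<psi> x" if x: "x \<in> V" for x
    using x qI \<psi> qr by (simp add: s_def tv_apply dual_add[OF \<psi>(1)] dual_smul[OF \<psi>(1)] smul_apply basis_vec_apply add_ac)
  hence "tv (s d) (\<lambda>x. \<psi> x + x r) \<in> M"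
    using M(2) sH by (intro tv_conj_subgroup[OF M(1) t _ dV \<psi>(1,2) \<eta>]) auto
  moreover have "s d = d" using dV dr by (simp add: s_def tv_apply)
  ultimately have t': "tv d (\<lambda>x. \<psi> x + x r) \<in> M" by simp
  have "tv d \<psi> \<otimes>\<^bsub>GG\<^esub> tv d (\<lambda>x. \<psi> x + x r) = tv d (\<lambda>x. \<psi> x + (\<psi> x + x r))"
    using dV \<psi> \<eta> dr by (intro tv_mult_dual) auto
  moreover have "tv d \<psi> \<otimes>\<^bsub>GG\<^esub> tv d (\<lambda>x. \<psi> x + x r) \<in> M" using t t' by (rule subgroup.m_closed[OF M(1)])
  ultimately show ?thesis by (simp only: bit_cancel)
qed

definition swap_ix :: "nat \<Rightarrow> nat \<Rightarrow> nat \<times> nat \<Rightarrow> nat \<times> nat" where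
  "swap_ix b b' p = (Transposition.transpose b b' (fst p), snd p)"

lemma swap_ix_I: "\<lbrakk>b < B; b' < B\<rbrakk> \<Longrightarrow> swap_ix b b' p \<in> I \<longleftrightarrow> p \<in> I"
  by (cases p) (auto simp: swap_ix_def Transposition.transpose_def)
lemma swap_ix_invol [simp]: "swap_ix b b' (swap_ix b b' p) = p"
  by (simp add: swap_ix_def)
lemma swap_ix_blk: "swap_ix b b' p \<in> blk k \<longleftrightarrow> p \<in> blk (Transposition.transpose b b' k)"
  by (cases p) (auto simp: swap_ix_def blk_def)

definition sw :: "nat \<Rightarrow> nat \<Rightarrow> (nat \<times> nat \<Rightarrow> bit) \<Rightarrow> nat \<times> nat \<Rightarrow> bit" where
  "sw b b' = (\<lambda>x\<in>V. \<lambda>p. x (swap_ix b b' p))"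

lemma sw_H:
  assumes b: "b < B" "b' < B" shows "sw b b' \<in> H"
proof (rule HI)
  have cl: "(\<lambda>p. x (swap_ix b b' p)) \<in> V" if "x \<in> V" for x
    using that swap_ix_I[OF b] unfolding V_def supported_def mem_Collect_eq by blast
  have "bij_betw (sw b b') V V"
    by (rule bij_betw_byWitness[of _ "sw b b'"]) (auto simp: sw_def cl)
  thus "sw b b' \<in> GL" by (auto simp: GL_def Bij_def sw_def fun_eq_iff)
  fix x assume x: "x \<in> U"
  then obtain k where k: "k < B" "x \<in> supported (blk k)" using UE by blast
  have "(\<lambda>p. x (swap_ix b b' p)) \<in> supported (blk (Transposition.transpose b b' k))"
    using k(2) swap_ix_blk[of b b' _ k] unfolding supported_def mem_Collect_eq by blast
  moreover have "Transposition.transpose b b' k < B" using k b by (simp add: Transposition.transpose_def)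
  ultimately show "sw b b' x \<in> U" using x U_V by (auto simp: sw_def intro: UI)
qed

lemma elem_swap:
  assumes M: "subgroup M GG" "H \<subseteq> M" and b: "b < B" "b' < B"
    and pr: "p \<in> I" "r \<in> I" "p \<noteq> r" "elem p r \<in> M"
  shows "elem (swap_ix b b' p) (swap_ix b b' r) \<in> M"
proof -
  have "tv (sw b b' (basis_vec p)) (\<lambda>x. x (swap_ix b b' r)) \<in> M"
  proof (rule tv_conj_subgroup[OF M(1), where g = "sw b b'" and v = "basis_vec p" and \<theta> = "\<lambda>x. x r"
        and \<eta> = "\<lambda>x. x (swap_ix b b' r)"])
    show "tv (basis_vec p) (\<lambda>x. x r) \<in> M" using pr by (simp add: elem_def)
    show "sw b b' \<in> M" using M(2) sw_H[OF b] by blast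
    show "basis_vec p \<in> V" using pr by simp
    show "basis_vec p r = 0" using pr by (simp add: basis_vec_apply)
    show "sw b b' x (swap_ix b b' r) = x r" if "x \<in> V" for x using that by (simp add: sw_def)
  qed simp_all
  moreover have "sw b b' (basis_vec p) = basis_vec (swap_ix b b' p)"
  proof -
    have "basis_vec p (swap_ix b b' p') = basis_vec (swap_ix b b' p) p'" for p'
      using swap_ix_invol[of b b' p] swap_ix_invol[of b b' p'] unfolding basis_vec_def by metis
    thus ?thesis using V_closed(4)[OF pr(1)] by (simp add: sw_def)
  qed
  ultimately show ?thesis by (simp add: elem_def)
qed

text \<open>An element of \<open>M\<close> outside \<open>H\<close> throws some \<open>x\<close> of
  a block out of \<open>U\<close>, and conjugating a transvection of \<open>H\<close> with centre
  \<open>x\<close> puts into \<open>M\<close> one with centre \<open>w\<close> outside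
  \<open>U\<close>. By means of \<open>H\<close> the centre is reduced to a single block
  \<open>i\<close> and the axis to a coordinate of another block \<open>j\<close>. This yields all
  elementary matrices for one ordered pair of blocks; block swaps give the other pairs, and those
  within a block are in \<open>H\<close>.\<close>

lemma H_maximal:
  assumes M: "subgroup M GG" "H \<subseteq> M" shows "M = H \<or> M = GL"
proof (cases "M = H")
  case False
  then obtain g where g: "g \<in> M" "g \<notin> H" using M by blast
  have gG: "g \<in> GL" using subgroup.mem_carrier[OF M(1) g(1)] by simp
  obtain x where x: "x \<in> U" "g x \<notin> U" using HI[OF gG] g(2) by blast
  obtain b where b: "b < B" "x \<in> supported (blk b)" using UE x by blast
  have xV: "x \<in> V" using x U_V by blast
  obtain z where z: "z \<in> supported (blk b)" "z \<noteq> 0" "z \<noteq> x"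
    using ex_third[of "supported (blk b)" 0 x] card_blk[of b] by auto
  obtain \<phi> where \<phi>: "\<phi> \<in> functionals_on (blk b)" "\<phi> x = 0" "\<phi> z = 1"
    using separating_functional[OF b(2) z(1,2)] z(3) by blast
  have \<phi>d: "\<phi> \<in> dual" using \<phi>(1) by (rule dualI)
  have tM: "tv x \<phi> \<in> M" using tv_H[OF b \<phi>(1,2)] M(2) by blast
  define w where "w = g x"
  define \<psi> where "\<psi> = (\<lambda>y. \<phi> ((inv\<^bsub>GG\<^esub> g) y))"
  have \<psi>d: "\<psi> \<in> dual" unfolding \<psi>_def by (rule dual_comp[OF \<phi>d GL_inv[OF gG]])
  have \<psi>g: "\<psi> (g y) = \<phi> y" if "y \<in> V" for y using that gG GL_inv_apply(1) by (simp add: \<psi>_def)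
  have wM: "tv w \<psi> \<in> M" unfolding w_def
    using tv_conj_subgroup[OF M(1) tM g(1) xV \<phi>d \<phi>(2) \<psi>d] \<psi>g by blast
  have w: "w \<in> V" "\<psi> w = 0" "w \<notin> U" using x xV gG GL_V \<psi>g \<phi> by (auto simp: w_def)
  have zV: "z \<in> V" using blk_V[OF b(1) z(1)] .
  obtain q where q: "q \<in> I" "\<psi> (basis_vec q) = 1"
    using dual_nonzero_basis[OF \<psi>d GL_V[OF gG zV]] \<psi>g[OF zV] \<phi>(3) by auto
  define j where "j = fst q"
  have j: "j < B" "q \<in> blk j" using I_blk[OF q(1)] by (auto simp: j_def)
  \<comment> \<open>\<open>w\<close> lies in no single block, so it has a nonzero coordinate outside
    the block \<open>j\<close> that contains the \<open>q\<close> with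
    \<open>\<psi> (basis_vec q) = 1\<close>.\<close>
  have "\<exists>p\<in>I. w p = 1 \<and> fst p \<noteq> j"
  proof (rule ccontr)
    assume n: "\<not> ?thesis"
    have "w p = 0" if "p \<notin> blk j" for p
    proof (cases "p \<in> I")
      case True
      hence "w p \<noteq> 1" using n that I_blk[OF True] by auto
      thus ?thesis by simp
    next
      case False
      thus ?thesis using w(1) unfolding V_def supported_def by blast
    qed
    hence "w \<in> supported (blk j)" by (simp add: supported_def)
    thus False using w(3) UI[OF j(1)] by blast
  qed
  then obtain p where p: "p \<in> I" "w p = 1" "fst p \<noteq> j" by blast
  define i where "i = fst p"
  have i: "i < B" "p \<in> blk i" "j \<noteq> i" using I_blk[OF p(1)] p(3) by (auto simp: i_def)
  define wi where "wi = (\<lambda>r. if r \<in> blk i then w r else 0)"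
  have wi: "wi \<in> supported (blk i)" "wi \<noteq> 0"
  proof -
    show "wi \<in> supported (blk i)" by (simp add: wi_def supported_def)
    have "wi p = 1" using i p(2) by (simp add: wi_def)
    thus "wi \<noteq> 0" by (metis zero_fun_apply zero_neq_one)
  qed
  \<comment> \<open>The kernel of \<open>\<psi>\<close> on block \<open>i\<close> has at least eight
    elements, so it contains a \<open>d\<close> other than 0 and the part \<open>wi\<close> of
    \<open>w\<close>. Some functional on block \<open>i\<close> then vanishes at \<open>d\<close>
    but not at \<open>wi\<close>.\<close>
  have "card {y \<in> supported (blk i). \<psi> y = 0} \<ge> 3"
  proof -
    have "16 \<le> 2 * card {y \<in> supported (blk i). \<psi> y = 0}"
      using card_blk[of i] card_kernel_ge[of "supported (blk i)" \<psi>] dual_add[OF \<psi>d] blk_V[OF i(1)]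
      by (simp add: supported_add finite_supported blk_def)
    thus ?thesis by simp
  qed
  then obtain d where d: "d \<in> supported (blk i)" "\<psi> d = 0" "d \<noteq> 0" "d \<noteq> wi"
    using ex_third[of "{y \<in> supported (blk i). \<psi> y = 0}" 0 wi] by blast
  have dV: "d \<in> V" using blk_V[OF i(1) d(1)] .
  obtain \<eta> where \<eta>: "\<eta> \<in> functionals_on (blk i)" "\<eta> d = 0" "\<eta> wi = 1"
    using separating_functional[OF d(1) wi d(4)] by blast
  have "\<forall>r\<in>blk i. (w + wi) r = 0" by (simp add: wi_def)
  hence "\<eta> (w + wi) = 0" using \<eta>(1) unfolding functionals_on_def by blast
  hence "\<eta> w + \<eta> wi = 0" using \<eta>(1) by (simp add: functionals_on_def)
  hence \<eta>w: "\<eta> w = 1" using \<eta>(3) by (cases "\<eta> w") auto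
  \<comment> \<open>\<open>s\<close> lies in \<open>H\<close>, preserves \<open>\<psi>\<close> and
    adds \<open>d\<close> to \<open>w\<close>. The product of \<open>tv w \<psi>\<close> with its
    conjugate is therefore \<open>tv d \<psi>\<close>, whose centre is in one block.\<close>
  define s where "s = tv d \<eta>"
  have sM: "s \<in> M" using tv_H[OF i(1) d(1) \<eta>(1,2)] M(2) by (auto simp: s_def)
  have "\<psi> (s y) = \<psi> y" if "y \<in> V" for y
    using that dV d(2) by (simp add: s_def tv_apply dual_add[OF \<psi>d] dual_smul[OF \<psi>d])
  hence "tv (s w) \<psi> \<in> M" using tv_conj_subgroup[OF M(1) wM sM w(1) \<psi>d w(2) \<psi>d] by blast
  moreover have "s w = w + d" using w \<eta>w by (simp add: s_def tv_apply)
  ultimately have "tv w \<psi> \<otimes>\<^bsub>GG\<^esub> tv (w + d) \<psi> \<in> M" using subgroup.m_closed[OF M(1) wM] by metis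
  moreover have "tv w \<psi> \<otimes>\<^bsub>GG\<^esub> tv (w + d) \<psi> = tv (w + (w + d)) \<psi>"
    using w dV d(2) \<psi>d by (intro tv_mult) (auto simp: dual_add)
  ultimately have dM: "tv d \<psi> \<in> M" by (simp only: vec_cancel)
  have coord_r: "tv d (\<lambda>x. x r) \<in> M" if r: "r \<in> blk j" for r
  proof (cases "r = q")
    case False
    show ?thesis by (rule change_axis[OF M dM i(1) d(1) \<psi>d d(2) q(2) j(1) i(3) j(2) r False])
  next
    case True
    \<comment> \<open>\<open>change_axis\<close> cannot return the coordinate \<open>q\<close> it
      starts from, so the axis goes to another coordinate \<open>r'\<close> of the block first and
      from there to \<open>q\<close>.\<close>
    have "card (blk j) \<ge> 3" using a4 by (simp add: blk_def card_cartesian_product)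
    then obtain r' where r': "r' \<in> blk j" "r' \<noteq> q" using ex_third[of "blk j" q q] by blast
    have "tv d (\<lambda>x. x r') \<in> M"
      by (rule change_axis[OF M dM i(1) d(1) \<psi>d d(2) q(2) j(1) i(3) j(2) r'])
    moreover have "d r' = 0" using d(1) r' i(3) by (auto simp: supported_def blk_def)
    ultimately show ?thesis
      using change_axis[OF M _ i(1) d(1) coord_dual _ _ j(1) i(3) r'(1) r] True r'(2)
      by (simp add: basis_vec_apply)
  qed
  have el_ij: "elem p r \<in> M" if p: "p \<in> blk i" and r: "r \<in> blk j" for p r
  proof (cases "d = basis_vec p")
    case True
    thus ?thesis using coord_r[OF r] by (simp add: elem_def)
  next
    case False
    have ps: "basis_vec p \<in> supported (blk i)" "basis_vec p \<noteq> 0"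
      by (rule supported_basis[OF p], rule basis_vec_nonzero)
    obtain \<eta> where \<eta>: "\<eta> \<in> functionals_on (blk i)" "\<eta> d = 1" "\<eta> (basis_vec p) = 1"
      using common_functional[OF d(1) ps(1) d(3) ps(2)] by blast
    define s where "s = tv (d + basis_vec p) \<eta>"
    have "s \<in> H" unfolding s_def
      using i(1) d(1) ps(1) \<eta> by (intro tv_H[of i] supported_add) (auto simp: functionals_on_def)
    hence sM: "s \<in> M" using M(2) by blast
    have z: "(d + basis_vec p) r = 0" "d r = 0"
      using d(1) ps(1) r i(3) by (auto simp: supported_def blk_def)
    have "tv (s d) (\<lambda>x. x r) \<in> M"
    proof (rule tv_conj_subgroup[OF M(1) coord_r[OF r] sM dV coord_dual z(2) coord_dual])
      show "s x r = x r" if "x \<in> V" for x using that z(1) by (simp add: s_def tv_apply smul_def)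
    qed
    moreover have "s d = basis_vec p" using dV \<eta> by (simp add: s_def tv_apply)
    ultimately show ?thesis by (simp add: elem_def)
  qed
  have ne: "p \<noteq> r" if "p \<in> blk k" "r \<in> blk l" "k \<noteq> l" for p r k l using that blk_fst by blast
  have swap_blocks: "\<forall>p\<in>blk (Transposition.transpose b b' k). \<forall>r\<in>blk (Transposition.transpose b b' l). elem p r \<in> M"
    if kl: "\<forall>p\<in>blk k. \<forall>r\<in>blk l. elem p r \<in> M" "k < B" "l < B" "k \<noteq> l" and b: "b < B" "b' < B" for k l b b'
  proof (intro ballI)
    fix p r assume pr: "p \<in> blk (Transposition.transpose b b' k)" "r \<in> blk (Transposition.transpose b b' l)"
    define p' r' where "p' = swap_ix b b' p" and "r' = swap_ix b b' r"
    have p'r': "p' \<in> blk k" "r' \<in> blk l" using pr by (auto simp: p'_def r'_def swap_ix_blk)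
    have "elem (swap_ix b b' p') (swap_ix b b' r') \<in> M"
      using p'r' kl blk_I ne by (intro elem_swap[OF M b]) blast+
    thus "elem p r \<in> M" by (simp add: p'_def r'_def)
  qed
  have all: "\<forall>p\<in>blk k. \<forall>r\<in>blk l. elem p r \<in> M" if kl: "k < B" "l < B" "k \<noteq> l" for k l
  proof -
    \<comment> \<open>Swapping \<open>i\<close> and \<open>k\<close> takes the pair
      \<open>(i, j)\<close> to \<open>(k, l')\<close>; swapping \<open>l'\<close> and
      \<open>l\<close> then corrects the second block without touching \<open>k\<close>.\<close>
    define l' where "l' = Transposition.transpose i k j"
    have l': "l' < B" "l' \<noteq> k" using i j kl by (auto simp: l'_def Transposition.transpose_def)
    have 1: "\<forall>p\<in>blk k. \<forall>r\<in>blk l'. elem p r \<in> M"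
      using swap_blocks[of i j i k] el_ij i j kl by (simp add: l'_def)
    have "Transposition.transpose l' l k = k" using l' kl by (simp add: Transposition.transpose_def)
    thus ?thesis using swap_blocks[OF 1 kl(1) l'(1) l'(2)[symmetric] l'(1) kl(2)] by simp
  qed
  have "M = GL"
  proof (rule generated_by_elementary[OF M(1)])
    fix p r assume pr: "p \<in> I" "r \<in> I" "p \<noteq> r"
    note Ip = I_blk[OF pr(1)] and Ir = I_blk[OF pr(2)]
    show "elem p r \<in> M"
    proof (cases "fst p = fst r")
      case False
      thus ?thesis using all Ip Ir by blast
    next
      case True
      have "elem p r \<in> H" unfolding elem_def
        using Ip Ir True pr(3)
        by (intro tv_H[of "fst p"] supported_basis coordinate_functional) (auto simp: basis_vec_apply)
      thus ?thesis using M(2) by blast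
    qed
  qed
  thus ?thesis ..
qed simp

lemma H_proper: "H \<noteq> GL" "H \<noteq> {\<one>\<^bsub>GG\<^esub>}"
proof -
  let ?p = "(0, 0) :: nat \<times> nat" and ?r = "(1, 0) :: nat \<times> nat" and ?q = "(0, 1) :: nat \<times> nat"
  have I: "?p \<in> I" "?r \<in> I" "?q \<in> I" using B2 a4 by auto
  have G: "elem ?p ?r \<in> GL" unfolding elem_def using I by (intro tv_GL) (auto simp: basis_vec_apply)
  have "elem ?p ?r \<notin> H"
  proof
    assume "elem ?p ?r \<in> H"
    moreover have "basis_vec ?r \<in> U" using B2 a4 by (intro UI[of 1] supported_basis) (auto simp: blk_def)
    ultimately have "elem ?p ?r (basis_vec ?r) \<in> U" unfolding H_def by blast
    hence "basis_vec ?r + basis_vec ?p \<in> U"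
      using V_closed(4)[OF I(2)] by (simp add: elem_def tv_apply basis_vec_apply)
    then obtain b where "basis_vec ?r + basis_vec ?p \<in> supported (blk b)" using UE by blast
    hence "?r \<in> blk b" "?p \<in> blk b" unfolding supported_def basis_vec_def by (force, force)
    thus False by (simp add: blk_def)
  qed
  thus "H \<noteq> GL" using G by blast
  have "elem ?p ?q \<in> H" unfolding elem_def
    using B2 a4 by (intro tv_H[of 0] supported_basis coordinate_functional) (auto simp: blk_def basis_vec_apply)
  moreover have "elem ?p ?q \<noteq> \<one>\<^bsub>GG\<^esub>"
  proof
    assume "elem ?p ?q = \<one>\<^bsub>GG\<^esub>"
    hence "elem ?p ?q (basis_vec ?q) ?p = basis_vec ?q ?p"
      using act_one[OF V_closed(4)[OF I(3)]] by simp
    thus False using V_closed(4)[OF I(3)] by (simp add: elem_def tv_apply basis_vec_apply)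
  qed
  ultimately show "H \<noteq> {\<one>\<^bsub>GG\<^esub>}" by blast
qed

text \<open>An element of \<open>H\<close> is determined by the images of the \<open>B a\<close>
  basis vectors, each of which stays in \<open>U\<close>. The bound is crude, but the excess in the
  exponent of 2 is only linear in \<open>a\<close> for fixed \<open>B\<close>.\<close>

lemma card_H: "card H \<le> (B * 2 ^ a) ^ (B * a)"
proof -
  have "inj_on (\<lambda>g. \<lambda>i\<in>I. g (basis_vec i)) H"
  proof (rule inj_onI)
    fix g h assume gh: "g \<in> H" "h \<in> H" "(\<lambda>i\<in>I. g (basis_vec i)) = (\<lambda>i\<in>I. h (basis_vec i))"
    show "g = h"
    proof (rule GL_eq_basis)
      show "g \<in> GL" "h \<in> GL" using gh by (auto simp: H_def)
      show "g (basis_vec i) = h (basis_vec i)" if "i \<in> I" for i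
        using fun_cong[OF gh(3), of i] that by (simp del: mem_Sigma_iff)
    qed
  qed
  moreover have "(\<lambda>g. \<lambda>i\<in>I. g (basis_vec i)) ` H \<subseteq> I \<rightarrow>\<^sub>E U"
  proof (intro image_subsetI PiE_I)
    fix g i assume g: "g \<in> H" and i: "i \<in> I"
    have "basis_vec i \<in> U" using I_blk[OF i] by (intro UI[of "fst i"] supported_basis) auto
    hence "g (basis_vec i) \<in> U" using g by (auto simp: H_def)
    thus "(\<lambda>i\<in>I. g (basis_vec i)) i \<in> U" using i by (simp del: mem_Sigma_iff)
  qed (simp del: mem_Sigma_iff)
  ultimately have "card H \<le> card (I \<rightarrow>\<^sub>E U)"
    using finite_U by (intro card_inj_on_le[of _ H]) (auto intro!: finite_PiE)
  also have "\<dots> = card U ^ (B * a)" by (simp add: card_PiE card_cartesian_product)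
  also have "\<dots> \<le> (B * 2 ^ a) ^ (B * a)"
  proof (rule power_mono)
    have "card U \<le> (\<Sum>b<B. card (supported (blk b)))" unfolding U_def by (rule card_UN_le) simp
    also have "\<dots> = B * 2 ^ a" by (simp add: card_supported blk_def card_cartesian_product)
    finally show "card U \<le> B * 2 ^ a" .
  qed simp
  finally show ?thesis .
qed

end

text \<open>A rank normal form for \<open>T\<close>, found by splitting off one vector from the kernels of a
  functional \<open>\<theta>\<close> on \<open>W2\<close> and of its pullback \<open>\<theta> \<circ> T\<close> on \<open>W1\<close>.\<close>

lemma adapted_families:
  fixes W1 W2 :: "('i \<Rightarrow> bit) set"
  assumes "finite Q" "finite W1" "finite W2" "card W1 = 2 ^ card Q" "card W2 = 2 ^ card Q"
    and "0 \<in> W1" "0 \<in> W2" "\<And>x y. \<lbrakk>x \<in> W1; y \<in> W1\<rbrakk> \<Longrightarrow> x + y \<in> W1" "\<And>x y. \<lbrakk>x \<in> W2; y \<in> W2\<rbrakk> \<Longrightarrow> x + y \<in> W2"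
    and T: "\<And>x y. T (x + y) = T x + T y" and "\<And>x. x \<in> W1 \<Longrightarrow> T x \<in> W2"
  shows "\<exists>y x. (\<forall>q\<in>Q. y q \<in> W1 \<and> x q \<in> W2 \<and> (T (y q) = 0 \<or> T (y q) = x q)) \<and>
    (\<forall>w\<in>W1. \<exists>A\<subseteq>Q. w = sum y A) \<and> (\<forall>w\<in>W2. \<exists>A\<subseteq>Q. w = sum x A)"
  using assms(1-9,11)
proof (induction Q arbitrary: W1 W2)
  case empty
  hence "card W1 = 1" "card W2 = 1" by auto
  hence W: "W1 = {0}" "W2 = {0}" using empty.prems(5,6) by (auto simp: card_1_singleton_iff)
  have "\<exists>A\<subseteq>{}. w = sum f A" if "w \<in> {0}" for w and f :: "_ \<Rightarrow> 'i \<Rightarrow> bit"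
    using that by (intro exI[of _ "{}"]) (simp only: sum.empty singleton_iff subset_refl simp_thms)
  thus ?case unfolding W by blast
next
  case (insert q Q)
  have big: "\<exists>v\<in>W. v \<noteq> 0" if "card W = 2 ^ card (insert q Q)" "finite W" for W :: "('i \<Rightarrow> bit) set"
  proof (rule ccontr)
    assume "\<not> ?thesis"
    hence "W \<subseteq> {0}" by blast
    hence "card W \<le> 1" using card_mono[of "{0}" W] by simp
    moreover have "card W \<ge> 2" using that insert.hyps by simp
    ultimately show False by simp
  qed
  have nz: "\<exists>i. v i = 1" if "v \<noteq> 0" for v :: "'i \<Rightarrow> bit" using that by (auto simp: fun_eq_iff)
  \<comment> \<open>The last condition lets \<open>T\<close> map the kernel of
    \<open>\<theta>1\<close> into that of \<open>\<theta>2\<close>, as the induction requires. If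
    \<open>T\<close> is nonzero on \<open>W1\<close>, then \<open>x0 = T y0\<close> and
    \<open>\<theta>1\<close> is \<open>\<theta>2\<close> after \<open>T\<close>; if it vanishes
    there, the two vectors can be chosen independently.\<close>
  have "\<exists>y0\<in>W1. \<exists>x0\<in>W2. \<exists>\<theta>1 \<theta>2. \<theta>1 y0 = 1 \<and> \<theta>2 x0 = 1 \<and> (T y0 = 0 \<or> T y0 = x0) \<and>
      (\<forall>x y. \<theta>1 (x + y) = \<theta>1 x + (\<theta>1 y :: bit)) \<and> (\<forall>x y. \<theta>2 (x + y) = \<theta>2 x + (\<theta>2 y :: bit)) \<and>
      (\<forall>w\<in>W1. \<theta>1 w = 0 \<longrightarrow> \<theta>2 (T w) = 0)"
  proof (cases "\<exists>y\<in>W1. T y \<noteq> 0")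
    case True
    then obtain y0 where y0: "y0 \<in> W1" "T y0 \<noteq> 0" by blast
    then obtain i where i: "T y0 i = 1" using nz by blast
    show ?thesis
      by (rule bexI[OF _ y0(1)], rule bexI[of _ "T y0"], rule exI[of _ "\<lambda>w. T w i"], rule exI[of _ "\<lambda>w. w i"])
        (use i insert.prems(9) y0 in \<open>auto simp: T\<close>)
  next
    case False
    obtain y0 where y0: "y0 \<in> W1" "y0 \<noteq> 0" using big[OF insert.prems(3,1)] by blast
    obtain x0 where x0: "x0 \<in> W2" "x0 \<noteq> 0" using big[OF insert.prems(4,2)] by blast
    obtain i j where ij: "y0 i = 1" "x0 j = 1" using nz y0 x0 by meson
    have T0: "T w j = 0" if "w \<in> W1" for w using False that by (metis zero_fun_apply)
    show ?thesis
      by (rule bexI[OF _ y0(1)], rule bexI[OF _ x0(1)], rule exI[of _ "\<lambda>w. w i"], rule exI[of _ "\<lambda>w. w j"])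
        (use ij False y0 T0 in \<open>auto\<close>)
  qed
  then obtain y0 x0 \<theta>1 \<theta>2 where y0: "y0 \<in> W1" "\<theta>1 y0 = 1" and x0: "x0 \<in> W2" "\<theta>2 x0 = 1"
    and Ty: "T y0 = 0 \<or> T y0 = x0"
    and \<theta>1: "\<And>x y. \<theta>1 (x + y) = \<theta>1 x + (\<theta>1 y :: bit)" and \<theta>2: "\<And>x y. \<theta>2 (x + y) = \<theta>2 x + (\<theta>2 y :: bit)"
    and ker: "\<And>w. \<lbrakk>w \<in> W1; \<theta>1 w = 0\<rbrakk> \<Longrightarrow> \<theta>2 (T w) = 0"
    by blast
  have zero: "\<theta>1 0 = 0" "\<theta>2 0 = 0" using \<theta>1[of 0 0] \<theta>2[of 0 0] by (simp_all only: add_0 bit_add_self)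
  define K1 where "K1 = {w \<in> W1. \<theta>1 w = 0}"
  define K2 where "K2 = {w \<in> W2. \<theta>2 w = 0}"
  have "card W1 = 2 * card K1" unfolding K1_def using insert.prems(1,7) \<theta>1 y0 by (intro card_kernel)
  hence c1: "card K1 = 2 ^ card Q" using insert.prems(3) insert.hyps by simp
  have "card W2 = 2 * card K2" unfolding K2_def using insert.prems(2,8) \<theta>2 x0 by (intro card_kernel)
  hence c2: "card K2 = 2 ^ card Q" using insert.prems(4) insert.hyps by simp
  have "\<exists>y x. (\<forall>q\<in>Q. y q \<in> K1 \<and> x q \<in> K2 \<and> (T (y q) = 0 \<or> T (y q) = x q)) \<and>
    (\<forall>w\<in>K1. \<exists>A\<subseteq>Q. w = sum y A) \<and> (\<forall>w\<in>K2. \<exists>A\<subseteq>Q. w = sum x A)"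
  proof (rule insert.IH[OF _ _ c1 c2])
    show "finite K1" "finite K2" using insert.prems(1,2) by (auto simp: K1_def K2_def)
    show "0 \<in> K1" "0 \<in> K2" unfolding K1_def K2_def using zero insert.prems(5,6) by blast+
    show "x + y \<in> K1" if "x \<in> K1" "y \<in> K1" for x y
    proof -
      have "x + y \<in> W1" using that by (intro insert.prems(7)) (auto simp: K1_def)
      moreover have "\<theta>1 (x + y) = 0" using that \<theta>1[of x y] by (simp add: K1_def)
      ultimately show ?thesis unfolding K1_def by blast
    qed
    show "x + y \<in> K2" if "x \<in> K2" "y \<in> K2" for x y
    proof -
      have "x + y \<in> W2" using that by (intro insert.prems(8)) (auto simp: K2_def)
      moreover have "\<theta>2 (x + y) = 0" using that \<theta>2[of x y] by (simp add: K2_def)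
      ultimately show ?thesis unfolding K2_def by blast
    qed
    show "T x \<in> K2" if "x \<in> K1" for x using that insert.prems(9) ker by (simp add: K1_def K2_def)
  qed
  then obtain y x where yx: "\<And>q. q \<in> Q \<Longrightarrow> y q \<in> K1 \<and> x q \<in> K2 \<and> (T (y q) = 0 \<or> T (y q) = x q)"
    and sp1: "\<And>w. w \<in> K1 \<Longrightarrow> \<exists>A\<subseteq>Q. w = sum y A" and sp2: "\<And>w. w \<in> K2 \<Longrightarrow> \<exists>A\<subseteq>Q. w = sum x A"
    by blast
  \<comment> \<open>A vector outside the kernel falls into it after adding \<open>v\<close>, so one
    further summand suffices.\<close>
  have span: "\<exists>A\<subseteq>insert q Q. w = sum (f(q := v)) A"
    if w: "w \<in> W" and add: "\<And>x y. \<lbrakk>x \<in> W; y \<in> W\<rbrakk> \<Longrightarrow> x + y \<in> W" and v: "v \<in> W" "\<theta> v = 1"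
      and \<theta>: "\<And>x y. \<theta> (x + y) = \<theta> x + (\<theta> y :: bit)"
      and sp: "\<And>w. \<lbrakk>w \<in> W; \<theta> w = 0\<rbrakk> \<Longrightarrow> \<exists>A\<subseteq>Q. w = sum f A"
    for w W v \<theta> and f :: "_ \<Rightarrow> 'i \<Rightarrow> bit"
  proof (cases "\<theta> w = 0")
    case True
    then obtain A where A: "A \<subseteq> Q" "w = sum f A" using sp w by blast
    have "sum (f(q := v)) A = sum f A" using A insert.hyps by (intro sum.cong) auto
    thus ?thesis using A by (intro exI[of _ A]) auto
  next
    case False
    hence "\<theta> (v + w) = 0" using v by (simp add: \<theta>)
    then obtain A where A: "A \<subseteq> Q" "v + w = sum f A" using sp[OF add[OF v(1) w]] by blast
    have "sum (f(q := v)) A = sum f A" using A insert.hyps by (intro sum.cong) auto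
    moreover have "q \<notin> A" "finite A" using A insert.hyps finite_subset by auto
    ultimately have "sum (f(q := v)) (insert q A) = v + (v + w)" by (simp add: A(2))
    thus ?thesis using A(1) by (intro exI[of _ "insert q A"]) (auto simp: insert_mono)
  qed
  show ?case
  proof (rule exI[of _ "y(q := y0)"], rule exI[of _ "x(q := x0)"], intro conjI ballI)
    fix p assume p: "p \<in> insert q Q"
    show "(y(q := y0)) p \<in> W1" "(x(q := x0)) p \<in> W2"
      "T ((y(q := y0)) p) = 0 \<or> T ((y(q := y0)) p) = (x(q := x0)) p"
      using p yx[of p] y0 x0 Ty by (auto simp: K1_def K2_def)
  next
    fix w assume w: "w \<in> W1"
    show "\<exists>A\<subseteq>insert q Q. w = sum (y(q := y0)) A"
      by (rule span[OF w insert.prems(7) y0 \<theta>1]) (use sp1 in \<open>auto simp: K1_def\<close>)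
  next
    fix w assume w: "w \<in> W2"
    show "\<exists>A\<subseteq>insert q Q. w = sum (x(q := x0)) A"
      by (rule span[OF w insert.prems(8) x0 \<theta>2]) (use sp2 in \<open>auto simp: K2_def\<close>)
  qed
qed

section \<open>The group of block unitriangular matrices as an intersecting set\<close>

locale even_block_gl2 = block_gl2 B "2 * c" for B c
begin

text \<open>The first halves of all blocks. \<open>sh\<close> matches them with the second halves
  inside the same block, which is what makes the normal form preserve blocks.\<close>

definition Xp :: "(nat \<times> nat) set" where "Xp = {..<B} \<times> {..<c}"
definition sh :: "nat \<times> nat \<Rightarrow> nat \<times> nat" where "sh q = (fst q, snd q + c)"

lemma Xp_I: "q \<in> Xp \<Longrightarrow> q \<in> I" "q \<in> Xp \<Longrightarrow> sh q \<in> I" by (auto simp: Xp_def sh_def)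
lemma finite_Xp: "finite Xp" by (simp add: Xp_def)
lemma card_Xp: "card Xp = B * c" by (simp add: Xp_def card_cartesian_product)
lemma sh_Xp: "q \<in> Xp \<Longrightarrow> sh q \<notin> Xp" by (auto simp: Xp_def sh_def)
lemma inj_sh: "inj_on sh Xp" by (auto simp: inj_on_def sh_def prod_eq_iff)
lemma I_cases: "p \<in> I \<Longrightarrow> p \<in> Xp \<or> p \<in> sh ` Xp"
proof -
  assume p: "p \<in> I"
  show ?thesis
  proof (cases "snd p < c")
    case True
    thus ?thesis using p by (cases p) (auto simp: Xp_def)
  next
    case False
    hence "p = sh (fst p, snd p - c)" "(fst p, snd p - c) \<in> Xp" using p by (cases p; auto simp: sh_def Xp_def)+
    thus ?thesis by blast
  qed
qed
lemma sh_blk: "\<lbrakk>q \<in> Xp; q \<notin> blk b\<rbrakk> \<Longrightarrow> sh q \<notin> blk b" by (auto simp: blk_def sh_def Xp_def)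

text \<open>The off-diagonal block with columns \<open>F q\<close>: it maps the basis vector at
  \<open>sh q\<close> to \<open>F q\<close> and vanishes on the span of the first halves. Thus
  \<open>uF F\<close> is the identity plus a map of square zero.\<close>

definition nF :: "(nat \<times> nat \<Rightarrow> nat \<times> nat \<Rightarrow> bit) \<Rightarrow> (nat \<times> nat \<Rightarrow> bit) \<Rightarrow> nat \<times> nat \<Rightarrow> bit" where
  "nF F x = (\<Sum>q\<in>Xp. smul (x (sh q)) (F q))"
definition uF :: "(nat \<times> nat \<Rightarrow> nat \<times> nat \<Rightarrow> bit) \<Rightarrow> (nat \<times> nat \<Rightarrow> bit) \<Rightarrow> nat \<times> nat \<Rightarrow> bit" where
  "uF F = (\<lambda>x\<in>V. x + nF F x)"

abbreviation "Fs \<equiv> Xp \<rightarrow>\<^sub>E supported Xp"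

lemma supported_sum: "(\<And>q. q \<in> A \<Longrightarrow> f q \<in> supported J) \<Longrightarrow> sum f A \<in> supported J"
  by (induction A rule: infinite_finite_induct) (auto simp: supported_add)

lemma nF_supported: "F \<in> Fs \<Longrightarrow> nF F x \<in> supported Xp"
  unfolding nF_def by (intro supported_sum supported_smul) auto

lemma supported_Xp_V: "x \<in> supported Xp \<Longrightarrow> x \<in> V"
proof -
  have "Xp \<subseteq> I" using Xp_I(1) by blast
  thus "x \<in> supported Xp \<Longrightarrow> x \<in> V" using supported_mono unfolding V_def by blast
qed

lemma nF_add: "nF F (x + y) = nF F x + nF F y"
  by (simp add: nF_def smul_add sum.distrib)

lemma nF_zero: assumes "x \<in> supported Xp" shows "nF F x = 0"
proof -
  have "x (sh q) = 0" if "q \<in> Xp" for q using assms sh_Xp[OF that] unfolding supported_def by blast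
  thus ?thesis by (simp add: nF_def)
qed

lemma nF_apply: "F \<in> Fs \<Longrightarrow> nF F x \<in> V" using nF_supported supported_Xp_V by blast

lemma uF_GL: assumes F: "F \<in> Fs" shows "uF F \<in> GL"
proof -
  have "uF F (uF F x) = x" if "x \<in> V" for x
    using that nF_apply[OF F, of x] nF_zero[OF nF_supported[OF F, of x], of F]
    by (simp add: uF_def nF_add add.assoc)
  moreover have "uF F x \<in> V" if "x \<in> V" for x using that nF_apply[OF F, of x] by (simp add: uF_def)
  ultimately have "bij_betw (uF F) V V" by (intro bij_betw_byWitness[of _ "uF F"]) auto
  thus ?thesis by (auto simp: GL_def Bij_def uF_def nF_add add_ac)
qed

text \<open>The composite of two maps \<open>nF F\<close> and \<open>nF G\<close> vanishes, so
  multiplication of the \<open>uF\<close> is addition of the off-diagonal blocks.\<close>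

lemma uF_mult:
  assumes F: "F \<in> Fs" and G: "G \<in> Fs"
  shows "uF F \<otimes>\<^bsub>GG\<^esub> uF G = uF (\<lambda>q\<in>Xp. F q + G q)" "(\<lambda>q\<in>Xp. F q + G q) \<in> Fs"
proof -
  show FG: "(\<lambda>q\<in>Xp. F q + G q) \<in> Fs" using F G by (auto intro!: supported_add)
  show "uF F \<otimes>\<^bsub>GG\<^esub> uF G = uF (\<lambda>q\<in>Xp. F q + G q)"
  proof (rule GL_eqI)
    show "uF F \<otimes>\<^bsub>GG\<^esub> uF G \<in> GL" "uF (\<lambda>q\<in>Xp. F q + G q) \<in> GL" using F G FG by (blast intro: GL_mult uF_GL)+
    fix x assume x: "x \<in> V"
    have "(uF F \<otimes>\<^bsub>GG\<^esub> uF G) x = uF F (uF G x)" using x F G by (intro GL_mult_apply uF_GL)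
    also have "\<dots> = x + nF G x + nF F x"
      using x nF_apply[OF G, of x] nF_zero[OF nF_supported[OF G, of x], of F] by (simp add: uF_def nF_add)
    also have "nF G x + nF F x = nF (\<lambda>q\<in>Xp. F q + G q) x"
      by (simp add: nF_def smul_add sum.distrib add.commute)
    hence "x + nF G x + nF F x = uF (\<lambda>q\<in>Xp. F q + G q) x" using x by (simp add: uF_def add.assoc)
    finally show "(uF F \<otimes>\<^bsub>GG\<^esub> uF G) x = uF (\<lambda>q\<in>Xp. F q + G q) x" .
  qed
qed

lemma uF_inv: assumes F: "F \<in> Fs" shows "inv\<^bsub>GG\<^esub> (uF F) = uF F"
proof (rule inv_equality)
  have "nF (\<lambda>q\<in>Xp. F q + F q) x = 0" for x by (simp add: nF_def)
  hence "uF (\<lambda>q\<in>Xp. F q + F q) = \<one>\<^bsub>GG\<^esub>" by (simp add: uF_def BijGroup_def)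
  thus "uF F \<otimes>\<^bsub>GG\<^esub> uF F = \<one>\<^bsub>GG\<^esub>" using uF_mult(1)[OF F F] by simp
qed (use uF_GL[OF F] in simp_all)

lemma uF_inj: "inj_on uF Fs"
proof (rule inj_onI)
  fix F G assume FG: "F \<in> Fs" "G \<in> Fs" "uF F = uF G"
  have "F q = G q" if q: "q \<in> Xp" for q
  proof -
    have ev: "nF K (basis_vec (sh q)) = K q" for K
    proof -
      have "nF K (basis_vec (sh q)) = (\<Sum>p\<in>Xp. if p = q then K p else 0)"
        unfolding nF_def using q inj_sh by (intro sum.cong) (auto simp: basis_vec_apply dest: inj_onD)
      thus ?thesis using q finite_Xp by (simp add: sum.delta)
    qed
    have "uF F (basis_vec (sh q)) = uF G (basis_vec (sh q))" using FG by simp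
    hence "basis_vec (sh q) + nF F (basis_vec (sh q)) = basis_vec (sh q) + nF G (basis_vec (sh q))"
      using V_closed(4)[OF Xp_I(2)[OF q]] by (simp add: uF_def)
    thus ?thesis by (simp add: ev)
  qed
  thus "F = G" using FG by (intro PiE_ext) auto
qed

lemma card_uF: "card (uF ` Fs) = 2 ^ ((B * c) * (B * c))"
proof -
  have "card (uF ` Fs) = card Fs" by (rule card_image[OF uF_inj])
  also have "\<dots> = (2 ^ (B * c)) ^ (B * c)"
    using finite_Xp by (simp add: card_PiE card_supported card_Xp)
  finally show ?thesis by (simp add: power_mult)
qed

text \<open>\<open>adapted_families\<close> provides vectors \<open>y q\<close> and
  \<open>x q\<close> with \<open>nF F (y q)\<close> either 0 or \<open>x q\<close>. Let
  \<open>g\<close> send the basis vectors at \<open>sh q\<close> and \<open>q\<close> to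
  \<open>y q\<close> and \<open>x q\<close>. Then the conjugate of \<open>uF F\<close> adds to the
  basis vector at \<open>sh q\<close> at most the one at \<open>q\<close>, which is in the same
  block.\<close>

lemma uF_conj_H:
  assumes F: "F \<in> Fs" shows "\<exists>g\<in>GL. inv\<^bsub>GG\<^esub> g \<otimes>\<^bsub>GG\<^esub> uF F \<otimes>\<^bsub>GG\<^esub> g \<in> H"
proof -
  let ?W1 = "supported (sh ` Xp)" and ?W2 = "supported Xp"
  have csh: "card (sh ` Xp) = card Xp" by (rule card_image[OF inj_sh])
  have "\<exists>y x. (\<forall>q\<in>Xp. y q \<in> ?W1 \<and> x q \<in> ?W2 \<and> (nF F (y q) = 0 \<or> nF F (y q) = x q)) \<and>
    (\<forall>w\<in>?W1. \<exists>A\<subseteq>Xp. w = sum y A) \<and> (\<forall>w\<in>?W2. \<exists>A\<subseteq>Xp. w = sum x A)"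
    by (rule adapted_families[OF finite_Xp _ _ _ _ supported_zero supported_zero supported_add
          supported_add nF_add nF_supported[OF F]])
      (use finite_Xp csh in \<open>simp_all add: card_supported finite_supported\<close>)
  then obtain y x where yx: "\<And>q. q \<in> Xp \<Longrightarrow> y q \<in> ?W1" "\<And>q. q \<in> Xp \<Longrightarrow> x q \<in> ?W2"
      "\<And>q. q \<in> Xp \<Longrightarrow> nF F (y q) = 0 \<or> nF F (y q) = x q"
    and sp1: "\<And>w. w \<in> ?W1 \<Longrightarrow> \<exists>A\<subseteq>Xp. w = sum y A" and sp2: "\<And>w. w \<in> ?W2 \<Longrightarrow> \<exists>A\<subseteq>Xp. w = sum x A"
    by blast
  have "sh ` Xp \<subseteq> I" using Xp_I(2) by blast
  hence W1V: "v \<in> V" if "v \<in> ?W1" for v using that supported_mono unfolding V_def by blast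
  define gg where "gg v = (\<Sum>q\<in>Xp. smul (v q) (x q) + smul (v (sh q)) (y q))" for v
  define g where "g = (\<lambda>v\<in>V. gg v)"
  have gadd: "gg (v + w) = gg v + gg w" for v w
    unfolding gg_def sum.distrib[symmetric] by (intro sum.cong) (auto simp: smul_add add_ac)
  have gV: "gg v \<in> V" for v
    unfolding gg_def V_def
    using yx W1V supported_Xp_V by (intro supported_sum) (auto simp: V_def intro!: supported_add supported_smul)
  \<comment> \<open>The \<open>x q\<close> span the vectors on the first halves and the
    \<open>y q\<close> those on the second halves, so \<open>g\<close> is onto; on a finite set it
    is then injective as well.\<close>
  have surj: "\<exists>t\<in>V. gg t = v" if v: "v \<in> V" for v
  proof -
    define v2 where "v2 = (\<lambda>p. if p \<in> Xp then v p else 0)"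
    define v1 where "v1 = v + v2"
    have v2: "v2 \<in> ?W2" by (simp add: v2_def supported_def)
    have "v1 p = 0" if "p \<notin> sh ` Xp" for p
    proof (cases "p \<in> Xp")
      case False
      hence "p \<notin> I" using I_cases that by blast
      hence "v p = 0" using v unfolding V_def supported_def by blast
      thus ?thesis using False by (simp add: v1_def v2_def)
    qed (simp add: v1_def v2_def)
    hence v1: "v1 \<in> ?W1" by (simp add: supported_def)
    obtain A1 where A1: "A1 \<subseteq> Xp" "v1 = sum y A1" using sp1[OF v1] by blast
    obtain A2 where A2: "A2 \<subseteq> Xp" "v2 = sum x A2" using sp2[OF v2] by blast
    define t where "t p = (if p \<in> A2 \<or> p \<in> sh ` A1 then 1 else 0 :: bit)" for p
    have tX: "t q = (if q \<in> A2 then 1 else 0)" "t (sh q) = (if q \<in> A1 then 1 else 0)" if q: "q \<in> Xp" for q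
    proof -
      have "q \<notin> sh ` A1" using A1(1) sh_Xp q by blast
      thus "t q = (if q \<in> A2 then 1 else 0)" by (simp add: t_def)
      have "sh q \<notin> A2" using A2(1) sh_Xp q by blast
      moreover have "sh q \<in> sh ` A1 \<longleftrightarrow> q \<in> A1" using inj_on_image_mem_iff[OF inj_sh q A1(1)] .
      ultimately show "t (sh q) = (if q \<in> A1 then 1 else 0)" by (simp add: t_def)
    qed
    have "t p = 0" if "p \<notin> I" for p
    proof -
      have "p \<notin> A2" "p \<notin> sh ` A1" using that A1(1) A2(1) Xp_I by blast+
      thus ?thesis by (simp add: t_def)
    qed
    hence tV: "t \<in> V" by (simp add: V_def supported_def)
    have s2: "(\<Sum>q\<in>Xp. smul (t q) (x q)) = sum x A2"
    proof -
      have "(\<Sum>q\<in>Xp. smul (t q) (x q)) = (\<Sum>q\<in>Xp. if q \<in> A2 then x q else 0)"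
        by (intro sum.cong) (auto simp: tX)
      also have "\<dots> = sum x (Xp \<inter> A2)" using finite_Xp by (simp add: sum.inter_restrict)
      also have "Xp \<inter> A2 = A2" using A2 by blast
      finally show ?thesis .
    qed
    have s1: "(\<Sum>q\<in>Xp. smul (t (sh q)) (y q)) = sum y A1"
    proof -
      have "(\<Sum>q\<in>Xp. smul (t (sh q)) (y q)) = (\<Sum>q\<in>Xp. if q \<in> A1 then y q else 0)"
        by (intro sum.cong) (auto simp: tX)
      also have "\<dots> = sum y (Xp \<inter> A1)" using finite_Xp by (simp add: sum.inter_restrict)
      also have "Xp \<inter> A1 = A1" using A1 by blast
      finally show ?thesis .
    qed
    have "gg t = v2 + v1" unfolding gg_def sum.distrib s1 s2 by (simp only: A1(2) A2(2))
    also have "\<dots> = v" by (simp add: v1_def add_ac)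
    finally show ?thesis using tV by blast
  qed
  have gim: "g ` V = V"
  proof (intro subset_antisym subsetI)
    fix v assume "v \<in> g ` V" thus "v \<in> V" using gV by (auto simp: g_def)
  next
    fix v assume v: "v \<in> V"
    then obtain t where "t \<in> V" "gg t = v" using surj by blast
    thus "v \<in> g ` V" by (intro image_eqI[of _ _ t]) (simp_all add: g_def)
  qed
  hence "inj_on g V" using finite_V by (intro eq_card_imp_inj_on) simp_all
  hence gG: "g \<in> GL" using gim gadd by (simp add: GL_def Bij_def bij_betw_def g_def)
  have nF_sum: "nF F (sum f A) = (\<Sum>q\<in>A. nF F (f q))" for f and A :: "(nat \<times> nat) set"
  proof -
    have "nF F 0 = 0" by (rule nF_zero) simp
    from sum_comp_morphism[of "nF F", OF this nF_add, of f A] show ?thesis by (simp add: o_def)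
  qed
  define e where "e q = (if nF F (y q) = 0 then 0 else 1 :: bit)" for q
  have e: "nF F (y q) = smul (e q) (x q)" if "q \<in> Xp" for q using yx(3)[OF that] by (auto simp: e_def)
  have "inv\<^bsub>GG\<^esub> g \<otimes>\<^bsub>GG\<^esub> uF F \<otimes>\<^bsub>GG\<^esub> g \<in> H"
  proof (rule HI)
    have uG: "uF F \<in> GL" using uF_GL[OF F] .
    show "inv\<^bsub>GG\<^esub> g \<otimes>\<^bsub>GG\<^esub> uF F \<otimes>\<^bsub>GG\<^esub> g \<in> GL" using gG uG by (intro GL_mult GL_inv)
    fix v assume v: "v \<in> U"
    then obtain b where b: "b < B" "v \<in> supported (blk b)" using UE by blast
    have vV: "v \<in> V" using v U_V by blast
    \<comment> \<open>The image of \<open>v\<close> under \<open>nF F\<close> in the new basis: the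
      entry at \<open>sh q\<close> moves to \<open>q\<close> if \<open>e q = 1\<close> and is
      dropped otherwise. Hence \<open>v'\<close> stays in the block of \<open>v\<close>.\<close>
    define v' where "v' p = (if p \<in> Xp then v (sh p) * e p else 0)" for p
    have v'b: "v' \<in> supported (blk b)"
      unfolding supported_def mem_Collect_eq
    proof (intro allI impI)
      fix p assume p: "p \<notin> blk b"
      show "v' p = 0"
      proof (cases "p \<in> Xp")
        case True
        hence "v (sh p) = 0" using b(2) sh_blk[OF True p] unfolding supported_def by blast
        thus ?thesis by (simp add: v'_def)
      qed (simp add: v'_def)
    qed
    have v'V: "v' \<in> V" using blk_V[OF b(1) v'b] .
    have v'Y: "v' (sh q) = 0" if "q \<in> Xp" for q using sh_Xp[OF that] by (simp add: v'_def)
    have nsm: "nF F (smul s z) = smul s (nF F z)" for s z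
      using nF_zero[of 0 F] by (cases "s = 1") auto
    have "nF F (gg v) = (\<Sum>q\<in>Xp. smul (v' q) (x q) + smul (v' (sh q)) (y q))"
      unfolding gg_def nF_sum
    proof (intro sum.cong refl)
      fix q assume q: "q \<in> Xp"
      have "nF F (smul (v q) (x q) + smul (v (sh q)) (y q)) = smul (v (sh q)) (smul (e q) (x q))"
        using nF_zero[OF yx(2)[OF q]] e[OF q] by (simp add: nF_add nsm)
      also have "\<dots> = smul (v' q) (x q)" using q by (simp add: v'_def smul_def fun_eq_iff mult.assoc)
      finally show "nF F (smul (v q) (x q) + smul (v (sh q)) (y q)) = smul (v' q) (x q) + smul (v' (sh q)) (y q)"
        using v'Y[OF q] by simp
    qed
    hence "nF F (gg v) = gg v'" by (simp add: gg_def)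
    hence ug: "uF F (g v) = g (v + v')" using vV v'V gV by (simp add: uF_def g_def gadd)
    have "(inv\<^bsub>GG\<^esub> g \<otimes>\<^bsub>GG\<^esub> uF F \<otimes>\<^bsub>GG\<^esub> g) v = (inv\<^bsub>GG\<^esub> g \<otimes>\<^bsub>GG\<^esub> uF F) (g v)"
      using gG uG vV by (intro GL_mult_apply GL_mult GL_inv)
    also have "\<dots> = (inv\<^bsub>GG\<^esub> g) (uF F (g v))" using gG uG GL_V[OF gG vV] by (intro GL_mult_apply GL_inv)
    also have "\<dots> = v + v'" unfolding ug using vV v'V by (intro GL_inv_apply(1)[OF gG]) simp
    finally show "(inv\<^bsub>GG\<^esub> g \<otimes>\<^bsub>GG\<^esub> uF F \<otimes>\<^bsub>GG\<^esub> g) v \<in> U"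
      using UI[OF b(1) supported_add[OF b(2) v'b]] by simp
  qed
  thus ?thesis using gG by blast
qed

end

section \<open>Groups of unbounded intersection density\<close>

lemma unbounded_examples:
  fixes r :: real
  shows "\<exists>(\<Gamma> :: nat set) A. finite_permutation_group \<Gamma> A \<and> primitive \<Gamma> A \<and>
           almost_simple (perm_grp \<Gamma> A) \<and> intersection_density \<Gamma> A > r"
    and "\<exists>(\<Delta> :: nat set) P. finite_permutation_group \<Delta> P \<and> primitive \<Delta> P \<and>
           product_action_type \<Delta> P \<and> intersection_density \<Delta> P > r"
proof -
  \<comment> \<open>\<open>primitive_examples\<close> asks for a bound of at least 1, so that the
    EKR alternative is excluded.\<close>
  define s where "s = max 1 r"
  obtain c0 :: nat where c0: "s < real c0" using reals_Archimedean2 by blast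
  \<comment> \<open>7 is the least positive \<open>c\<close> with
    \<open>20 c^2 + 31 c + 1 \<le> 25 c^2\<close>, the comparison of exponents below.\<close>
  define c where "c = max 7 c0"
  have c: "c \<ge> 7" "s < real c" using c0 by (auto simp: c_def)
  interpret even_block_gl2 5 c using c by unfold_locales auto
  have dens: "real (card (uF ` Fs)) / real (card H) \<ge> 2 * real c"
  proof -
    \<comment> \<open>Replacing the factor 5 by \<open>2 ^ 3\<close> bounds \<open>card H\<close> by
      a power of two with exponent \<open>20 c^2 + 30 c\<close>. The desired quotient
      \<open>2 c\<close> is at most \<open>2 ^ Suc c\<close> and adds \<open>c + 1\<close>.\<close>
    have "(5::nat) * 2 ^ (2 * c) \<le> 2 ^ 3 * 2 ^ (2 * c)" by (intro mult_right_mono) auto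
    also have "\<dots> = 2 ^ (2 * c + 3)" by (simp add: power_add)
    finally have "((5::nat) * 2 ^ (2 * c)) ^ (5 * (2 * c)) \<le> (2 ^ (2 * c + 3)) ^ (5 * (2 * c))"
      by (intro power_mono) auto
    with card_H have "card H \<le> (2 ^ (2 * c + 3)) ^ (5 * (2 * c))" by simp
    also have "\<dots> = 2 ^ ((2 * c + 3) * (5 * (2 * c)))" by (simp only: power_mult)
    finally have H: "card H \<le> 2 ^ ((2 * c + 3) * (5 * (2 * c)))" .
    have "2 * c * card H \<le> 2 ^ (Suc c) * 2 ^ ((2 * c + 3) * (5 * (2 * c)))"
    proof (rule mult_mono[OF _ H])
      have "c < 2 ^ c" by (rule less_exp)
      thus "2 * c \<le> 2 ^ Suc c" by simp
    qed simp_all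
    also have "\<dots> = 2 ^ (Suc c + (2 * c + 3) * (5 * (2 * c)))" by (simp only: power_add)
    also have "\<dots> \<le> 2 ^ ((5 * c) * (5 * c))"
    proof (rule power_increasing)
      have "7 * c \<le> c * c" using c(1) by (intro mult_le_mono1)
      moreover have "Suc c + (2 * c + 3) * (5 * (2 * c)) = 20 * (c * c) + 31 * c + 1" by (simp add: algebra_simps)
      moreover have "(5 * c) * (5 * c) = 25 * (c * c)" by simp
      ultimately show "Suc c + (2 * c + 3) * (5 * (2 * c)) \<le> (5 * c) * (5 * c)" using c(1) by linarith
    qed simp
    also have "\<dots> = card (uF ` Fs)" by (simp add: card_uF)
    finally have "real (2 * c * card H) \<le> real (card (uF ` Fs))" by (simp only: of_nat_le_iff)
    moreover have "card H > 0" using H_subgroup finite_carrier by (rule subgroup.finite_imp_card_positive)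
    ultimately show ?thesis by (simp add: field_simps)
  qed
  have s1: "s \<ge> 1" by (simp add: s_def)
  define q where "q = real (card (uF ` Fs)) / real (card H)"
  \<comment> \<open>The surplus factor 2 compensates for the halving in the wreath product:
    \<open>q > 2 s\<close> and \<open>s \<ge> 1\<close> give \<open>q^2 > 2 s\<close>.\<close>
  have q: "q > 2 * s" using dens c(2) by (simp add: q_def)
  have "2 * s \<le> q * 2" using q s1 by simp
  also have "q * 2 < q * q" using q s1 by (intro mult_strict_left_mono) auto
  finally have q2: "q\<^sup>2 / 2 > s" by (simp add: power2_eq_square)
  have q1: "q > s" using q s1 by simp
  have I4: "card ({..<5::nat} \<times> {..<2 * c}) \<ge> 4" using c(1) by (simp add: card_cartesian_product)
  have Y: "\<exists>g\<in>carrier GG. inv\<^bsub>GG\<^esub> g \<otimes>\<^bsub>GG\<^esub> (x \<otimes>\<^bsub>GG\<^esub> inv\<^bsub>GG\<^esub> y) \<otimes>\<^bsub>GG\<^esub> g \<in> H"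
    if xy: "x \<in> uF ` Fs" "y \<in> uF ` Fs" for x y
  proof -
    obtain F G where FG: "F \<in> Fs" "G \<in> Fs" "x = uF F" "y = uF G" using xy by blast
    have "x \<otimes>\<^bsub>GG\<^esub> inv\<^bsub>GG\<^esub> y = uF (\<lambda>q\<in>Xp. F q + G q)"
      unfolding FG(3,4) uF_inv[OF FG(2)] by (rule uF_mult(1)[OF FG(1,2)])
    thus ?thesis using uF_conj_H[OF uF_mult(2)[OF FG(1,2)]] by simp
  qed
  have H: "H \<noteq> carrier GG" "H \<noteq> {\<one>\<^bsub>GG\<^esub>}" using H_proper by auto
  have max: "M = H \<or> M = carrier GG" if "subgroup M GG" "H \<subseteq> M" for M using H_maximal[OF that] by simp
  have YG: "uF ` Fs \<subseteq> carrier GG" using uF_GL by auto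
  note ex = primitive_examples[OF finite_carrier GL_nonabelian_simple[OF I4] H_subgroup H max YG Y
      q1[unfolded q_def] q2[unfolded q_def] s1]
  have rs: "r \<le> s" by (simp add: s_def)
  show "\<exists>(\<Gamma> :: nat set) A. finite_permutation_group \<Gamma> A \<and> primitive \<Gamma> A \<and>
           almost_simple (perm_grp \<Gamma> A) \<and> intersection_density \<Gamma> A > r"
    using ex(1) rs by (meson order.strict_trans1)
  show "\<exists>(\<Delta> :: nat set) P. finite_permutation_group \<Delta> P \<and> primitive \<Delta> P \<and>
           product_action_type \<Delta> P \<and> intersection_density \<Delta> P > r"
    using ex(2) rs by (meson order.strict_trans1)
qed

theorem theorem1p4:
  shows
    "(\<forall>(\<Omega> :: 'a set) G. finite_permutation_group \<Omega> G \<and> quasiprimitive \<Omega> G \<longrightarrow>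
        (intersection_density \<Omega> G = 1 \<and> EKR_property \<Omega> G) \<or>
        (almost_simple (perm_grp \<Omega> G) \<or> product_action_type \<Omega> G))
     \<and>
     (\<forall>M :: real. M > 0 \<longrightarrow>
        (\<exists>(\<Gamma> :: nat set) A. finite_permutation_group \<Gamma> A \<and> primitive \<Gamma> A \<and>
           almost_simple (perm_grp \<Gamma> A) \<and> intersection_density \<Gamma> A > M) \<and>
        (\<exists>(\<Delta> :: nat set) P. finite_permutation_group \<Delta> P \<and> primitive \<Delta> P \<and>
           product_action_type \<Delta> P \<and> intersection_density \<Delta> P > M))"
proof (intro conjI allI impI)
  fix \<Omega> :: "'a set" and G
  assume a: "finite_permutation_group \<Omega> G \<and> quasiprimitive \<Omega> G"
  then interpret perm_group \<Omega> G by unfold_locales simp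
  show "(intersection_density \<Omega> G = 1 \<and> EKR_property \<Omega> G) \<or>
      (almost_simple (perm_grp \<Omega> G) \<or> product_action_type \<Omega> G)"
    using a by (intro quasiprimitive_cases) simp
qed (rule unbounded_examples)+

end
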